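(* Let $|\mathcal U|\ge5$ and let $\mathcal D\subseteq\mathcal R$ be a rich domain. An anonymous social welfare function $f\colon\mathcal D^N\to\mathcal R$ is Arrovian if and only if $f$ is the utilitarian social welfare function and $\mathcal D\subseteq\mathcal R^{pc}$.
   Context: Outcomes. $\mathcal U$ is a non-empty finite set of alternatives; $\Delta$ is the set of all probability measures on $\mathcal U$, with the Euclidean topology inherited from $\mathbb R^{\mathcal U}$. Each $a\in\mathcal U$ is identified with the point mass on $a$ (a pure outcome). For $X\subseteq\mathcal U$, $\Delta_X=\{p\in\Delta: p(X)=1\}$. For $p,q\in\Delta$, $\lambda\in[0,1]$, $p\lambda q=\lambda p+(1-\lambda)q$. Preferences. A preference relation is an asymmetric binary relation $\succ$ on $\Delta$; $p\sim q$ means neither $p\succ q$ nor $q\succ p$; $p\succsim q$ means $p\succ q$ or $p\sim q$. $U(p)=\{q: q\succ p\}$, $L(p)=\{q: p\succ q\}$, $I(p)=\{q: p\sim q\}$. For a set $X$ of outcomes, ${\succ}|_X=\{(p,q)\in{\succ}: p,q\in X\}$. $\mathcal R$ is the set of preference relations satisfying, for all $p$: (continuity) $U(p)$ and $L(p)$ are open in $\Delta$; (convexity) $U(p)$, $L(p)$, $U(p)\cup I(p)$, $L(p)\cup I(p)$ are convex; and (symmetry) for all $p,q,r\in\Delta$, $\lambda\in(0,1)$: if $q\sim\frac12p+\frac12r$ and $p\lambda r\sim\frac12p+\frac12q$, then $r\lambda p\sim\frac12r+\frac12q$. The empty relation $\emptyset$ is complete indifference. SSB functions. An SSB function is a map $\phi\colon\Delta\times\Delta\to\mathbb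 R$ with $\phi(p,q)=-\phi(q,p)$ that is linear (i.e. preserves convex combinations) in each argument; it represents $\succ$ (written ${\succ}\equiv\phi$) if $p\succ q\Leftrightarrow\phi(p,q)>0$ for all $p,q$. Every ${\succ}\in\mathcal R$ is represented by an SSB function, unique up to multiplication by a positive scalar. $\Phi$ is the set of SSB functions whose largest value is $1$, together with the zero function (which represents $\emptyset$). $\Phi^{pc}$ is the set of $\phi\in\Phi$ with $\phi(a,b)\in\{-1,0,1\}$ for all $a,b\in\mathcal U$, and $\mathcal R^{pc}=\{{\succ}\in\mathcal R: {\succ}\equiv\phi\text{ for some }\phi\in\Phi^{pc}\}$. Social welfare functions. $N=\{1,\dots,n\}$ with $n\ge2$ is the set of agents, $\mathcal D\subseteq\mathcal R$ a domain. A profile is $R=(\succ_1,\dots,\succ_n)\in\mathcal D^N$; restrictions $R|_X$ are componentwise. A social welfare function (SWF) is a map $f\colon\mathcal D^N\to\mathcal R$. It satisfies Pareto optimality if for all $p,q\in\Delta$, $R\in\mathcal D^N$ and ${\succ}=f(R)$: $p\succsim_iq$ for all $i\in N$ implies $p\succsim q$, and if additionally $p\succ_iq$ for some $i$ then $p\succ q$. It satisfies IIA if for all $R,\hat R\in\mathcal D^N$ and $X\subseteq\mathcal U$: $R|_{\Delta_X}=\hat R|_{\Delta_X}$ implies $f(R)|_{\Delta_X}=f(\hat R)|_{\Delta_X}$. It is Arrovian if it satisfies Pareto optimality and IIA. It is anonymous if $f(R)=f(R\circ\pi)$ for every $R\in\mathcal D^N$ and every permutation $\pi$ of $N$. The utilitarian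 SWF on $\mathcal D$ is the one with $f(R)\equiv\sum_{i\in N}\phi_i$ for all $R=(\succ_i)_{i\in N}\in\mathcal D^N$, where $\phi_i\in\Phi$ is the normalized function with ${\succ_i}\equiv\phi_i$. Rich domains. For a permutation $\pi$ of $\mathcal U$ and $p\in\Delta$, $p^\pi(\pi(a))=p(a)$; ${\succ}^\pi$ is defined by $p^\pi\succ^\pi q^\pi\Leftrightarrow p\succ q$. ${\succ}^{-1}$ is defined by $p\succ^{-1}q\Leftrightarrow q\succ p$. $\mathcal D\subseteq\mathcal R$ is rich if: (R1) for all ${\succ}\in\mathcal R$ and all permutations $\pi$ of $\mathcal U$, ${\succ}\in\mathcal D$ if and only if ${\succ}^\pi\in\mathcal D$; (R2) $\emptyset\in\mathcal D$; (R3) ${\succ}\in\mathcal D$ implies ${\succ}^{-1}\in\mathcal D$; (R4) for all ${\hat\succ}\in\mathcal D$ and all $X\subseteq\mathcal U$ with $|X|\le4$ there are ${\succ}\in\mathcal D$ and $a\in\mathcal U$ such that ${\succ}|_X={\hat\succ}|_X$ (restriction to the pure outcomes in $X$) and $x\succ a$ for all $x\in X$. *)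

theory Defs
  imports "HOL-Analysis.Analysis" "HOL-Combinatorics.Permutations"
begin

text \<open>
  The alternatives are the elements of a finite type \<open>'a\<close>; a probability measure on them is
  identified with its vector of point probabilities.
\<close>

definition outcomes :: "(real ^ 'a::finite) set" where
  "outcomes = {p. (\<forall>a. 0 \<le> p $ a) \<and> (\<Sum>a\<in>UNIV. p $ a) = 1}"

definition pure :: "'a::finite \<Rightarrow> real ^ 'a" where
  "pure a = axis a 1"

definition outcomes_on :: "'a::finite set \<Rightarrow> (real ^ 'a) set" where
  "outcomes_on X = {p \<in> outcomes. (\<Sum>a\<in>X. p $ a) = 1}"

definition mix :: "real ^ 'a::finite \<Rightarrow> real \<Rightarrow> real ^ 'a \<Rightarrow> real ^ 'a" where
  "mix p l q = l *\<^sub>R p + (1 - l) *\<^sub>R q"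

text \<open>
  A relation is the set of pairs \<open>(p, q)\<close> with \<open>p\<close> strictly preferred to \<open>q\<close>. Requiring it to be a
  subset of \<open>outcomes \<times> outcomes\<close> makes equality of relations agree with equality on outcomes.
\<close>

type_synonym 'a pref = "((real ^ 'a) \<times> (real ^ 'a)) set"

definition preference :: "'a::finite pref \<Rightarrow> bool" where
  "preference r \<longleftrightarrow> r \<subseteq> outcomes \<times> outcomes \<and> asym r"

definition indiff :: "'a::finite pref \<Rightarrow> real ^ 'a \<Rightarrow> real ^ 'a \<Rightarrow> bool" where
  "indiff r p q \<longleftrightarrow> (p, q) \<notin> r \<and> (q, p) \<notin> r"

definition weakly_prefers :: "'a::finite pref \<Rightarrow> real ^ 'a \<Rightarrow> real ^ 'a \<Rightarrow> bool" where
  "weakly_prefers r p q \<longleftrightarrow> (p, q) \<in> r \<or> indiff r p q"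

definition upper :: "'a::finite pref \<Rightarrow> real ^ 'a \<Rightarrow> (real ^ 'a) set" where
  "upper r p = {q \<in> outcomes. (q, p) \<in> r}"

definition lower :: "'a::finite pref \<Rightarrow> real ^ 'a \<Rightarrow> (real ^ 'a) set" where
  "lower r p = {q \<in> outcomes. (p, q) \<in> r}"

definition indiff_set :: "'a::finite pref \<Rightarrow> real ^ 'a \<Rightarrow> (real ^ 'a) set" where
  "indiff_set r p = {q \<in> outcomes. indiff r p q}"

definition restrict_rel :: "'b rel \<Rightarrow> 'b set \<Rightarrow> 'b rel" where
  "restrict_rel r X = r \<inter> X \<times> X"

definition continuous_pref :: "'a::finite pref \<Rightarrow> bool" where
  "continuous_pref r \<longleftrightarrow>
     (\<forall>p\<in>outcomes. openin (top_of_set outcomes) (upper r p) \<and>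
                   openin (top_of_set outcomes) (lower r p))"

definition convex_pref :: "'a::finite pref \<Rightarrow> bool" where
  "convex_pref r \<longleftrightarrow>
     (\<forall>p\<in>outcomes. convex (upper r p) \<and> convex (lower r p) \<and>
                   convex (upper r p \<union> indiff_set r p) \<and>
                   convex (lower r p \<union> indiff_set r p))"

definition symmetric_pref :: "'a::finite pref \<Rightarrow> bool" where
  "symmetric_pref r \<longleftrightarrow>
     (\<forall>p\<in>outcomes. \<forall>q\<in>outcomes. \<forall>s\<in>outcomes. \<forall>l\<in>{0<..<1}.
        indiff r q (mix p (1/2) s) \<longrightarrow>
        indiff r (mix p l s) (mix p (1/2) q) \<longrightarrow>
        indiff r (mix s l p) (mix s (1/2) q))"

definition prefs :: "'a::finite pref set" where
  "prefs = {r. preference r \<and> continuous_pref r \<and> convex_pref r \<and> symmetric_pref r}"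

text \<open>
  SSB functions are skew-symmetric and bilinear with respect to mixtures. They are functions on
  \<open>outcomes \<times> outcomes\<close>: values elsewhere are unconstrained and never used.
\<close>

definition ssb :: "(real ^ 'a::finite \<Rightarrow> real ^ 'a \<Rightarrow> real) \<Rightarrow> bool" where
  "ssb \<phi> \<longleftrightarrow>
     (\<forall>p\<in>outcomes. \<forall>q\<in>outcomes. \<phi> p q = - \<phi> q p) \<and>
     (\<forall>p\<in>outcomes. \<forall>q\<in>outcomes. \<forall>s\<in>outcomes. \<forall>l\<in>{0..1}.
        \<phi> (mix p l q) s = l * \<phi> p s + (1 - l) * \<phi> q s \<and>
        \<phi> s (mix p l q) = l * \<phi> s p + (1 - l) * \<phi> s q)"

definition represents :: "'a::finite pref \<Rightarrow> (real ^ 'a \<Rightarrow> real ^ 'a \<Rightarrow> real) \<Rightarrow> bool" where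
  "represents r \<phi> \<longleftrightarrow> (\<forall>p\<in>outcomes. \<forall>q\<in>outcomes. (p, q) \<in> r \<longleftrightarrow> \<phi> p q > 0)"

definition normalized_ssb :: "(real ^ 'a::finite \<Rightarrow> real ^ 'a \<Rightarrow> real) set" where
  "normalized_ssb =
     {\<phi>. ssb \<phi> \<and>
         ((\<exists>p\<in>outcomes. \<exists>q\<in>outcomes. \<phi> p q = 1) \<and> (\<forall>p\<in>outcomes. \<forall>q\<in>outcomes. \<phi> p q \<le> 1) \<or>
          (\<forall>p\<in>outcomes. \<forall>q\<in>outcomes. \<phi> p q = 0))}"

definition pc_ssb :: "(real ^ 'a::finite \<Rightarrow> real ^ 'a \<Rightarrow> real) set" where
  "pc_ssb = {\<phi> \<in> normalized_ssb. \<forall>a b. \<phi> (pure a) (pure b) \<in> {-1, 0, 1}}"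

definition pc_prefs :: "'a::finite pref set" where
  "pc_prefs = {r \<in> prefs. \<exists>\<phi>\<in>pc_ssb. represents r \<phi>}"

definition profiles :: "nat \<Rightarrow> 'a::finite pref set \<Rightarrow> (nat \<Rightarrow> 'a pref) set" where
  "profiles n D = {1..n} \<rightarrow>\<^sub>E D"

definition swf :: "nat \<Rightarrow> 'a::finite pref set \<Rightarrow> ((nat \<Rightarrow> 'a pref) \<Rightarrow> 'a pref) \<Rightarrow> bool" where
  "swf n D f \<longleftrightarrow> f \<in> profiles n D \<rightarrow> prefs"

definition pareto_optimal ::
    "nat \<Rightarrow> 'a::finite pref set \<Rightarrow> ((nat \<Rightarrow> 'a pref) \<Rightarrow> 'a pref) \<Rightarrow> bool" where
  "pareto_optimal n D f \<longleftrightarrow>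
     (\<forall>R\<in>profiles n D. \<forall>p\<in>outcomes. \<forall>q\<in>outcomes.
        (\<forall>i\<in>{1..n}. weakly_prefers (R i) p q) \<longrightarrow>
          weakly_prefers (f R) p q \<and>
          ((\<exists>i\<in>{1..n}. (p, q) \<in> R i) \<longrightarrow> (p, q) \<in> f R))"

definition iia :: "nat \<Rightarrow> 'a::finite pref set \<Rightarrow> ((nat \<Rightarrow> 'a pref) \<Rightarrow> 'a pref) \<Rightarrow> bool" where
  "iia n D f \<longleftrightarrow>
     (\<forall>R\<in>profiles n D. \<forall>R'\<in>profiles n D. \<forall>X.
        (\<forall>i\<in>{1..n}. restrict_rel (R i) (outcomes_on X) = restrict_rel (R' i) (outcomes_on X)) \<longrightarrow>
        restrict_rel (f R) (outcomes_on X) = restrict_rel (f R') (outcomes_on X))"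

definition arrovian :: "nat \<Rightarrow> 'a::finite pref set \<Rightarrow> ((nat \<Rightarrow> 'a pref) \<Rightarrow> 'a pref) \<Rightarrow> bool" where
  "arrovian n D f \<longleftrightarrow> pareto_optimal n D f \<and> iia n D f"

definition anonymous :: "nat \<Rightarrow> 'a::finite pref set \<Rightarrow> ((nat \<Rightarrow> 'a pref) \<Rightarrow> 'a pref) \<Rightarrow> bool" where
  "anonymous n D f \<longleftrightarrow>
     (\<forall>R\<in>profiles n D. \<forall>\<pi>. \<pi> permutes {1..n} \<longrightarrow> f R = f (R \<circ> \<pi>))"

text \<open>
  The normalized representation of a relation in \<open>prefs\<close> exists and its values on
  \<open>outcomes \<times> outcomes\<close> are unique, so the existential quantifier below merely names
  these functions.
\<close>

definition utilitarian :: "nat \<Rightarrow> 'a::finite pref set \<Rightarrow> ((nat \<Rightarrow> 'a pref) \<Rightarrow> 'a pref) \<Rightarrow> bool" where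
  "utilitarian n D f \<longleftrightarrow>
     (\<forall>R\<in>profiles n D. \<exists>\<phi>.
        (\<forall>i\<in>{1..n}. \<phi> i \<in> normalized_ssb \<and> represents (R i) (\<phi> i)) \<and>
        represents (f R) (\<lambda>p q. \<Sum>i\<in>{1..n}. \<phi> i p q))"

definition permute_outcome :: "('a \<Rightarrow> 'a) \<Rightarrow> real ^ 'a::finite \<Rightarrow> real ^ 'a" where
  "permute_outcome \<pi> p = (\<chi> b. p $ (inv \<pi> b))"

definition permute_pref :: "('a \<Rightarrow> 'a) \<Rightarrow> 'a::finite pref \<Rightarrow> 'a pref" where
  "permute_pref \<pi> r = map_prod (permute_outcome \<pi>) (permute_outcome \<pi>) ` r"

definition rich :: "'a::finite pref set \<Rightarrow> bool" where
  "rich D \<longleftrightarrow>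
     D \<subseteq> prefs \<and>
     (\<forall>r\<in>prefs. \<forall>\<pi>. \<pi> permutes UNIV \<longrightarrow> (r \<in> D \<longleftrightarrow> permute_pref \<pi> r \<in> D)) \<and>
     {} \<in> D \<and>
     (\<forall>r\<in>D. r\<inverse> \<in> D) \<and>
     (\<forall>r'\<in>D. \<forall>X. card X \<le> 4 \<longrightarrow>
        (\<exists>r\<in>D. \<exists>a. restrict_rel r (pure ` X) = restrict_rel r' (pure ` X) \<and>
                   (\<forall>x\<in>X. (pure x, pure a) \<in> r)))"

end

theory Submission
  imports Defs
begin

text \<open>
  Every preference relation is represented by a skew-symmetric matrix: an outcome in the interior of
  the simplex has a separating functional, the symmetry axiom makes the functionals along a line an
  affine family up to scaling, and this is the cocycle identity needed to rescale them
  skew-symmetrically.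

  For an anonymous Arrovian function, two agents with opposite signs on every pair of some set of
  alternatives cancel on that set. Pareto optimality then forbids any difference between their
  intensities, and suitable permutations and inverses of a single preference show that all its nonzero
  intensities are equal. To find the collective intensities, an alternative \<open>e\<close> ranked last by all
  agents is added as a common unit. In this unit, the intensity between two alternatives depends only
  on the sets \<open>P\<close> and \<open>Q\<close> of agents supporting either side, and one Pareto indifference gives
  \<open>v(P, Q) = v(P \<union> Q) - 2 v(Q)\<close>. Exchanging \<open>P\<close> and \<open>Q\<close> changes the sign, so \<open>v\<close> is additive, and by
  anonymity it counts agents.
\<close>

text \<open>A representing matrix is unique only up to a positive factor, so independence transfers
  collective intensities on a set \<open>X\<close> only up to a factor that may change with
  \<open>X\<close> and with the profiles. Intensities can be compared across profiles only inside
  sets that contain a common unit, and this forces the detour through \<open>e\<close>. The largest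
  sets used in this way are four alternatives together with \<open>e\<close>, both in the key
  profile and when two arbitrary entries of the collective matrix are compared at the end; here the
  bound 4 in richness and the five alternatives meet.

  The unknown factor is also the obstacle to the representation: a separating functional is known
  only up to a positive multiple, which has to be normalized away along a line before functionals at
  different outcomes can be compared.\<close>

section \<open>Mixtures of outcomes and elementary properties of relations\<close>

lemma outcomesD: "p \<in> outcomes \<Longrightarrow> 0 \<le> p $ a" "p \<in> outcomes \<Longrightarrow> (\<Sum>a\<in>UNIV. p $ a) = 1"
  by (auto simp: outcomes_def)

lemma mix_outcomes:
  "p \<in> outcomes \<Longrightarrow> q \<in> outcomes \<Longrightarrow> 0 \<le> l \<Longrightarrow> l \<le> 1 \<Longrightarrow> mix p l q \<in> outcomes"
  by (auto simp: outcomes_def mix_def sum.distrib simp flip: sum_distrib_left)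

lemma mix_commute: "mix p l q = mix q (1 - l) p"
  by (simp add: mix_def)

lemma mix_same [simp]: "mix p l p = p"
  by (simp add: mix_def flip: scaleR_add_left)

lemma mix_0 [simp]: "mix p 0 q = q" and mix_1 [simp]: "mix p 1 q = p"
  by (simp_all add: mix_def)

lemma mix_mix_right: "mix p l (mix p m q) = mix p (l + (1 - l) * m) q"
  by (simp add: mix_def vec_eq_iff algebra_simps)

lemma mix_mem_convex: "convex A \<Longrightarrow> p \<in> A \<Longrightarrow> q \<in> A \<Longrightarrow> 0 \<le> l \<Longrightarrow> l \<le> 1 \<Longrightarrow> mix p l q \<in> A"
  unfolding mix_def by (rule convexD) auto

lemma inner_mix: "v \<bullet> mix p l q = l * (v \<bullet> p) + (1 - l) * (v \<bullet> q)"
  by (simp add: mix_def inner_add_right)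

lemma openin_near:
  assumes "openin (top_of_set S) A" "q \<in> A"
  shows "\<exists>d>0. \<forall>x\<in>S. dist x q < d \<longrightarrow> x \<in> A"
  using assms by (auto simp: openin_euclidean_subtopology_iff)

lemma dist_mix: "dist (mix s l q) q = \<bar>l\<bar> * norm (s - q)"
proof -
  have "mix s l q - q = l *\<^sub>R (s - q)" by (simp add: mix_def algebra_simps)
  then show ?thesis by (simp add: dist_norm)
qed

lemma openin_mix:
  assumes "openin (top_of_set outcomes) A" "q \<in> A" "s \<in> outcomes"
  shows "\<exists>e>0. e \<le> 1 \<and> (\<forall>l. 0 \<le> l \<and> l \<le> e \<longrightarrow> mix s l q \<in> A)"
proof -
  have q: "q \<in> outcomes" using assms openin_imp_subset by blast
  obtain d where d: "d > 0" "\<And>x. x \<in> outcomes \<Longrightarrow> dist x q < d \<Longrightarrow> x \<in> A"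
    using openin_near[OF assms(1,2)] by auto
  define e where "e = min 1 (d / (norm (s - q) + 1))"
  have "mix s l q \<in> A" if l: "0 \<le> l" "l \<le> e" for l
  proof (rule d(2))
    show "mix s l q \<in> outcomes" using l mix_outcomes[OF assms(3) q] by (auto simp: e_def)
    have "l * norm (s - q) \<le> d / (norm (s - q) + 1) * norm (s - q)"
      using l by (intro mult_right_mono) (auto simp: e_def)
    also have "\<dots> < d"
    proof -
      have "d * norm (s - q) < d * (norm (s - q) + 1)" using d(1) by simp
      then show ?thesis by (simp add: pos_divide_less_eq add_nonneg_pos)
    qed
    finally show "dist (mix s l q) q < d" using l by (simp add: dist_mix)
  qed
  moreover have "e > 0" "e \<le> 1" using d(1) by (auto simp: e_def add_nonneg_pos)
  ultimately show ?thesis by blast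
qed

lemma pref_subset: "r \<in> prefs \<Longrightarrow> (p, q) \<in> r \<Longrightarrow> p \<in> outcomes \<and> q \<in> outcomes"
  by (auto simp: prefs_def preference_def)

lemma pref_asym: "r \<in> prefs \<Longrightarrow> (p, q) \<in> r \<Longrightarrow> (q, p) \<notin> r"
  by (auto simp: prefs_def preference_def dest: asymD)

lemma pref_irrefl: "r \<in> prefs \<Longrightarrow> (p, p) \<notin> r"
  using pref_asym by blast

lemma converse_prefs:
  assumes "r \<in> prefs" shows "r\<inverse> \<in> prefs"
proof -
  have u: "upper (r\<inverse>) = lower r" "lower (r\<inverse>) = upper r"
    by (auto simp: upper_def lower_def fun_eq_iff)
  have i: "indiff (r\<inverse>) = indiff r" by (auto simp: indiff_def fun_eq_iff)
  have s: "indiff_set (r\<inverse>) = indiff_set r" by (auto simp: indiff_set_def fun_eq_iff i)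
  have "preference (r\<inverse>)" using assms by (auto simp: prefs_def preference_def)
  moreover have "continuous_pref (r\<inverse>)" "convex_pref (r\<inverse>)" "symmetric_pref (r\<inverse>)"
    using assms by (auto simp: prefs_def continuous_pref_def convex_pref_def symmetric_pref_def u i s)
  ultimately show ?thesis by (simp add: prefs_def)
qed

subsection \<open>Segments\<close>

lemma weak_lower_iff:
  "r \<in> prefs \<Longrightarrow> x \<in> lower r p \<union> indiff_set r p \<longleftrightarrow> x \<in> outcomes \<and> (x, p) \<notin> r"
  by (auto simp: lower_def indiff_set_def indiff_def dest: pref_asym)

lemma weak_upper_iff:
  "r \<in> prefs \<Longrightarrow> x \<in> upper r p \<union> indiff_set r p \<longleftrightarrow> x \<in> outcomes \<and> (p, x) \<notin> r"
  by (auto simp: upper_def indiff_set_def indiff_def dest: pref_asym)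

lemma weak_lower_mix:
  assumes "r \<in> prefs" "p \<in> outcomes" "x \<in> outcomes" "y \<in> outcomes" "(x, p) \<notin> r" "(y, p) \<notin> r"
    "0 \<le> l" "l \<le> 1"
  shows "(mix x l y, p) \<notin> r"
proof -
  have "convex (lower r p \<union> indiff_set r p)"
    using assms(1,2) by (simp add: prefs_def convex_pref_def)
  then have "mix x l y \<in> lower r p \<union> indiff_set r p"
    using assms by (intro mix_mem_convex) (auto simp only: weak_lower_iff)
  then show ?thesis using weak_lower_iff[OF assms(1)] by blast
qed

lemma weak_upper_mix:
  assumes "r \<in> prefs" "p \<in> outcomes" "x \<in> outcomes" "y \<in> outcomes" "(p, x) \<notin> r" "(p, y) \<notin> r"
    "0 \<le> l" "l \<le> 1"
  shows "(p, mix x l y) \<notin> r"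
  using weak_lower_mix[OF converse_prefs[OF assms(1)] assms(2-4)] assms by simp

lemma indiff_mix:
  assumes "r \<in> prefs" "p \<in> outcomes" "x \<in> outcomes" "y \<in> outcomes" "indiff r p x" "indiff r p y"
    "0 \<le> l" "l \<le> 1"
  shows "indiff r p (mix x l y)"
  using assms(5,6) weak_lower_mix[OF assms(1-4) _ _ assms(7,8)]
    weak_upper_mix[OF assms(1-4) _ _ assms(7,8)] unfolding indiff_def by blast

lemma indiff_commute: "indiff r p q \<longleftrightarrow> indiff r q p"
  by (auto simp: indiff_def)

lemma lower_open: "r \<in> prefs \<Longrightarrow> p \<in> outcomes \<Longrightarrow> openin (top_of_set outcomes) (lower r p)"
  and upper_open: "r \<in> prefs \<Longrightarrow> p \<in> outcomes \<Longrightarrow> openin (top_of_set outcomes) (upper r p)"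
  and lower_convex: "r \<in> prefs \<Longrightarrow> p \<in> outcomes \<Longrightarrow> convex (lower r p)"
  by (simp_all add: prefs_def continuous_pref_def convex_pref_def)

lemma strict_mix_near_right:
  assumes "r \<in> prefs" "(p, q) \<in> r" "s \<in> outcomes"
  shows "\<exists>e>0. e \<le> 1 \<and> (\<forall>l. 0 \<le> l \<and> l \<le> e \<longrightarrow> (p, mix s l q) \<in> r)"
proof -
  have "p \<in> outcomes" "q \<in> lower r p" using pref_subset[OF assms(1,2)] assms(2) by (auto simp: lower_def)
  from openin_mix[OF lower_open[OF assms(1) this(1)] this(2) assms(3)]
  show ?thesis by (simp add: lower_def) blast
qed

lemma strict_mix_near_left:
  assumes "r \<in> prefs" "(p, q) \<in> r" "s \<in> outcomes"
  shows "\<exists>e>0. e \<le> 1 \<and> (\<forall>l. 0 \<le> l \<and> l \<le> e \<longrightarrow> (mix s l p, q) \<in> r)"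
  using strict_mix_near_right[OF converse_prefs[OF assms(1)], of q p s] assms(2,3) by simp

text \<open>
  The symmetry axiom with two equal arguments rules out thick indifference on a segment: if \<open>p\<close> were
  indifferent to the midpoint, symmetry would carry the indifference down to \<open>q\<close>.
\<close>

lemma strict_midpoint:
  assumes r: "r \<in> prefs" and pq: "(p, q) \<in> r"
  shows "(p, mix p (1/2) q) \<in> r"
proof (rule ccontr)
  define m where "m = mix p (1/2) q"
  assume "(p, mix p (1/2) q) \<notin> r"
  then have pm: "(p, m) \<notin> r" by (simp add: m_def)
  have P: "p \<in> outcomes" and Q: "q \<in> outcomes" using pref_subset r pq by auto
  then have M: "m \<in> outcomes" by (simp add: m_def mix_outcomes)
  have "(m, p) \<notin> r" unfolding m_def
    using r P Q pq pref_asym pref_irrefl by (intro weak_lower_mix) auto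
  with pm have ipm: "indiff r p m" by (simp add: indiff_def)
  have low: "indiff r p (mix p l q)" if l: "0 < l" "l \<le> 1/2" for l
  proof -
    have "mix q l p = mix m (2 * l) p"
      by (simp add: m_def mix_def vec_eq_iff field_simps)
    moreover have "indiff r m (mix m (2 * l) p)"
      using l ipm by (intro indiff_mix r M P) (auto simp: indiff_commute, simp add: indiff_def pref_irrefl r)
    ultimately have "indiff r (mix q l p) (mix q (1/2) p)"
      by (simp add: m_def indiff_commute mix_commute[of p "1/2" q])
    moreover have "indiff r p (mix q (1/2) p)" using ipm by (simp add: m_def mix_commute[of p "1/2" q])
    moreover have "symmetric_pref r" using r by (simp add: prefs_def)
    moreover have "l \<in> {0<..<1}" using l by auto
    ultimately have "indiff r (mix p l q) (mix p (1/2) p)"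
      using P Q unfolding symmetric_pref_def by blast
    then show ?thesis by (simp add: indiff_commute)
  qed
  obtain e where e: "e > 0" "e \<le> 1" "\<And>l. 0 \<le> l \<Longrightarrow> l \<le> e \<Longrightarrow> (p, mix p l q) \<in> r"
    using strict_mix_near_right[OF r pq P] by auto
  define l where "l = min e (1/2)"
  have "0 < l" "l \<le> 1/2" "l \<le> e" using e(1) by (auto simp: l_def)
  then show False using low[of l] e(3)[of l] by (auto simp: indiff_def)
qed

text \<open>Iterated midpoints give strict preference at the weights \<open>1 - (1/2) ^ k\<close>;
  convexity of \<open>lower r p\<close> fills in the smaller weights, since such a point lies
  between one of these and \<open>q\<close>.\<close>

lemma strict_mix_left:
  assumes r: "r \<in> prefs" and pq: "(p, q) \<in> r" and l: "0 \<le> l" "l < 1"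
  shows "(p, mix p l q) \<in> r"
proof -
  have P: "p \<in> outcomes" and Q: "q \<in> outcomes" using pref_subset r pq by auto
  have *: "(p, mix p (1 - (1/2) ^ k) q) \<in> r" for k :: nat
  proof (induction k)
    case (Suc k)
    from strict_midpoint[OF r Suc] show ?case by (simp add: mix_mix_right field_simps)
  qed (use pq in simp)
  obtain k :: nat where k: "(1/2) ^ k < 1 - l" using l real_arch_pow_inv[of "1 - l" "1/2"] by auto
  define c where "c = 1 - (1/2 :: real) ^ k"
  have c: "l < c" "0 \<le> l" using k l by (auto simp: c_def)
  have "mix p l q = mix (mix p c q) (l / c) q"
    using c by (simp add: mix_def algebra_simps flip: scaleR_add_left)
  moreover have "mix (mix p c q) (l / c) q \<in> lower r p"
  proof (rule mix_mem_convex[OF lower_convex[OF r P]])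
    show "mix p c q \<in> lower r p" "q \<in> lower r p"
      using *[of k] pq pref_subset[OF r] by (auto simp: lower_def c_def)
  qed (use c in auto)
  ultimately show ?thesis by (simp add: lower_def)
qed

lemma strict_mix_right:
  assumes r: "r \<in> prefs" and pq: "(p, q) \<in> r" and l: "0 < l" "l \<le> 1"
  shows "(mix p l q, q) \<in> r"
proof -
  have "(q, mix q (1 - l) p) \<in> r\<inverse>" using strict_mix_left[OF converse_prefs[OF r], of q p "1 - l"] pq l by auto
  moreover have "mix q (1 - l) p = mix p l q" by (simp add: mix_def)
  ultimately show ?thesis by simp
qed

lemma strict_segment:
  assumes r: "r \<in> prefs" and pq: "(p, q) \<in> r" and l: "0 \<le> l" "l < m" "m \<le> 1"
  shows "(mix p m q, mix p l q) \<in> r"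
proof -
  have 1: "(p, mix p l q) \<in> r" using strict_mix_left[OF r pq] l by auto
  have "mix p m q = mix p ((m - l) / (1 - l)) (mix p l q)"
  proof -
    have "(m - l) / (1 - l) + (1 - (m - l) / (1 - l)) * l = m"
      using l by (simp add: divide_simps) (simp add: algebra_simps)
    then show ?thesis by (simp add: mix_mix_right)
  qed
  then show ?thesis using strict_mix_right[OF r 1, of "(m - l) / (1 - l)"] l by simp
qed

lemma indiff_segment:
  assumes r: "r \<in> prefs" and P: "p \<in> outcomes" and Q: "q \<in> outcomes" and pq: "indiff r p q"
    and "0 \<le> l" "l \<le> 1" "0 \<le> m" "m \<le> 1"
  shows "indiff r (mix p m q) (mix p l q)"
proof -
  have refl: "indiff r x x" for x using r by (simp add: indiff_def pref_irrefl)
  have M: "mix p m q \<in> outcomes" using assms by (intro mix_outcomes)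
  have "indiff r p (mix p m q)" "indiff r q (mix p m q)"
    using assms refl indiff_commute by (auto intro!: indiff_mix)
  then show ?thesis using assms M by (intro indiff_mix) (auto simp: indiff_commute)
qed

text \<open>A segment is either strictly ordered in one direction or indifferent throughout, so one
  strict pair fixes the order of all pairs on it. Real parameters are used because later arguments
  step beyond two given outcomes.\<close>

lemma line_order:
  fixes a b t0 t1 t2 t3 :: real
  assumes r: "r \<in> prefs" and ab: "p + a *\<^sub>R d \<in> outcomes" "p + b *\<^sub>R d \<in> outcomes"
    and t: "a \<le> t0" "t0 < t1" "t1 \<le> b" "a \<le> t2" "t2 < t3" "t3 \<le> b"
    and 0: "(p + t0 *\<^sub>R d, p + t1 *\<^sub>R d) \<in> r"
  shows "(p + t2 *\<^sub>R d, p + t3 *\<^sub>R d) \<in> r"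
proof -
  define A where "A = p + a *\<^sub>R d"
  define B where "B = p + b *\<^sub>R d"
  define c where "c = (\<lambda>t. (b - t) / (b - a))"
  have ba: "a < b" using t by linarith
  have x: "p + t *\<^sub>R d = mix A (c t) B" for t
  proof -
    have "c t * a + (1 - c t) * b = t" using ba by (simp add: c_def divide_simps) (simp add: algebra_simps)
    moreover have "mix A (c t) B = p + (c t * a + (1 - c t) * b) *\<^sub>R d"
      by (simp add: mix_def A_def B_def algebra_simps)
    ultimately show ?thesis by simp
  qed
  have c: "0 \<le> c t" "c t \<le> 1" if "a \<le> t" "t \<le> b" for t
    using that ba by (auto simp: c_def divide_simps)
  have cl: "c t' < c t" if "t < t'" for t t' using that ba by (simp add: c_def divide_strict_right_mono)
  have "A \<in> outcomes" "B \<in> outcomes" using ab by (auto simp: A_def B_def)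
  consider "(A, B) \<in> r" | "(B, A) \<in> r" | "indiff r A B" by (auto simp: indiff_def)
  then show ?thesis
  proof cases
    case 1
    show ?thesis unfolding x by (rule strict_segment[OF r 1]) (use c[of t3] c[of t2] cl t in auto)
  next
    case 2
    have "(mix B (1 - c t1) A, mix B (1 - c t0) A) \<in> r"
      by (rule strict_segment[OF r 2]) (use c[of t1] c[of t0] cl t in auto)
    then have "(p + t1 *\<^sub>R d, p + t0 *\<^sub>R d) \<in> r" by (simp add: x mix_commute[of A _ B])
    then have False using 0 pref_asym[OF r] by blast
    then show ?thesis ..
  next
    case 3
    have "indiff r (mix A (c t0) B) (mix A (c t1) B)"
      by (rule indiff_segment[OF r \<open>A \<in> outcomes\<close> \<open>B \<in> outcomes\<close> 3]) (use c[of t1] c[of t0] t in auto)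
    then have False using 0 by (simp add: x indiff_def)
    then show ?thesis ..
  qed
qed

subsection \<open>Interior outcomes\<close>

definition inner_outcomes :: "(real ^ 'a::finite) set" where
  "inner_outcomes = {p \<in> outcomes. \<forall>a. 0 < p $ a}"

lemma inner_outcomes_subset: "p \<in> inner_outcomes \<Longrightarrow> p \<in> outcomes"
  by (simp add: inner_outcomes_def)

lemma pure_outcomes: "pure a \<in> outcomes"
  by (simp add: outcomes_def pure_def axis_def)

lemma inner_mix_outcomes:
  "p \<in> inner_outcomes \<Longrightarrow> q \<in> outcomes \<Longrightarrow> 0 < l \<Longrightarrow> l \<le> 1 \<Longrightarrow> mix p l q \<in> inner_outcomes"
  using mix_outcomes[of p q l]
  by (auto simp: inner_outcomes_def mix_def outcomesD(1) intro!: add_pos_nonneg)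

lemma inner_outcomes_nonempty: "(\<chi> a::'a::finite. 1 / real CARD('a)) \<in> inner_outcomes"
  by (simp add: inner_outcomes_def outcomes_def)

lemma inner_extend:
  assumes p: "p \<in> inner_outcomes" and d: "(\<Sum>a\<in>UNIV. d $ a) = 0"
  shows "\<exists>e>0. \<forall>t. \<bar>t\<bar> \<le> e \<longrightarrow> p + t *\<^sub>R d \<in> inner_outcomes"
proof -
  define m where "m = Min (range (\<lambda>a. p $ a))"
  have m: "0 < m" "\<And>a. m \<le> p $ a" using p by (auto simp: m_def inner_outcomes_def)
  define e where "e = m / (norm d + 1)"
  have e: "0 < e" using m by (simp add: e_def add_nonneg_pos)
  have "e * norm d < m"
  proof -
    have "e * norm d < e * (norm d + 1)" using e by simp
    also have "norm d + 1 \<noteq> 0" using norm_ge_zero[of d] by linarith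
    then have "e * (norm d + 1) = m" by (simp add: e_def)
    finally show ?thesis .
  qed
  have "0 < p $ a + t * d $ a" if "\<bar>t\<bar> \<le> e" for t a
  proof -
    have "\<bar>t * d $ a\<bar> \<le> e * norm d"
      unfolding abs_mult using that component_le_norm_cart[of d a] e by (intro mult_mono) auto
    then show ?thesis using m(2)[of a] \<open>e * norm d < m\<close> by linarith
  qed
  moreover have "(\<Sum>a\<in>UNIV. p $ a + t * d $ a) = 1" for t
    using p d by (simp add: sum.distrib inner_outcomes_def outcomes_def flip: sum_distrib_left)
  ultimately have "\<forall>t. \<bar>t\<bar> \<le> e \<longrightarrow> p + t *\<^sub>R d \<in> inner_outcomes"
    by (auto simp: inner_outcomes_def outcomes_def intro: less_imp_le)
  then show ?thesis using e by blast
qed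

lemma sum_diff_outcomes: "p \<in> outcomes \<Longrightarrow> q \<in> outcomes \<Longrightarrow> (\<Sum>a\<in>UNIV. (p - q) $ a) = 0"
  by (simp add: sum_subtractf outcomesD)

lemma inner_reflect:
  assumes "p \<in> inner_outcomes" "q \<in> outcomes"
  shows "\<exists>e>0. p + e *\<^sub>R (p - q) \<in> inner_outcomes"
  using inner_extend[OF assms(1) sum_diff_outcomes[OF inner_outcomes_subset[OF assms(1)] assms(2)]]
  by (metis abs_of_pos order_refl)

text \<open>Lets statements on \<open>upper r p\<close> be read off from \<open>lower r p\<close>:
  the reflected outcome lies on the same line, on the other side of \<open>p\<close>.\<close>

lemma reflect_iff:
  assumes r: "r \<in> prefs" and q: "q \<in> outcomes" and u: "p + e *\<^sub>R (p - q) \<in> outcomes" and e: "e > 0"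
  shows "(q, p) \<in> r \<longleftrightarrow> (p, p + e *\<^sub>R (p - q)) \<in> r"
proof -
  have *: "p + (-1) *\<^sub>R (p - q) = q" by (simp add: algebra_simps)
  have ab: "p + (-1) *\<^sub>R (p - q) \<in> outcomes" using q * by simp
  show ?thesis
    using line_order[OF r ab u, of "-1" 0 0 e] line_order[OF r ab u, of 0 e "-1" 0] e
    unfolding * by auto
qed

text \<open>Separating cones instead of the sets themselves yields a functional without constant
  term, as a bilinear representation requires.\<close>

lemma convex_pos_cone:
  assumes "convex A" shows "convex {t *\<^sub>R x | t x. (0::real) < t \<and> x \<in> A}"
proof (rule convexI, clarify)
  fix u v s t :: real and x y
  assume uv: "0 \<le> u" "0 \<le> v" "u + v = 1" and st: "0 < s" "0 < t" and xy: "x \<in> A" "y \<in> A"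
  define w where "w = u * s + v * t"
  have w: "w > 0"
  proof (cases "u = 0")
    case False
    then show ?thesis using uv st by (simp add: w_def add_pos_nonneg)
  qed (use uv st in \<open>simp add: w_def\<close>)
  have "(u * s / w) *\<^sub>R x + (v * t / w) *\<^sub>R y \<in> A"
    using assms xy by (rule convexD) (use w uv st in \<open>auto simp: w_def simp flip: add_divide_distrib\<close>)
  moreover have "u *\<^sub>R s *\<^sub>R x + v *\<^sub>R t *\<^sub>R y = w *\<^sub>R ((u * s / w) *\<^sub>R x + (v * t / w) *\<^sub>R y)"
    using w by (simp add: scaleR_add_right)
  ultimately show "\<exists>t' x'. u *\<^sub>R s *\<^sub>R x + v *\<^sub>R t *\<^sub>R y = t' *\<^sub>R x' \<and> 0 < t' \<and> x' \<in> A"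
    using w by blast
qed

lemma inner_pure: "v \<bullet> pure a = v $ a"
  by (simp add: pure_def inner_axis)

text \<open>The cones over \<open>lower r p\<close> and over its complement in the simplex are
  separated. Separation gives weak inequalities only; they become exact because \<open>p\<close> is
  interior, so that \<open>v\<close> vanishes at \<open>p\<close> without vanishing on the whole
  simplex.\<close>

lemma pref_functional:
  assumes r: "r \<in> prefs" and p: "p \<in> inner_outcomes"
  shows "\<exists>v. \<forall>q\<in>outcomes. ((p, q) \<in> r \<longleftrightarrow> v \<bullet> q > 0) \<and> ((q, p) \<in> r \<longleftrightarrow> v \<bullet> q < 0)"
proof (cases "lower r p = {}")
  case True
  have P: "p \<in> outcomes" using p by (rule inner_outcomes_subset)
  have "(p, q) \<notin> r \<and> (q, p) \<notin> r" if q: "q \<in> outcomes" for q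
  proof -
    obtain e where "e > 0" "p + e *\<^sub>R (p - q) \<in> inner_outcomes" using inner_reflect[OF p q] by auto
    then show ?thesis using True q reflect_iff[OF r q, of p e] inner_outcomes_subset
      by (auto simp: lower_def)
  qed
  then show ?thesis by (intro exI[of _ 0]) auto
next
  case False
  then obtain q0 where q0: "q0 \<in> outcomes" "(p, q0) \<in> r" by (auto simp: lower_def)
  have P: "p \<in> outcomes" using p by (rule inner_outcomes_subset)
  define W where "W = upper r p \<union> indiff_set r p"
  define CL where "CL = {t *\<^sub>R x | t x. (0::real) < t \<and> x \<in> lower r p}"
  define CW where "CW = {t *\<^sub>R x | t x. (0::real) < t \<and> x \<in> W}"
  have W: "x \<in> W \<longleftrightarrow> x \<in> outcomes \<and> (p, x) \<notin> r" for x
    unfolding W_def by (rule weak_upper_iff[OF r])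
  have "convex W" using r P by (simp add: W_def prefs_def convex_pref_def)
  then have "convex CW" unfolding CW_def by (rule convex_pos_cone)
  moreover have "convex CL" unfolding CL_def using lower_convex[OF r P] by (rule convex_pos_cone)
  ultimately have cS: "convex (\<Union>x\<in>CL. \<Union>y\<in>CW. {x - y})" by (intro convex_differences)
  have "0 \<notin> (\<Union>x\<in>CL. \<Union>y\<in>CW. {x - y})"
  proof
    assume "0 \<in> (\<Union>x\<in>CL. \<Union>y\<in>CW. {x - y})"
    then obtain s t x y where *: "0 < s" "0 < t" "x \<in> lower r p" "y \<in> W" "s *\<^sub>R x = t *\<^sub>R y"
      unfolding CL_def CW_def by auto
    have "(\<Sum>a\<in>UNIV. (s *\<^sub>R x) $ a) = s" "(\<Sum>a\<in>UNIV. (t *\<^sub>R y) $ a) = t"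
      using *(3,4) W[of y] by (simp_all add: lower_def outcomesD flip: sum_distrib_left)
    then have "x = y" using * by simp
    then show False using * W[of y] by (simp add: lower_def)
  qed
  from separating_hyperplane_set_0[OF cS this] obtain v where v: "v \<noteq> 0"
    and vS: "\<And>x y. x \<in> CL \<Longrightarrow> y \<in> CW \<Longrightarrow> 0 \<le> v \<bullet> (x - y)" by auto
  have sep: "0 \<le> s * (v \<bullet> x) - t * (v \<bullet> y)" if "x \<in> lower r p" "y \<in> W" "0 < s" "0 < t" for x y s t
    using vS[of "s *\<^sub>R x" "t *\<^sub>R y"] that by (auto simp: CL_def CW_def inner_diff_right)
  have q0L: "q0 \<in> lower r p" and pW: "p \<in> W" using q0 P pref_irrefl[OF r] W by (auto simp: lower_def)
  have vL: "0 \<le> v \<bullet> x" if "x \<in> lower r p" for x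
  proof (rule ccontr)
    assume n: "\<not> 0 \<le> v \<bullet> x"
    define s where "s = (\<bar>v \<bullet> p\<bar> + 1) / - (v \<bullet> x)"
    have "0 < s" "s * (v \<bullet> x) = - (\<bar>v \<bullet> p\<bar> + 1)" using n by (auto simp: s_def field_simps divide_simps)
    then show False using sep[OF that pW, of s 1] by linarith
  qed
  have vW: "v \<bullet> y \<le> 0" if "y \<in> W" for y
  proof (rule ccontr)
    assume n: "\<not> v \<bullet> y \<le> 0"
    define s where "s = (\<bar>v \<bullet> q0\<bar> + 1) / (v \<bullet> y)"
    have "0 < s" "s * (v \<bullet> y) = \<bar>v \<bullet> q0\<bar> + 1" using n by (auto simp: s_def)
    then show False using sep[OF q0L that, of 1 s] by linarith
  qed
  have vp: "v \<bullet> p = 0"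
  proof (rule ccontr)
    assume "v \<bullet> p \<noteq> 0"
    then have n: "v \<bullet> p < 0" using vW[OF pW] by simp
    \<comment> \<open>Half the weight of \<open>q0\<close> at which \<open>v\<close> vanishes on the
      segment from \<open>p\<close> to \<open>q0\<close>: the mixture already lies in
      \<open>lower r p\<close>, yet \<open>v\<close> is still negative there.\<close>
    define l where "l = - (v \<bullet> p) / (2 * (v \<bullet> q0 - v \<bullet> p))"
    have d: "v \<bullet> q0 - v \<bullet> p > 0" "- (v \<bullet> p) \<le> v \<bullet> q0 - v \<bullet> p" using n vL[OF q0L] by auto
    have l: "0 < l" "l < 1" using n d by (auto simp: l_def divide_simps)
    have "(p, mix p (1 - l) q0) \<in> r" using strict_mix_left[OF r q0(2), of "1 - l"] l by simp
    then have "0 \<le> v \<bullet> mix p (1 - l) q0" using vL pref_subset[OF r] by (auto simp: lower_def)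
    also have "v \<bullet> mix p (1 - l) q0 = v \<bullet> p + l * (v \<bullet> q0 - v \<bullet> p)"
      by (simp add: inner_mix algebra_simps)
    also have "l * (v \<bullet> q0 - v \<bullet> p) = - (v \<bullet> p) / 2" using d by (simp add: l_def field_simps)
    finally show False using n by simp
  qed
  \<comment> \<open>\<open>v\<close> is nonzero but vanishes at \<open>p\<close>, so it is negative
    either at a vertex where it does not vanish or at the reflection of that vertex through
    \<open>p\<close>.\<close>
  obtain z where z: "z \<in> outcomes" "v \<bullet> z < 0"
  proof -
    obtain a where a: "v $ a \<noteq> 0" using v by (auto simp: vec_eq_iff)
    obtain e where e: "e > 0" "p + e *\<^sub>R (p - pure a) \<in> inner_outcomes"
      using inner_reflect[OF p pure_outcomes] by blast
    have "v \<bullet> (p + e *\<^sub>R (p - pure a)) = - e * v $ a"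
      by (simp add: inner_add_right inner_diff_right inner_pure vp)
    then show thesis using that[of "pure a"] that[of "p + e *\<^sub>R (p - pure a)"] a e
      by (cases "v $ a < 0") (auto simp: pure_outcomes inner_pure inner_outcomes_subset mult_less_0_iff)
  qed
  have L: "(p, q) \<in> r \<longleftrightarrow> 0 < v \<bullet> q" if q: "q \<in> outcomes" for q
  proof
    assume "(p, q) \<in> r"
    \<comment> \<open>Moving \<open>q\<close> slightly towards \<open>z\<close> lowers the value but
      stays in \<open>lower r p\<close>, so the weak inequality at \<open>q\<close> is
      strict.\<close>
    then obtain e where e: "0 < e" "e \<le> 1" "\<And>l. 0 \<le> l \<Longrightarrow> l \<le> e \<Longrightarrow> (p, mix z l q) \<in> r"
      using strict_mix_near_right[OF r _ z(1)] by blast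
    have "0 \<le> v \<bullet> mix z e q"
      using e vL[of "mix z e q"] mix_outcomes[OF z(1) q, of e] by (auto simp: lower_def)
    then have "0 \<le> e * (v \<bullet> z) + (1 - e) * (v \<bullet> q)" by (simp add: inner_mix)
    moreover have "e * (v \<bullet> z) < 0" using e z by (simp add: mult_pos_neg)
    ultimately have "0 < (1 - e) * (v \<bullet> q)" by linarith
    then show "0 < v \<bullet> q" using e by (simp add: zero_less_mult_iff)
  next
    assume "0 < v \<bullet> q"
    then show "(p, q) \<in> r" using vW[of q] W[of q] q by auto
  qed
  have "(q, p) \<in> r \<longleftrightarrow> v \<bullet> q < 0" if q: "q \<in> outcomes" for q
  proof -
    obtain e where e: "e > 0" "p + e *\<^sub>R (p - q) \<in> inner_outcomes" using inner_reflect[OF p q] by auto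
    then have "(q, p) \<in> r \<longleftrightarrow> 0 < v \<bullet> (p + e *\<^sub>R (p - q))"
      using reflect_iff[OF r q _ e(1)] L inner_outcomes_subset by blast
    also have "v \<bullet> (p + e *\<^sub>R (p - q)) = - e * (v \<bullet> q)"
      by (simp add: inner_add_right inner_diff_right vp)
    finally show ?thesis using e by (simp add: mult_less_0_iff)
  qed
  with L show ?thesis by blast
qed

text \<open>The choice fixes this functional only up to a positive factor;
  \<open>skew_scaling\<close> corrects the factors afterwards.\<close>

definition pref_vec :: "'a::finite pref \<Rightarrow> real ^ 'a \<Rightarrow> real ^ 'a" where
  "pref_vec r p = (SOME v. \<forall>q\<in>outcomes. ((p, q) \<in> r \<longleftrightarrow> v \<bullet> q > 0) \<and> ((q, p) \<in> r \<longleftrightarrow> v \<bullet> q < 0))"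

lemma pref_vec:
  assumes "r \<in> prefs" "p \<in> inner_outcomes" "q \<in> outcomes"
  shows "(p, q) \<in> r \<longleftrightarrow> pref_vec r p \<bullet> q > 0" "(q, p) \<in> r \<longleftrightarrow> pref_vec r p \<bullet> q < 0"
  using someI_ex[OF pref_functional[OF assms(1,2)]] assms(3) unfolding pref_vec_def by blast+

lemma pref_vec_indiff:
  assumes "r \<in> prefs" "p \<in> inner_outcomes" "q \<in> outcomes"
  shows "indiff r p q \<longleftrightarrow> pref_vec r p \<bullet> q = 0" "indiff r q p \<longleftrightarrow> pref_vec r p \<bullet> q = 0"
  using pref_vec[OF assms] by (auto simp: indiff_def)

lemma pref_vec_self: "r \<in> prefs \<Longrightarrow> p \<in> inner_outcomes \<Longrightarrow> pref_vec r p \<bullet> p = 0"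
  using pref_vec_indiff[of r p p] by (simp add: indiff_def pref_irrefl inner_outcomes_subset)

lemma pref_vec_sgn:
  assumes "r \<in> prefs" "p \<in> inner_outcomes" "q \<in> inner_outcomes"
  shows "sgn (pref_vec r p \<bullet> q) = - sgn (pref_vec r q \<bullet> p)"
  using pref_vec[OF assms(1,2), of q] pref_vec[OF assms(1,3), of p] assms(2,3)[THEN inner_outcomes_subset]
  by (cases "pref_vec r p \<bullet> q" "0::real" rule: linorder_cases) (auto simp: sgn_if)

subsection \<open>The functionals along a line\<close>

lemma convex_inner_outcomes:
  assumes "p \<in> inner_outcomes" "q \<in> inner_outcomes" "0 \<le> l" "l \<le> 1"
  shows "mix p l q \<in> inner_outcomes"
  using assms inner_mix_outcomes[of p q l] by (cases "l = 0") (auto simp: inner_outcomes_def)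

definition line_pt :: "real ^ 'a::finite \<Rightarrow> real ^ 'a \<Rightarrow> real \<Rightarrow> real ^ 'a" where
  "line_pt p s t = p + t *\<^sub>R (s - p)"

text \<open>Dividing by the value on the direction \<open>s - p\<close> cancels the arbitrary factor
  in \<open>pref_vec\<close>, so that functionals at different points of the line become
  comparable.\<close>

definition line_fun :: "'a::finite pref \<Rightarrow> real ^ 'a \<Rightarrow> real ^ 'a \<Rightarrow> real \<Rightarrow> real ^ 'a \<Rightarrow> real" where
  "line_fun r p s t y = (pref_vec r (line_pt p s t) \<bullet> y) / (pref_vec r (line_pt p s t) \<bullet> (s - p))"

lemma line_pt_0 [simp]: "line_pt p s 0 = p" and line_pt_1 [simp]: "line_pt p s 1 = s"
  by (simp_all add: line_pt_def)

lemma mix_line_pt: "mix (line_pt p s a) l (line_pt p s b) = line_pt p s (l * a + (1 - l) * b)"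
  by (simp add: mix_def line_pt_def algebra_simps)

lemma line_fun_add: "line_fun r p s t (y + z) = line_fun r p s t y + line_fun r p s t z"
  and line_fun_diff: "line_fun r p s t (y - z) = line_fun r p s t y - line_fun r p s t z"
  and line_fun_scale: "line_fun r p s t (c *\<^sub>R y) = c * line_fun r p s t y"
  by (simp_all add: line_fun_def inner_add_right inner_diff_right add_divide_distrib diff_divide_distrib)

lemma line_pt_between:
  assumes "line_pt p s a \<in> inner_outcomes" "line_pt p s b \<in> inner_outcomes" "a \<le> t" "t \<le> b"
  shows "line_pt p s t \<in> inner_outcomes"
proof (cases "a = b")
  case False
  define l where "l = (b - t) / (b - a)"
  have "0 \<le> l" "l \<le> 1" using assms(3,4) False by (auto simp: l_def divide_simps)
  then have "mix (line_pt p s a) l (line_pt p s b) \<in> inner_outcomes"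
    using assms by (intro convex_inner_outcomes)
  moreover have "l * a + (1 - l) * b = t"
  proof -
    have "l * (b - a) = b - t" using False by (simp add: l_def)
    then show ?thesis by (simp add: algebra_simps)
  qed
  ultimately show ?thesis by (simp add: mix_line_pt)
qed (use assms in simp)

context
  fixes r :: "'a::finite pref" and p s :: "real ^ 'a"
  assumes r: "r \<in> prefs" and p: "p \<in> inner_outcomes" and s: "s \<in> inner_outcomes" and ps: "(p, s) \<in> r"
begin

lemma line_pt_extend:
  assumes "line_pt p s t \<in> inner_outcomes"
  shows "\<exists>e>0. \<forall>u. \<bar>u\<bar> \<le> e \<longrightarrow> line_pt p s (t + u) \<in> inner_outcomes"
  using inner_extend[OF assms sum_diff_outcomes[of s p]] p s
  by (simp add: line_pt_def inner_outcomes_subset algebra_simps)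

text \<open>By \<open>line_order\<close>, a small move along \<open>s - p\<close> from any point of
  the line leads to something strictly worse; as the functional vanishes at the point itself, its
  value comes from the direction alone.\<close>

lemma line_denominator_pos:
  assumes t: "line_pt p s t \<in> inner_outcomes"
  shows "0 < pref_vec r (line_pt p s t) \<bullet> (s - p)"
proof -
  obtain e where e: "e > 0" "line_pt p s (t + e) \<in> inner_outcomes"
  proof -
    obtain e where "e > 0" "\<forall>u. \<bar>u\<bar> \<le> e \<longrightarrow> line_pt p s (t + u) \<in> inner_outcomes"
      using line_pt_extend[OF t] by blast
    then show thesis using that[of e] by auto
  qed
  have "p + min 0 t *\<^sub>R (s - p) \<in> outcomes" "p + max 1 (t + e) *\<^sub>R (s - p) \<in> outcomes"
    using t e(2) p s by (auto simp: min_def max_def line_pt_def inner_outcomes_subset)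
  from line_order[OF r this, of 0 1 t "t + e"] have "(line_pt p s t, line_pt p s (t + e)) \<in> r"
    using e(1) ps by (simp add: line_pt_def)
  then have "0 < pref_vec r (line_pt p s t) \<bullet> line_pt p s (t + e)"
    using pref_vec(1)[OF r t] e inner_outcomes_subset by blast
  also have "line_pt p s (t + e) = line_pt p s t + e *\<^sub>R (s - p)"
    by (simp add: line_pt_def algebra_simps)
  finally show ?thesis using e(1) pref_vec_self[OF r t] by (simp add: inner_add_right zero_less_mult_iff)
qed

lemma line_fun_direction:
  "line_pt p s t \<in> inner_outcomes \<Longrightarrow> line_fun r p s t (s - p) = 1"
  using line_denominator_pos by (fastforce simp: line_fun_def)

lemma line_fun_line_pt:
  assumes t: "line_pt p s t \<in> inner_outcomes"
  shows "line_fun r p s t (line_pt p s u) = u - t"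
proof -
  have "line_pt p s u = line_pt p s t + (u - t) *\<^sub>R (s - p)" by (simp add: line_pt_def algebra_simps)
  moreover have "line_fun r p s t (line_pt p s t) = 0" by (simp add: line_fun_def pref_vec_self r t)
  ultimately show ?thesis by (simp add: line_fun_add line_fun_scale line_fun_direction t)
qed

lemma line_fun_sgn:
  assumes t: "line_pt p s t \<in> inner_outcomes"
  shows "sgn (line_fun r p s t y) = sgn (pref_vec r (line_pt p s t) \<bullet> y)"
  using line_denominator_pos[OF t] by (simp add: line_fun_def sgn_divide)

lemma indiff_line_fun:
  assumes t: "line_pt p s t \<in> inner_outcomes" and y: "y \<in> outcomes"
  shows "indiff r (line_pt p s t) y \<longleftrightarrow> line_fun r p s t y = 0"
    and "indiff r y (line_pt p s t) \<longleftrightarrow> line_fun r p s t y = 0"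
  using line_fun_sgn[OF t, of y] by (auto simp: pref_vec_indiff[OF r t y] sgn_if split: if_splits)

text \<open>
  Symmetry is applied to the points \<open>t0 - h\<close> and \<open>t0 + h\<close> of the line and to a third point
  indifferent to their midpoint; \<open>h\<close> is chosen such that the second hypothesis of the axiom holds at
  the point \<open>t0 - g\<close>.
\<close>

lemma line_fun_symmetric_kernel:
  assumes g: "0 < g" and in3: "line_pt p s (t0 - 3 * g) \<in> inner_outcomes" "line_pt p s (t0 + 3 * g) \<in> inner_outcomes"
    and d: "(\<Sum>a\<in>UNIV. d $ a) = 0" and d0: "line_fun r p s t0 d = 0"
  shows "line_fun r p s (t0 - g) d + line_fun r p s (t0 + g) d = 0"
proof -
  have IN: "line_pt p s t \<in> inner_outcomes" if "t0 - 3 * g \<le> t" "t \<le> t0 + 3 * g" for t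
    using line_pt_between[OF in3 that] .
  have t0: "line_pt p s t0 \<in> inner_outcomes" and tm: "line_pt p s (t0 - g) \<in> inner_outcomes"
    and tp: "line_pt p s (t0 + g) \<in> inner_outcomes"
    using g by (auto intro!: IN)
  obtain e where e: "e > 0" "\<And>u. \<bar>u\<bar> \<le> e \<Longrightarrow> line_pt p s t0 + u *\<^sub>R d \<in> inner_outcomes"
    using inner_extend[OF t0 d] by auto
  define k where "k = line_fun r p s (t0 - g) d"
  \<comment> \<open>Small enough that \<open>\<bar>n * k\<bar> < g\<close>; then \<open>h\<close>
    lies between \<open>g\<close> and \<open>3 * g\<close>, which keeps \<open>P\<close> and
    \<open>R\<close> in the interior.\<close>
  define n where "n = min e (g / (\<bar>k\<bar> + 1))"
  have n: "0 < n" "n \<le> e" using e g by (auto simp: n_def)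
  have nk: "\<bar>n * k\<bar> < g"
  proof -
    have "\<bar>n * k\<bar> = n * \<bar>k\<bar>" using n by (simp add: abs_mult)
    also have "\<dots> < n * (\<bar>k\<bar> + 1)" using n by simp
    also have "\<dots> \<le> g / (\<bar>k\<bar> + 1) * (\<bar>k\<bar> + 1)" by (intro mult_right_mono) (auto simp: n_def)
    also have "\<dots> = g" by simp
    finally show ?thesis .
  qed
  define h where "h = 2 * g + n * k"
  have h: "g < h" "h < 3 * g" using nk by (auto simp: h_def)
  define P where "P = line_pt p s (t0 - h)"
  define R where "R = line_pt p s (t0 + h)"
  define Q where "Q = line_pt p s t0 + n *\<^sub>R d"
  have PQR: "P \<in> outcomes" "Q \<in> outcomes" "R \<in> outcomes"
    using h g e(2)[of n] n by (auto simp: P_def Q_def R_def intro!: inner_outcomes_subset IN)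
  \<comment> \<open>The weight that puts \<open>mix P l R\<close> at parameter \<open>t0 - g\<close>
    and \<open>mix R l P\<close> at \<open>t0 + g\<close>.\<close>
  define l where "l = (1 + g / h) / 2"
  have l: "l \<in> {0<..<1}" "(1 - 2 * l) * h = - g" using h g by (auto simp: l_def field_simps)
  have "(t0 - h) / 2 + (t0 + h) / 2 = t0" by (simp add: field_simps)
  then have "mix P (1/2) R = line_pt p s t0" by (simp add: P_def R_def mix_line_pt)
  moreover have lQ: "line_fun r p s t Q = t0 - t + n * line_fun r p s t d"
    if "line_pt p s t \<in> inner_outcomes" for t
    using that by (simp add: Q_def line_fun_add line_fun_scale line_fun_line_pt)
  ultimately have 1: "indiff r Q (mix P (1/2) R)"
    using indiff_line_fun(2)[OF t0 PQR(2)] t0 d0 by simp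
  have lm: "line_fun r p s t (mix X (1/2) Q) = (line_fun r p s t X + line_fun r p s t Q) / 2" for t X
    by (simp add: mix_def line_fun_add line_fun_scale)
  have "mix P l R = line_pt p s (t0 - g)" "mix R l P = line_pt p s (t0 + g)"
    unfolding P_def R_def mix_line_pt using l(2)
    by (auto simp: algebra_simps intro!: arg_cong[where f = "line_pt p s"])
  moreover have "line_fun r p s (t0 - g) (mix P (1/2) Q) = 0"
    unfolding lm lQ[OF tm] P_def line_fun_line_pt[OF tm] by (simp add: h_def k_def)
  ultimately have 2: "indiff r (mix P l R) (mix P (1/2) Q)"
    using indiff_line_fun(1)[OF tm, of "mix P (1/2) Q"] mix_outcomes[OF PQR(1,2)] by simp
  have "symmetric_pref r" using r by (simp add: prefs_def)
  with 1 2 PQR l(1) have "indiff r (mix R l P) (mix R (1/2) Q)"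
    unfolding symmetric_pref_def by blast
  then have "line_fun r p s (t0 + g) (mix R (1/2) Q) = 0"
    using indiff_line_fun(1)[OF tp, of "mix R (1/2) Q"] mix_outcomes[OF PQR(3,2)]
      \<open>mix R l P = line_pt p s (t0 + g)\<close> by simp
  then have "n * k + n * line_fun r p s (t0 + g) d = 0"
    unfolding lm lQ[OF tp] R_def line_fun_line_pt[OF tp] by (simp add: h_def)
  then have "n * (k + line_fun r p s (t0 + g) d) = 0" by (simp add: algebra_simps)
  then show ?thesis using n by (simp add: k_def)
qed

text \<open>Reduces to \<open>line_fun_symmetric_kernel\<close> by subtracting from \<open>y\<close>
  multiples of \<open>line_pt p s t0\<close> and \<open>s - p\<close>, on which
  \<open>line_fun\<close> is known to be affine in the parameter. The remainder has coordinate sum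
  zero and is annihilated at \<open>t0\<close>.\<close>

lemma line_fun_midpoint:
  assumes g: "0 < g" and in3: "line_pt p s (t0 - 3 * g) \<in> inner_outcomes" "line_pt p s (t0 + 3 * g) \<in> inner_outcomes"
  shows "line_fun r p s (t0 - g) y + line_fun r p s (t0 + g) y = 2 * line_fun r p s t0 y"
proof -
  have IN: "line_pt p s t \<in> inner_outcomes" if "t0 - 3 * g \<le> t" "t \<le> t0 + 3 * g" for t
    using line_pt_between[OF in3 that] .
  define c where "c = (\<Sum>a\<in>UNIV. y $ a)"
  define k where "k = line_fun r p s t0 y"
  define d where "d = y - c *\<^sub>R line_pt p s t0 - k *\<^sub>R (s - p)"
  have t0: "line_pt p s t0 \<in> inner_outcomes" using g by (auto intro!: IN)
  have *: "line_fun r p s t d = line_fun r p s t y - c * (t0 - t) - k"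
    if "line_pt p s t \<in> inner_outcomes" for t
    by (simp add: d_def line_fun_diff[of _ _ _ _ _ "k *\<^sub>R (s - p)"] line_fun_diff[of _ _ _ _ y]
        line_fun_scale line_fun_line_pt line_fun_direction that)
  have "(\<Sum>a\<in>UNIV. d $ a) = c - c * (\<Sum>a\<in>UNIV. line_pt p s t0 $ a) - k * (\<Sum>a\<in>UNIV. (s - p) $ a)"
    by (simp add: d_def c_def sum_subtractf sum_distrib_left right_diff_distrib)
  also have "\<dots> = 0"
    using outcomesD(2)[OF inner_outcomes_subset[OF t0]] sum_diff_outcomes[of s p] p s
    by (simp add: inner_outcomes_subset del: vector_minus_component)
  finally have "line_fun r p s (t0 - g) d + line_fun r p s (t0 + g) d = 0"
    using *[OF t0] by (intro line_fun_symmetric_kernel[OF g in3]) (auto simp: k_def)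
  then show ?thesis using *[of "t0 - g"] *[of "t0 + g"] IN[of "t0 - g"] IN[of "t0 + g"] g
    by (simp add: k_def)
qed

text \<open>A sequence with vanishing second differences is affine. With spacing
  \<open>1 / N\<close>, the midpoint rule needs points three steps away from the middle one, that is
  up to \<open>2 / N\<close> beyond either end of the unit interval; hence the slack
  \<open>e\<close>.\<close>

lemma line_fun_grid:
  assumes e: "line_pt p s (- e) \<in> inner_outcomes" "line_pt p s (1 + e) \<in> inner_outcomes"
    and N: "0 < N" "2 / real N \<le> e" and k: "k \<le> N"
  shows "line_fun r p s (real k / N) y
    = (1 - real k / N) * line_fun r p s 0 y + (real k / N) * line_fun r p s 1 y"
proof -
  define a where "a = (\<lambda>k::nat. line_fun r p s (real k / N) y)"
  have step: "a k + a (Suc (Suc k)) = 2 * a (Suc k)" if k: "Suc (Suc k) \<le> N" for k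
  proof -
    define w where "w = real k / N"
    define g where "g = 1 / real N"
    have eq: "real (Suc k) / N = w + g" "real (Suc (Suc k)) / N = w + 2 * g"
      by (simp_all add: w_def g_def add_divide_distrib)
    have g: "0 < g" "2 * g \<le> e" using N by (simp_all add: g_def)
    have w: "0 \<le> w" by (simp add: w_def)
    have "real (Suc (Suc k)) \<le> N" using k by (simp only: of_nat_le_iff)
    then have "real (Suc (Suc k)) / N \<le> 1" using N(1) by simp
    then have w1: "w + 2 * g \<le> 1" by (simp only: eq)
    have "line_fun r p s (w + g - g) y + line_fun r p s (w + g + g) y = 2 * line_fun r p s (w + g) y"
      by (rule line_fun_midpoint[OF g(1)]; rule line_pt_between[OF e]; use g w w1 in linarith)
    moreover have "w + g - g = w" "w + g + g = w + 2 * g" by simp_all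
    ultimately show ?thesis by (simp only: a_def eq w_def[symmetric])
  qed
  have *: "a k = a 0 + k * (a 1 - a 0)" if "k \<le> N" for k
    using that
  proof (induction k rule: induct_nat_012)
    case (ge2 k)
    then have IH: "a k = a 0 + k * (a 1 - a 0)" "a (Suc k) = a 0 + Suc k * (a 1 - a 0)" by simp_all
    have "a (Suc (Suc k)) = 2 * a (Suc k) - a k" using step[OF ge2(3)] by linarith
    then show ?case unfolding IH by (simp add: algebra_simps)
  qed simp_all
  have ak: "a k = a 0 + k * (a 1 - a 0)" and aN: "a N = a 0 + N * (a 1 - a 0)"
    using *[OF k] *[OF order_refl] .
  have "a k = (1 - real k / N) * a 0 + (real k / N) * a N"
  proof -
    have "(real k / N) * a N = (real k / N) * a 0 + k * (a 1 - a 0)"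
      unfolding aN using N by (simp add: distrib_left)
    then show ?thesis unfolding ak by (simp add: left_diff_distrib)
  qed
  then show ?thesis using N by (simp add: a_def)
qed

text \<open>The grid gives rational parameters only, and \<open>line_fun\<close> is not known to be
  continuous in \<open>t\<close>; only its sign is controlled, by openness of the contour sets. So a
  deviation at \<open>t\<close> is first turned into an outcome \<open>z\<close> at which the true
  and the interpolated value have opposite signs. At a nearby grid point the two values agree, while
  each still has the sign it had at \<open>t\<close>.\<close>

lemma line_fun_affine:
  assumes t: "0 \<le> t" "t \<le> 1"
  shows "line_fun r p s t y = (1 - t) * line_fun r p s 0 y + t * line_fun r p s 1 y"
proof (rule ccontr)
  define G where "G = (\<lambda>t y. (1 - t) * line_fun r p s 0 y + t * line_fun r p s 1 y)"
  define F where "F = line_fun r p s"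
  assume "line_fun r p s t y \<noteq> (1 - t) * line_fun r p s 0 y + t * line_fun r p s 1 y"
  then have ne: "F t y \<noteq> G t y" by (simp add: G_def F_def)
  have 0: "line_pt p s 0 \<in> inner_outcomes" and 1: "line_pt p s 1 \<in> inner_outcomes" using p s by auto
  have tI: "line_pt p s t \<in> inner_outcomes" using line_pt_between[OF 0 1 t] .
  \<comment> \<open>The mean of the true and the interpolated value: subtracting it leaves values of
    equal size and opposite sign.\<close>
  define k where "k = (F t y + G t y) / 2"
  define c where "c = (\<Sum>a\<in>UNIV. y $ a)"
  define d where "d = y - c *\<^sub>R line_pt p s t - k *\<^sub>R (s - p)"
  have "(\<Sum>a\<in>UNIV. d $ a) = c - c * (\<Sum>a\<in>UNIV. line_pt p s t $ a) - k * (\<Sum>a\<in>UNIV. (s - p) $ a)"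
    by (simp add: d_def c_def sum_subtractf sum_distrib_left right_diff_distrib)
  also have "\<dots> = 0"
    using outcomesD(2)[OF inner_outcomes_subset[OF tI]] sum_diff_outcomes[of s p] p s
    by (simp add: inner_outcomes_subset del: vector_minus_component)
  finally obtain n where "n > 0" "\<forall>u. \<bar>u\<bar> \<le> n \<longrightarrow> line_pt p s t + u *\<^sub>R d \<in> inner_outcomes"
    using inner_extend[OF tI] by blast
  then have n: "n > 0" "line_pt p s t + n *\<^sub>R d \<in> inner_outcomes" by auto
  define z where "z = line_pt p s t + n *\<^sub>R d"
  have z: "z \<in> outcomes" using n by (simp add: z_def inner_outcomes_subset)
  have lin: "line_fun r p s u z = u' + n * (line_fun r p s u y - c * u' - k)"
    if "line_pt p s u \<in> inner_outcomes" "u' = t - u" for u u'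
    by (simp add: z_def d_def line_fun_add line_fun_diff[of _ _ _ _ _ "k *\<^sub>R (s - p)"] line_fun_diff[of _ _ _ _ y]
        line_fun_scale line_fun_line_pt line_fun_direction that)
  have Fz: "F t z = n * ((F t y - G t y) / 2)"
    using lin[OF tI, of 0] by (simp add: F_def k_def field_simps)
  have "G t z = (1 - t) * t + t * (t - 1) + n * (G t y - c * ((1 - t) * t + t * (t - 1)) - k)"
    unfolding G_def lin[OF 0, of t, simplified] lin[OF 1, of "t - 1", simplified] by (simp add: algebra_simps)
  then have Gz: "G t z = - F t z"
    unfolding Fz by (simp add: k_def field_simps)
  have Fz0: "F t z \<noteq> 0" unfolding Fz using n(1) ne by simp
  obtain e1 where e1: "e1 > 0" "\<And>u. \<bar>u\<bar> \<le> e1 \<Longrightarrow> line_pt p s (0 + u) \<in> inner_outcomes"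
    using line_pt_extend[OF 0] by auto
  obtain e2 where e2: "e2 > 0" "\<And>u. \<bar>u\<bar> \<le> e2 \<Longrightarrow> line_pt p s (1 + u) \<in> inner_outcomes"
    using line_pt_extend[OF 1] by auto
  define e where "e = min e1 e2"
  have e': "e > 0" "e \<le> e1" "e \<le> e2" using e1(1) e2(1) by (auto simp: e_def)
  have e: "e > 0" "line_pt p s (- e) \<in> inner_outcomes" "line_pt p s (1 + e) \<in> inner_outcomes"
    using e' e1(2)[of "-e"] e2(2)[of e] by auto
  \<comment> \<open>\<open>z\<close> stays fixed while the base point of the functional moves, so
    openness of \<open>lower r z\<close> or \<open>upper r z\<close> makes the sign locally
    constant.\<close>
  obtain m where m: "m > 0" "\<And>x. x \<in> outcomes \<Longrightarrow> dist x (line_pt p s t) < m \<Longrightarrow>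
    sgn (pref_vec r x \<bullet> z) = sgn (F t z) \<or> x \<notin> inner_outcomes"
  proof (cases "F t z" "0::real" rule: linorder_cases)
    case less
    then have "sgn (pref_vec r (line_pt p s t) \<bullet> z) = -1" using line_fun_sgn[OF tI, of z] by (simp add: F_def)
    then have "line_pt p s t \<in> lower r z"
      using pref_vec(2)[OF r tI z] tI by (simp add: lower_def inner_outcomes_subset sgn_1_pos sgn_1_neg)
    from openin_near[OF lower_open[OF r z] this] obtain m where
      m: "m > 0" "\<And>x. x \<in> outcomes \<Longrightarrow> dist x (line_pt p s t) < m \<Longrightarrow> (z, x) \<in> r" by (simp add: lower_def) blast
    have "sgn (pref_vec r x \<bullet> z) = sgn (F t z)"
      if "x \<in> outcomes" "dist x (line_pt p s t) < m" "x \<in> inner_outcomes" for x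
      using pref_vec(2)[OF r that(3) z] m(2)[OF that(1,2)] less by simp
    then show ?thesis using that[OF m(1)] by blast
  next
    case greater
    then have "sgn (pref_vec r (line_pt p s t) \<bullet> z) = 1" using line_fun_sgn[OF tI, of z] by (simp add: F_def)
    then have "line_pt p s t \<in> upper r z"
      using pref_vec(1)[OF r tI z] tI by (simp add: upper_def inner_outcomes_subset sgn_1_pos sgn_1_neg)
    from openin_near[OF upper_open[OF r z] this] obtain m where
      m: "m > 0" "\<And>x. x \<in> outcomes \<Longrightarrow> dist x (line_pt p s t) < m \<Longrightarrow> (x, z) \<in> r" by (simp add: upper_def) blast
    have "sgn (pref_vec r x \<bullet> z) = sgn (F t z)"
      if "x \<in> outcomes" "dist x (line_pt p s t) < m" "x \<in> inner_outcomes" for x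
      using pref_vec(1)[OF r that(3) z] m(2)[OF that(1,2)] greater by simp
    then show ?thesis using that[OF m(1)] by blast
  qed (use Fz0 in simp)
  define A where "A = \<bar>F 1 z - F 0 z\<bar>"
  \<comment> \<open>The three bounds give room for the grid, closeness to \<open>t\<close> for the
    sign of \<open>F\<close>, and closeness for the affine function \<open>G\<close>, whose slope is
    \<open>A\<close> in absolute value.\<close>
  define x where "x = min (e / 2) (min (m / (norm (s - p) + 1)) (\<bar>F t z\<bar> / (A + 1)))"
  have x: "x > 0" using e(1) m(1) Fz0 by (auto simp: x_def A_def add_nonneg_pos)
  obtain N :: nat where N: "N > 0" "1 / N < x"
  proof -
    obtain k where "inverse (real (Suc k)) < x" using reals_Archimedean[OF x] ..
    then show thesis using that[of "Suc k"] by (simp add: inverse_eq_divide)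
  qed
  define j where "j = nat \<lfloor>t * N\<rfloor>"
  have "real j = \<lfloor>t * N\<rfloor>" using t by (simp add: j_def)
  then have j: "real j \<le> t * N" "t * N < real j + 1" by linarith+
  define u where "u = real j / N"
  have u: "u \<le> t" "t - u < x" "0 \<le> u"
  proof -
    show "u \<le> t" using j N by (simp add: u_def divide_simps)
    have "t < (real j + 1) / N" using j N by (simp add: pos_less_divide_eq)
    then show "t - u < x" using N by (simp add: u_def add_divide_distrib)
  qed (simp add: u_def)
  have uI: "line_pt p s u \<in> inner_outcomes" using line_pt_between[OF 0 1] u t by simp
  have "j \<le> N"
  proof -
    have "t * N \<le> N" using t by (simp add: mult_left_le_one_le)
    then show ?thesis using j by linarith
  qed
  moreover have "2 / real N \<le> e" using N(2) by (auto simp: x_def)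
  ultimately have FG: "F u z = G u z"
    using line_fun_grid[OF e(2,3) N(1)] by (simp add: F_def G_def u_def)
  have "dist (line_pt p s u) (line_pt p s t) = (t - u) * norm (s - p)"
  proof -
    have "line_pt p s u - line_pt p s t = (u - t) *\<^sub>R (s - p)" by (simp add: line_pt_def algebra_simps)
    then show ?thesis using u by (simp add: dist_norm)
  qed
  also have "\<dots> < m"
  proof -
    have "(t - u) * norm (s - p) \<le> (t - u) * (norm (s - p) + 1)" using u by (intro mult_left_mono) auto
    also have "\<dots> < m / (norm (s - p) + 1) * (norm (s - p) + 1)"
      using u by (intro mult_strict_right_mono) (auto simp: x_def add_nonneg_pos)
    also have "norm (s - p) + 1 \<noteq> 0" using norm_ge_zero[of "s - p"] by linarith
    then have "m / (norm (s - p) + 1) * (norm (s - p) + 1) = m" by simp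
    finally show ?thesis .
  qed
  finally have "sgn (F u z) = sgn (F t z)"
    using m(2)[of "line_pt p s u"] line_fun_sgn[OF uI, of z] uI by (simp add: F_def inner_outcomes_subset)
  moreover have "\<bar>G u z - G t z\<bar> < \<bar>F t z\<bar>"
  proof -
    have "G u z - G t z = (u - t) * (F 1 z - F 0 z)" by (simp add: G_def F_def algebra_simps)
    then have "\<bar>G u z - G t z\<bar> = (t - u) * A" using u by (simp add: abs_mult A_def)
    also have "\<dots> \<le> (t - u) * (A + 1)" using u by (intro mult_left_mono) auto
    also have "\<dots> < \<bar>F t z\<bar> / (A + 1) * (A + 1)"
      using u by (intro mult_strict_right_mono) (auto simp: x_def A_def add_nonneg_pos)
    also have "A + 1 \<noteq> 0" unfolding A_def by linarith
    then have "\<bar>F t z\<bar> / (A + 1) * (A + 1) = \<bar>F t z\<bar>" by simp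
    finally show ?thesis .
  qed
  ultimately have "sgn (F t z) = sgn (G u z)" "\<bar>G u z + F t z\<bar> < \<bar>F t z\<bar>" using FG Gz by simp_all
  then show False using Fz0 by (cases "F t z > 0"; cases "G u z > 0") (auto simp: sgn_real_def split: if_splits)
qed

text \<open>The affine law read at a zero of the interpolated functional. In the cross-multiplied
  form both sides scale alike in \<open>pref_vec r p\<close> and in \<open>pref_vec r s\<close>, so
  the arbitrary factors no longer matter.\<close>

lemma pref_vec_segment_strict:
  assumes l: "0 \<le> l" "l \<le> 1" and q: "pref_vec r (mix p l s) \<bullet> q = 0"
  shows "l * (pref_vec r p \<bullet> q) * (pref_vec r s \<bullet> p) = (1 - l) * (pref_vec r s \<bullet> q) * (pref_vec r p \<bullet> s)"
proof -
  have "line_pt p s (1 - l) = mix p l s" by (simp add: mix_def line_pt_def algebra_simps)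
  then have "line_fun r p s (1 - l) q = 0" using q by (simp add: line_fun_def)
  then have *: "l * line_fun r p s 0 q + (1 - l) * line_fun r p s 1 q = 0"
    using line_fun_affine[of "1 - l" q] l by simp
  have 0: "pref_vec r p \<bullet> s > 0" "pref_vec r s \<bullet> p < 0"
    using pref_vec(1)[OF r p inner_outcomes_subset[OF s]] pref_vec(2)[OF r s inner_outcomes_subset[OF p]] ps
    by simp_all
  have "line_fun r p s 0 q = (pref_vec r p \<bullet> q) / (pref_vec r p \<bullet> s)"
    "line_fun r p s 1 q = - (pref_vec r s \<bullet> q) / (pref_vec r s \<bullet> p)"
    using pref_vec_self[OF r p] pref_vec_self[OF r s] by (simp_all add: line_fun_def inner_diff_right)
  then have "l * ((pref_vec r p \<bullet> q) / (pref_vec r p \<bullet> s)) = (1 - l) * ((pref_vec r s \<bullet> q) / (pref_vec r s \<bullet> p))"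
    using * by simp
  then show ?thesis using 0 by (simp add: frac_eq_eq)
qed

end

lemma pref_vec_segment:
  assumes r: "r \<in> prefs" and p: "p \<in> inner_outcomes" and s: "s \<in> inner_outcomes"
    and ps: "pref_vec r p \<bullet> s \<noteq> 0"
    and l: "0 \<le> l" "l \<le> 1" and q: "pref_vec r (mix p l s) \<bullet> q = 0"
  shows "l * (pref_vec r p \<bullet> q) * (pref_vec r s \<bullet> p) = (1 - l) * (pref_vec r s \<bullet> q) * (pref_vec r p \<bullet> s)"
proof -
  consider "(p, s) \<in> r" | "(s, p) \<in> r"
    using pref_vec[OF r p inner_outcomes_subset[OF s]] ps by linarith
  then show ?thesis
  proof cases
    case 1
    then show ?thesis using pref_vec_segment_strict[OF r p s 1 l q] by simp
  next
    case 2
    have "mix s (1 - l) p = mix p l s" by (simp add: mix_def)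
    then show ?thesis using pref_vec_segment_strict[OF r s p 2, of "1 - l" q] l q by simp
  qed
qed

section \<open>The cocycle identity and the skew-symmetric rescaling of the functionals\<close>

lemma pref_vec_zero_commute:
  "r \<in> prefs \<Longrightarrow> p \<in> inner_outcomes \<Longrightarrow> q \<in> inner_outcomes \<Longrightarrow> pref_vec r p \<bullet> q = 0 \<longleftrightarrow> pref_vec r q \<bullet> p = 0"
  using pref_vec_sgn[of r p q] by (auto simp: sgn_if split: if_splits)

text \<open>
  The three functionals of a triangle are compared through the point of the side opposite to the
  middle vertex that is indifferent to that vertex.
\<close>

lemma cocycle_chain:
  assumes r: "r \<in> prefs" and p: "p \<in> inner_outcomes" and q: "q \<in> inner_outcomes" and s: "s \<in> inner_outcomes"
    and pq: "pref_vec r q \<bullet> p < 0" and qs: "pref_vec r q \<bullet> s > 0" and ps: "pref_vec r p \<bullet> s \<noteq> 0"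
  shows "(pref_vec r p \<bullet> s) * (pref_vec r s \<bullet> q) * (pref_vec r q \<bullet> p)
    = - ((pref_vec r p \<bullet> q) * (pref_vec r q \<bullet> s) * (pref_vec r s \<bullet> p))"
proof -
  define D where "D = pref_vec r q \<bullet> s - pref_vec r q \<bullet> p"
  define l where "l = (pref_vec r q \<bullet> s) / D"
  have D: "D > 0" using pq qs by (simp add: D_def)
  have l: "0 \<le> l" "l \<le> 1" "l * D = pref_vec r q \<bullet> s" "(1 - l) * D = - (pref_vec r q \<bullet> p)"
    using D pq qs by (auto simp: l_def D_def field_simps)
  have "D * (pref_vec r q \<bullet> mix p l s) = (l * D) * (pref_vec r q \<bullet> p) + ((1 - l) * D) * (pref_vec r q \<bullet> s)"
    by (simp add: inner_mix algebra_simps)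
  also have "\<dots> = 0" unfolding l by simp
  finally have "pref_vec r q \<bullet> mix p l s = 0" using D by simp
  then have "pref_vec r (mix p l s) \<bullet> q = 0"
    using pref_vec_zero_commute[OF r convex_inner_outcomes[OF p s l(1,2)] q] by simp
  from pref_vec_segment[OF r p s ps l(1,2) this]
  have "(l * D) * (pref_vec r p \<bullet> q) * (pref_vec r s \<bullet> p) = ((1 - l) * D) * (pref_vec r s \<bullet> q) * (pref_vec r p \<bullet> s)"
    by simp
  then show ?thesis unfolding l by (simp add: mult_ac)
qed

text \<open>Every orientation of a triangle contains a directed path of two edges, to which
  \<open>cocycle_chain\<close> applies. The identity says that one cyclic product is minus the
  other, which is invariant under relabelling the vertices.\<close>

lemma cocycle:
  assumes r: "r \<in> prefs" and p: "p \<in> inner_outcomes" and q: "q \<in> inner_outcomes" and s: "s \<in> inner_outcomes"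
    and pq: "pref_vec r p \<bullet> q \<noteq> 0" and qs: "pref_vec r q \<bullet> s \<noteq> 0" and ps: "pref_vec r p \<bullet> s \<noteq> 0"
  shows "(pref_vec r p \<bullet> s) * (pref_vec r s \<bullet> q) * (pref_vec r q \<bullet> p)
    = - ((pref_vec r p \<bullet> q) * (pref_vec r q \<bullet> s) * (pref_vec r s \<bullet> p))"
proof -
  define f where "f = (\<lambda>x y. pref_vec r x \<bullet> y)"
  have sg: "f x y > 0 \<longleftrightarrow> f y x < 0" "f x y < 0 \<longleftrightarrow> f y x > 0" if "x \<in> inner_outcomes" "y \<in> inner_outcomes" for x y
    using pref_vec_sgn[OF r that] by (auto simp: f_def sgn_if split: if_splits)
  have chain: "f x z * f z y * f y x = - (f x y * f y z * f z x)"
    if "f x y > 0" "f y z > 0" "f x z \<noteq> 0" "x \<in> inner_outcomes" "y \<in> inner_outcomes" "z \<in> inner_outcomes" for x y z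
    using cocycle_chain[OF r that(4-6)] that sg(1)[OF that(4,5)] by (simp add: f_def)
  have nz: "f p q \<noteq> 0" "f q s \<noteq> 0" "f p s \<noteq> 0" "f q p \<noteq> 0" "f s q \<noteq> 0" "f s p \<noteq> 0"
    using pq qs ps pref_vec_zero_commute[OF r] p q s by (auto simp: f_def)
  have fg: "f x y > 0 \<or> f y x > 0" if "x \<in> inner_outcomes" "y \<in> inner_outcomes" "f x y \<noteq> 0" for x y
    using sg[OF that(1,2)] that(3) by linarith
  have "f p s * f s q * f q p = - (f p q * f q s * f s p)"
  proof (cases "f p q > 0")
    case True
    show ?thesis
    proof (cases "f q s > 0")
      case True
      then show ?thesis using chain[of p q s] \<open>f p q > 0\<close> nz p q s by simp
    next
      case False
      then have sq: "f s q > 0" using fg[OF q s] nz by simp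
      show ?thesis
      proof (cases "f p s > 0")
        case True
        then show ?thesis using chain[of p s q] sq nz p q s by (simp add: mult_ac)
      next
        case False
        then have "f s p > 0" using fg[OF p s] nz by simp
        then show ?thesis using chain[of s p q] True nz p q s by (simp add: mult_ac)
      qed
    qed
  next
    case False
    then have qp: "f q p > 0" using fg[OF p q] nz by simp
    show ?thesis
    proof (cases "f q s > 0")
      case True
      show ?thesis
      proof (cases "f p s > 0")
        case True
        then show ?thesis using chain[of q p s] qp nz p q s by (simp add: mult_ac)
      next
        case False
        then have "f s p > 0" using fg[OF p s] nz by simp
        then show ?thesis using chain[of q s p] \<open>f q s > 0\<close> nz p q s by (simp add: mult_ac)
      qed
    next
      case False
      then have sq: "f s q > 0" using fg[OF q s] nz by simp
      then show ?thesis using chain[of s q p] qp nz p q s by (simp add: mult_ac)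
    qed
  qed
  then show ?thesis by (simp add: f_def)
qed

text \<open>Finitely many hyperplanes cannot cover the interior: moving towards a vertex on which
  the new functional is nonzero spoils an earlier functional for at most one weight each.\<close>

lemma generic_inner_outcome:
  fixes V :: "(real ^ 'a::finite) set"
  assumes "finite V" "0 \<notin> V"
  shows "\<exists>x\<in>inner_outcomes. \<forall>v\<in>V. v \<bullet> x \<noteq> 0"
  using assms
proof (induction rule: finite_induct)
  case empty
  then show ?case using inner_outcomes_nonempty by blast
next
  case (insert v V)
  then obtain x where x: "x \<in> inner_outcomes" "\<And>w. w \<in> V \<Longrightarrow> w \<bullet> x \<noteq> 0" by auto
  obtain a where a: "v $ a \<noteq> 0" using insert.prems by (auto simp: vec_eq_iff)
  show ?case
  proof (cases "v \<bullet> x = 0")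
    case True
    define E where "E = (\<lambda>w. - (w \<bullet> x) / (w \<bullet> (pure a - x))) ` V"
    have "infinite ({0<..<1::real} - E)" using insert.hyps by (simp add: E_def infinite_Ioo Diff_infinite_finite)
    then obtain l where "l \<in> {0<..<1} - E" using infinite_imp_nonempty by blast
    then have l: "0 < l" "l < 1" "l \<notin> E" by auto
    have m: "w \<bullet> mix (pure a) l x = w \<bullet> x + l * (w \<bullet> (pure a - x))" for w
      by (simp add: inner_mix inner_diff_right algebra_simps)
    have "w \<bullet> mix (pure a) l x \<noteq> 0" if w: "w \<in> V" for w
    proof
      assume 0: "w \<bullet> mix (pure a) l x = 0"
      then have "w \<bullet> (pure a - x) \<noteq> 0" using m[of w] x(2)[OF w] by auto
      then have "l = - (w \<bullet> x) / (w \<bullet> (pure a - x))" using 0 m[of w] by (simp add: field_simps)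
      then show False using l(3) w by (auto simp: E_def)
    qed
    moreover have "v \<bullet> mix (pure a) l x \<noteq> 0" using True a l by (simp add: inner_mix inner_pure)
    moreover have "mix (pure a) l x \<in> inner_outcomes"
      using inner_mix_outcomes[OF x(1) pure_outcomes, of "1 - l" a] l by (simp add: mix_def add.commute)
    ultimately show ?thesis by blast
  qed (use x in blast)
qed

text \<open>Skew-symmetry prescribes the quotient of the factors at \<open>x\<close> and
  \<open>y\<close> as \<open>k x y\<close> wherever \<open>f x y\<close> is nonzero. The cocycle
  identity makes \<open>k\<close> multiplicative, so the factors can be read off relative to one
  reference outcome \<open>o'\<close>.\<close>

lemma skew_scaling:
  fixes r :: "'a::finite pref"
  assumes r: "r \<in> prefs"
  shows "\<exists>w. (\<forall>p\<in>inner_outcomes. \<forall>q\<in>inner_outcomes. w p \<bullet> q = - (w q \<bullet> p)) \<and>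
    (\<forall>p\<in>inner_outcomes. \<exists>c>0. w p = c *\<^sub>R pref_vec r p)"
proof (cases "\<forall>p\<in>inner_outcomes. pref_vec r p = 0")
  case True
  then show ?thesis by (intro exI[of _ "pref_vec r"]) (auto intro!: exI[of _ 1])
next
  case False
  then obtain o' where o': "o' \<in> inner_outcomes" "pref_vec r o' \<noteq> 0" by blast
  define f where "f = (\<lambda>x y. pref_vec r x \<bullet> y)"
  define k where "k = (\<lambda>x y. - f y x / f x y)"
  have f0: "f x y = 0 \<longleftrightarrow> f y x = 0" if "x \<in> inner_outcomes" "y \<in> inner_outcomes" for x y
    using pref_vec_zero_commute[OF r that] by (simp add: f_def)
  have kpos: "k x y > 0" if "x \<in> inner_outcomes" "y \<in> inner_outcomes" "f x y \<noteq> 0" for x y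
    using pref_vec_sgn[OF r that(1,2)] that(3) by (auto simp: k_def f_def sgn_if divide_less_0_iff split: if_splits)
  have kinv: "k x y * k y x = 1" if "x \<in> inner_outcomes" "y \<in> inner_outcomes" "f x y \<noteq> 0" for x y
    using f0[OF that(1,2)] that(3) by (simp add: k_def)
  have kk: "k x y * k y z = k x z"
    if "x \<in> inner_outcomes" "y \<in> inner_outcomes" "z \<in> inner_outcomes" "f x y \<noteq> 0" "f y z \<noteq> 0" "f x z \<noteq> 0" for x y z
  proof -
    have "f x z * f z y * f y x = - (f x y * f y z * f z x)"
      using cocycle[OF r that(1-3)] that(4-6) by (simp add: f_def)
    then show ?thesis using that(4-6) by (simp add: k_def field_simps)
  qed
  have gen: "\<exists>x\<in>inner_outcomes. \<forall>p\<in>P. f p x \<noteq> 0" if "finite P" "\<forall>p\<in>P. pref_vec r p \<noteq> 0" for P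
    using generic_inner_outcome[of "pref_vec r ` P"] that by (auto simp: f_def image_iff)
  have vz: "pref_vec r x \<noteq> 0" if "f x y \<noteq> 0" for x y
  proof
    assume "pref_vec r x = 0"
    then show False using that by (simp add: f_def)
  qed
  define ok where "ok = (\<lambda>p x. x \<in> inner_outcomes \<and> f p x \<noteq> 0 \<and> f o' x \<noteq> 0)"
  \<comment> \<open>\<open>k p o'\<close> is of no use when \<open>f p o' = 0\<close>; hence the
    detour through an auxiliary \<open>x\<close> in general position to both. The fact
    \<open>K\<close> shows that the choice of \<open>x\<close> does not matter.\<close>
  define K where "K = (\<lambda>p. let x = SOME x. ok p x in k p x * k x o')"
  have K: "K p = k p x * k x o'" if p: "p \<in> inner_outcomes" "ok p x" for p x
  proof -
    define y where "y = (SOME x. ok p x)"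
    have y: "ok p y" unfolding y_def using that(2) by (rule someI)
    have X: "x \<in> inner_outcomes" "f p x \<noteq> 0" "f o' x \<noteq> 0" and Y: "y \<in> inner_outcomes" "f p y \<noteq> 0" "f o' y \<noteq> 0"
      using that(2) y by (auto simp: ok_def)
    have ne: "f x p \<noteq> 0" "f y p \<noteq> 0" "f x o' \<noteq> 0" "f y o' \<noteq> 0" using X Y f0 p o' by auto
    \<comment> \<open>The routes through \<open>x\<close> and \<open>y\<close> cannot be compared
      directly, as \<open>f x y\<close> may vanish; both are compared with the route through a
      generic \<open>z\<close>.\<close>
    then have "\<exists>z\<in>inner_outcomes. \<forall>q\<in>{p, o', x, y}. f q z \<noteq> 0"
      using o'(2) vz[OF X(2)] vz[OF ne(1)] vz[OF ne(2)] by (intro gen) auto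
    then obtain z where z: "z \<in> inner_outcomes" "f p z \<noteq> 0" "f o' z \<noteq> 0" "f x z \<noteq> 0" "f y z \<noteq> 0" by auto
    have zs: "f z p \<noteq> 0" "f z o' \<noteq> 0" "f z x \<noteq> 0" "f z y \<noteq> 0"
      using z f0[OF z(1)] p(1) o'(1) X(1) Y(1) by auto
    have *: "k p v * k v o' = k p z * k z o'" if v: "v \<in> inner_outcomes" "f p v \<noteq> 0" "f v o' \<noteq> 0" "f v z \<noteq> 0" "f z v \<noteq> 0" for v
    proof -
      have "k p v = k p z * k z v" using kk[OF p(1) z(1) v(1)] z zs v by simp
      moreover have "k v o' = k v z * k z o'" using kk[OF v(1) z(1) o'(1)] z zs v by simp
      ultimately have "k p v * k v o' = k p z * (k z v * k v z) * k z o'" by simp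
      then show ?thesis using kinv[OF z(1) v(1) v(5)] by simp
    qed
    have "k p x * k x o' = k p y * k y o'" using *[of x] *[of y] X Y z zs ne by simp
    then show ?thesis by (simp add: K_def y_def Let_def)
  qed
  have Kpos: "K p > 0" if p: "p \<in> inner_outcomes" "pref_vec r p \<noteq> 0" for p
  proof -
    have "\<exists>z\<in>inner_outcomes. \<forall>q\<in>{p, o'}. f q z \<noteq> 0" using p(2) o'(2) by (intro gen) auto
    then obtain x where x: "x \<in> inner_outcomes" "f p x \<noteq> 0" "f o' x \<noteq> 0" by auto
    have "f x o' \<noteq> 0" using f0[OF o'(1) x(1)] x(3) by simp
    moreover have "ok p x" using x by (simp add: ok_def)
    ultimately show ?thesis using K[OF p(1)] kpos[OF p(1) x(1,2)] kpos[OF x(1) o'(1)] by simp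
  qed
  have Kk: "K p * f p q = - (K q * f q p)" if p: "p \<in> inner_outcomes" and q: "q \<in> inner_outcomes" for p q
  proof (cases "f p q = 0")
    case True
    then show ?thesis using f0[OF p q] by simp
  next
    case False
    then have qp: "f q p \<noteq> 0" using f0[OF p q] by simp
    have "\<exists>z\<in>inner_outcomes. \<forall>v\<in>{p, o', q}. f v z \<noteq> 0"
      using vz[OF False] vz[OF qp] o'(2) by (intro gen) auto
    then obtain x where x: "x \<in> inner_outcomes" "f p x \<noteq> 0" "f o' x \<noteq> 0" "f q x \<noteq> 0" by auto
    have xs: "f x p \<noteq> 0" "f x o' \<noteq> 0" "f x q \<noteq> 0" using x f0[OF x(1)] p q o'(1) by auto
    have "ok p x" "ok q x" using x by (simp_all add: ok_def)
    then have "K p = k p x * k x o'" "K q = k q x * k x o'" using K[OF p] K[OF q] by blast+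
    moreover have "k p x = k p q * k q x" using kk[OF p q x(1)] False x by simp
    ultimately have "K p = k p q * K q" by simp
    then show ?thesis using False by (simp add: k_def)
  qed
  define w where "w = (\<lambda>p. if pref_vec r p = 0 then 0 else K p *\<^sub>R pref_vec r p)"
  have "w p \<bullet> q = K p * f p q" for p q by (simp add: w_def f_def)
  then have "w p \<bullet> q = - (w q \<bullet> p)" if "p \<in> inner_outcomes" "q \<in> inner_outcomes" for p q
    using Kk[OF that] by (simp only:)
  moreover have "\<exists>c>0. w p = c *\<^sub>R pref_vec r p" if "p \<in> inner_outcomes" for p
  proof (cases "pref_vec r p = 0")
    case True
    then show ?thesis by (intro exI[of _ 1]) (simp add: w_def)
  next
    case False
    then show ?thesis using Kpos[OF that False] by (intro exI[of _ "K p"]) (simp add: w_def)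
  qed
  ultimately show ?thesis by (intro exI[of _ w] conjI ballI)
qed

subsection \<open>Representation by a skew matrix\<close>

definition bil :: "('a::finite \<Rightarrow> 'a \<Rightarrow> real) \<Rightarrow> real ^ 'a \<Rightarrow> real ^ 'a \<Rightarrow> real" where
  "bil M x y = (\<Sum>a\<in>UNIV. \<Sum>b\<in>UNIV. x $ a * y $ b * M a b)"

definition skew :: "('a \<Rightarrow> 'a \<Rightarrow> real) \<Rightarrow> bool" where
  "skew M \<longleftrightarrow> (\<forall>a b. M a b = - M b a)"

lemma bil_add_left: "bil M (x + y) z = bil M x z + bil M y z"
  and bil_add_right: "bil M x (y + z) = bil M x y + bil M x z"
  by (simp_all add: bil_def sum.distrib distrib_right distrib_left)

lemma bil_diff_left: "bil M (x - y) z = bil M x z - bil M y z"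
  and bil_diff_right: "bil M x (y - z) = bil M x y - bil M x z"
  by (simp_all add: bil_def sum_subtractf left_diff_distrib right_diff_distrib)

lemma bil_scale_left: "bil M (c *\<^sub>R x) z = c * bil M x z"
  and bil_scale_right: "bil M x (c *\<^sub>R y) = c * bil M x y"
  by (simp_all add: bil_def sum_distrib_left mult_ac)

lemmas bil_linear = bil_add_left bil_add_right bil_diff_left bil_diff_right bil_scale_left bil_scale_right

lemma bil_mix_left: "bil M (mix p l q) y = l * bil M p y + (1 - l) * bil M q y"
  and bil_mix_right: "bil M y (mix p l q) = l * bil M y p + (1 - l) * bil M y q"
  by (simp_all add: mix_def bil_linear)

lemma pure_nth: "pure a $ b = (if a = b then 1 else 0)"
  by (simp add: pure_def axis_def)

lemma bil_pure: "bil M (pure a) (pure b) = M a b"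
proof -
  have "bil M (pure a) (pure b) = (\<Sum>i\<in>UNIV. \<Sum>j\<in>UNIV. if b = j then (if a = i then M i j else 0) else 0)"
    unfolding bil_def by (intro sum.cong refl) (simp add: pure_nth)
  then show ?thesis by simp
qed

lemma bil_skew:
  assumes "skew M" shows "bil M x y = - bil M y x"
proof -
  have M: "M a b = - M b a" for a b using assms unfolding skew_def by blast
  have "x $ a * y $ b * M a b = - (y $ b * x $ a * M b a)" for a b
    by (subst M) (simp only: mult_minus_right mult.commute[of "x $ a"])
  then have "bil M x y = (\<Sum>a\<in>UNIV. \<Sum>b\<in>UNIV. - (y $ b * x $ a * M b a))"
    unfolding bil_def by (intro sum.cong refl)
  also have "\<dots> = - (\<Sum>a\<in>UNIV. \<Sum>b\<in>UNIV. y $ b * x $ a * M b a)"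
    by (simp only: sum_negf)
  also have "\<dots> = - bil M y x" unfolding bil_def by (subst sum.swap) (rule refl)
  finally show ?thesis .
qed

lemma bil_self: "skew M \<Longrightarrow> bil M x x = 0"
  using bil_skew[of M x x] by linarith

lemma inner_expansion: "v \<bullet> x = (\<Sum>a\<in>UNIV. x $ a * (v \<bullet> pure a))"
  unfolding inner_pure by (simp add: inner_vec_def mult.commute)

text \<open>Skew-symmetry alone forces linearity: \<open>w p \<bullet> q\<close> is linear in
  \<open>q\<close>, hence also in \<open>p\<close>. Vertices are not interior, so they are reached
  through \<open>pure a = 2 *\<^sub>R b a - u\<close> with \<open>b a\<close> and \<open>u\<close>
  interior.\<close>

lemma skew_matrix_inner:
  fixes w :: "real ^ 'a::finite \<Rightarrow> real ^ 'a"
  assumes w: "\<And>p q. p \<in> inner_outcomes \<Longrightarrow> q \<in> inner_outcomes \<Longrightarrow> w p \<bullet> q = - (w q \<bullet> p)"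
  shows "\<exists>M. skew M \<and> (\<forall>p\<in>inner_outcomes. \<forall>y. w p \<bullet> y = bil M p y)"
proof -
  obtain u :: "real ^ 'a" where u: "u \<in> inner_outcomes" using inner_outcomes_nonempty by blast
  define b where "b = (\<lambda>a. mix u (1/2) (pure a))"
  have b: "b a \<in> inner_outcomes" for a
    unfolding b_def using inner_mix_outcomes[OF u pure_outcomes] by simp
  have pure_b: "pure a = 2 *\<^sub>R b a - u" for a by (simp add: b_def mix_def scaleR_add_right)
  have on_pure: "v \<bullet> pure a = 2 * (v \<bullet> b a) - v \<bullet> u" for v a
    by (subst pure_b) (simp add: inner_diff_right)
  \<comment> \<open>The value at \<open>pure a\<close> of the linear extension of
    \<open>w\<close>.\<close>
  define R where "R = (\<lambda>a. 2 *\<^sub>R w (b a) - w u)"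
  define M where "M = (\<lambda>a c. R a $ c)"
  have R: "R a \<bullet> q = - (w q \<bullet> pure a)" if "q \<in> inner_outcomes" for a q
    unfolding on_pure using w[OF b that, of a] w[OF u that] by (simp add: R_def inner_diff_left)
  have "w u \<bullet> u = 0" using w[OF u u] by simp
  have MM: "M a c = 2 * (R a \<bullet> b c) - R a \<bullet> u" for a c
    unfolding on_pure[symmetric] by (simp add: M_def inner_pure)
  have "M a c = - M c a" for a c
    unfolding MM R[OF b] R[OF u] unfolding on_pure
    using w[OF b b, of a c] w[OF b u, of a] w[OF b u, of c] \<open>w u \<bullet> u = 0\<close> by simp
  then have "skew M" unfolding skew_def by blast
  moreover have "w p \<bullet> y = bil M p y" if p: "p \<in> inner_outcomes" for p y
  proof -
    define v where "v = w p - (\<Sum>a\<in>UNIV. p $ a *\<^sub>R R a)"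
    have "v \<bullet> q = 0" if q: "q \<in> inner_outcomes" for q
    proof -
      have "v \<bullet> q = w p \<bullet> q + (\<Sum>a\<in>UNIV. p $ a * (w q \<bullet> pure a))"
        by (simp add: v_def inner_diff_left inner_sum_left R[OF q] sum_negf)
      also have "\<dots> = w p \<bullet> q + w q \<bullet> p" by (simp only: inner_expansion[of "w q" p])
      finally show ?thesis using w[OF p q] by linarith
    qed
    then have "v $ a = 0" for a using on_pure[of v a] b[of a] u by (simp add: inner_pure)
    then have "v = 0" by (simp add: vec_eq_iff)
    then have wp: "w p = (\<Sum>a\<in>UNIV. p $ a *\<^sub>R R a)" by (simp add: v_def)
    have "w p \<bullet> y = (\<Sum>a\<in>UNIV. p $ a * (\<Sum>c\<in>UNIV. y $ c * R a $ c))"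
      unfolding wp inner_sum_left inner_scaleR_left by (simp add: inner_expansion[of _ y] inner_pure)
    then show ?thesis by (simp add: bil_def M_def sum_distrib_left mult.assoc)
  qed
  ultimately show ?thesis by blast
qed

lemma positive_mix:
  fixes \<alpha> \<beta> :: real
  assumes "\<beta> > 0" shows "\<exists>e>0. e < 1 \<and> e * \<alpha> + (1 - e) * \<beta> > 0"
proof -
  define e where "e = \<beta> / (2 * (\<beta> + \<bar>\<alpha>\<bar>))"
  have d: "2 * (\<beta> + \<bar>\<alpha>\<bar>) > 0" using assms by simp
  have e: "0 < e" "e < 1" using assms d by (auto simp: e_def pos_divide_less_eq)
  have eq: "e * (2 * (\<beta> + \<bar>\<alpha>\<bar>)) = \<beta>" using d by (simp add: e_def)
  have "e * - \<bar>\<alpha>\<bar> \<le> e * \<alpha>" using e by (intro mult_left_mono) auto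
  moreover have "e * (\<beta> + \<bar>\<alpha>\<bar>) = \<beta> / 2" using eq by (simp add: algebra_simps)
  then have "e * - \<bar>\<alpha>\<bar> + (1 - e) * \<beta> = \<beta> / 2" by (simp add: algebra_simps)
  ultimately have "e * \<alpha> + (1 - e) * \<beta> > 0" using assms by linarith
  then show ?thesis using e by blast
qed

text \<open>
  Outcomes on the boundary of the simplex need a separate argument: there the functional of an
  outcome is not determined by the relation.
\<close>

lemma boundary_strict:
  assumes r: "r \<in> prefs" and M: "skew M"
    and inner: "\<And>p q. p \<in> inner_outcomes \<Longrightarrow> q \<in> outcomes \<Longrightarrow> (p, q) \<in> r \<longleftrightarrow> bil M p q > 0"
      "\<And>p q. p \<in> inner_outcomes \<Longrightarrow> q \<in> outcomes \<Longrightarrow> (q, p) \<in> r \<longleftrightarrow> bil M p q < 0"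
    and pq: "(p, q) \<in> r"
  shows "bil M p q > 0"
proof (rule ccontr)
  assume "\<not> bil M p q > 0"
  then have B: "bil M p q \<le> 0" by simp
  have P: "p \<in> outcomes" and Q: "q \<in> outcomes" using pref_subset[OF r pq] by auto
  obtain s :: "real ^ 'a" where s: "s \<in> inner_outcomes" using inner_outcomes_nonempty by blast
  have S: "s \<in> outcomes" using s by (rule inner_outcomes_subset)
  have mixI: "mix s e x \<in> inner_outcomes" if "0 < e" "e \<le> 1" "x \<in> outcomes" for e x
    using inner_mix_outcomes[OF s that(3) that(1,2)] .
  have sq: "bil M s q > 0"
  proof -
    obtain e where e: "e > 0" "e \<le> 1" "\<forall>l. 0 \<le> l \<and> l \<le> e \<longrightarrow> (mix s l p, q) \<in> r"
      using strict_mix_near_left[OF r pq S] by blast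
    then have "(mix s e p, q) \<in> r" by simp
    then have "e * bil M s q + (1 - e) * bil M p q > 0"
      using inner(1)[OF mixI[OF e(1,2) P] Q] by (simp add: bil_mix_left)
    moreover have "(1 - e) * bil M p q \<le> 0" using e B by (simp add: mult_nonneg_nonpos)
    ultimately have "e * bil M s q > 0" by linarith
    then show ?thesis using e(1) by (simp add: zero_less_mult_iff)
  qed
  have ps: "bil M p s > 0"
  proof -
    obtain e where e: "e > 0" "e \<le> 1" "\<forall>l. 0 \<le> l \<and> l \<le> e \<longrightarrow> (p, mix s l q) \<in> r"
      using strict_mix_near_right[OF r pq S] by blast
    then have "(p, mix s e q) \<in> r" by simp
    then have "bil M (mix s e q) p < 0" using inner(2)[OF mixI[OF e(1,2) Q] P] by simp
    then have "bil M p (mix s e q) > 0" using bil_skew[OF M, of p "mix s e q"] by linarith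
    then have "e * bil M p s + (1 - e) * bil M p q > 0" by (simp add: bil_mix_right)
    moreover have "(1 - e) * bil M p q \<le> 0" using e B by (simp add: mult_nonneg_nonpos)
    ultimately have "e * bil M p s > 0" by linarith
    then show ?thesis using e(1) by (simp add: zero_less_mult_iff)
  qed
  \<comment> \<open>The weight at which \<open>bil M s\<close> vanishes on the segment from
    \<open>p\<close> to \<open>q\<close>. Perturbing \<open>p\<close> towards \<open>s\<close> then
    does not disturb the sign of \<open>bil M p q\<close> in the comparison with
    \<open>m\<close>.\<close>
  define l where "l = bil M s q / (bil M p s + bil M s q)"
  have l: "0 < l" "l < 1" using sq ps by (auto simp: l_def)
  define m where "m = mix p l q"
  have Mo: "m \<in> outcomes" using l P Q by (simp add: m_def mix_outcomes)
  have ms: "bil M s m = 0"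
  proof -
    have "l * (bil M p s + bil M s q) = bil M s q" using sq ps by (simp add: l_def)
    moreover have "bil M s m = l * bil M s p + (1 - l) * bil M s q" by (simp add: m_def bil_mix_right)
    moreover have "bil M s p = - bil M p s" by (rule bil_skew[OF M])
    ultimately show ?thesis by (simp add: algebra_simps)
  qed
  have "(p, m) \<in> r" unfolding m_def using strict_mix_left[OF r pq, of l] l by simp
  then obtain e where e: "e > 0" "e \<le> 1" "\<forall>l. 0 \<le> l \<and> l \<le> e \<longrightarrow> (mix s l p, m) \<in> r"
    using strict_mix_near_left[OF r _ S] by blast
  then have "(mix s e p, m) \<in> r" by simp
  then have "bil M (mix s e p) m > 0" using inner(1)[OF mixI[OF e(1,2) P] Mo] by simp
  moreover have "bil M (mix s e p) m = (1 - e) * ((1 - l) * bil M p q)"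
    unfolding bil_mix_left ms by (simp add: m_def bil_mix_right bil_self[OF M])
  moreover have "(1 - e) * ((1 - l) * bil M p q) \<le> 0"
    using e l B by (intro mult_nonneg_nonpos) auto
  ultimately show False by linarith
qed

text \<open>If strict preference failed in spite of \<open>bil M p q > 0\<close>, then
  \<open>p\<close> and \<open>q\<close> would be indifferent, and \<open>claim\<close>, applied to
  their midpoint \<open>m\<close>, would make \<open>bil M m\<close> positive on the whole interior.
  But \<open>bil M p m > 0\<close>, and this persists at interior outcomes near \<open>p\<close>,
  contrary to skew-symmetry.\<close>

lemma boundary_representation:
  assumes r: "r \<in> prefs" and M: "skew M"
    and inner: "\<And>p q. p \<in> inner_outcomes \<Longrightarrow> q \<in> outcomes \<Longrightarrow> (p, q) \<in> r \<longleftrightarrow> bil M p q > 0"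
      "\<And>p q. p \<in> inner_outcomes \<Longrightarrow> q \<in> outcomes \<Longrightarrow> (q, p) \<in> r \<longleftrightarrow> bil M p q < 0"
    and P: "p \<in> outcomes" and Q: "q \<in> outcomes"
  shows "(p, q) \<in> r \<longleftrightarrow> bil M p q > 0"
proof
  assume pq: "(p, q) \<in> r"
  show "bil M p q > 0" by (rule boundary_strict[OF r M _ _ pq]) (fact inner)+
next
  assume B: "bil M p q > 0"
  show "(p, q) \<in> r"
  proof (rule ccontr)
    assume npq: "(p, q) \<notin> r"
    have claim: "bil M p x > 0"
      if P: "p \<in> outcomes" and np: "(p, q) \<notin> r" and B: "bil M p q > 0" and x: "x \<in> inner_outcomes" for p x
    proof (rule ccontr)
      assume "\<not> bil M p x > 0"
      then have "\<not> bil M x p < 0" using bil_skew[OF M, of p x] by linarith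
      then have px: "(p, x) \<notin> r" using inner(2)[OF x P] by simp
      obtain e where e: "e > 0" "e < 1" "e * bil M p x + (1 - e) * bil M p q > 0"
        using positive_mix[OF B] by blast
      have "bil M p (mix x e q) > 0" using e(3) by (simp add: bil_mix_right)
      then have "bil M (mix x e q) p < 0" using bil_skew[OF M, of p "mix x e q"] by linarith
      moreover have "mix x e q \<in> inner_outcomes" using inner_mix_outcomes[OF x Q] e by simp
      ultimately have "(p, mix x e q) \<in> r" using inner(2) P by blast
      moreover have "(p, mix x e q) \<notin> r"
        using weak_upper_mix[OF r P inner_outcomes_subset[OF x] Q px np] e by simp
      ultimately show False by blast
    qed
    have "(q, p) \<notin> r"
    proof
      assume qp: "(q, p) \<in> r"
      have "bil M q p > 0" by (rule boundary_strict[OF r M _ _ qp]) (fact inner)+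
      then show False using B bil_skew[OF M, of p q] by linarith
    qed
    then have i: "indiff r p q" using npq by (simp add: indiff_def)
    define m where "m = mix p (1/2) q"
    have Mo: "m \<in> outcomes" by (simp add: m_def mix_outcomes P Q)
    have "indiff r m q" using indiff_segment[OF r P Q i, of 0 "1/2"] by (simp add: m_def)
    then have mq: "(m, q) \<notin> r" by (simp add: indiff_def)
    have "bil M m q > 0" using B by (simp add: m_def bil_mix_left bil_self[OF M])
    note mx = claim[OF Mo mq this]
    have "bil M p m > 0" using B by (simp add: m_def bil_mix_right bil_self[OF M])
    moreover obtain u :: "real ^ 'a" where u: "u \<in> inner_outcomes" using inner_outcomes_nonempty by blast
    ultimately obtain e where e: "e > 0" "e < 1" "e * bil M u m + (1 - e) * bil M p m > 0"
      using positive_mix by blast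
    then have "bil M (mix u e p) m > 0" by (simp add: bil_mix_left)
    moreover have "bil M m (mix u e p) > 0" using mx inner_mix_outcomes[OF u P] e by simp
    ultimately show False using bil_skew[OF M, of m "mix u e p"] by linarith
  qed
qed

definition rep :: "'a::finite pref \<Rightarrow> ('a \<Rightarrow> 'a \<Rightarrow> real) \<Rightarrow> bool" where
  "rep r M \<longleftrightarrow> skew M \<and> (\<forall>p\<in>outcomes. \<forall>q\<in>outcomes. (p, q) \<in> r \<longleftrightarrow> bil M p q > 0)"

lemma rep_skew: "rep r M \<Longrightarrow> skew M"
  and rep_iff: "rep r M \<Longrightarrow> p \<in> outcomes \<Longrightarrow> q \<in> outcomes \<Longrightarrow> (p, q) \<in> r \<longleftrightarrow> bil M p q > 0"
  by (simp_all add: rep_def)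

theorem prefs_rep:
  assumes r: "r \<in> prefs" shows "\<exists>M. rep r M"
proof -
  obtain w where w: "\<And>p q. p \<in> inner_outcomes \<Longrightarrow> q \<in> inner_outcomes \<Longrightarrow> w p \<bullet> q = - (w q \<bullet> p)"
    and wv: "\<And>p. p \<in> inner_outcomes \<Longrightarrow> \<exists>c>0. w p = c *\<^sub>R pref_vec r p"
    using skew_scaling[OF r] by blast
  obtain M where M: "skew M" and wM: "\<And>p y. p \<in> inner_outcomes \<Longrightarrow> w p \<bullet> y = bil M p y"
    using skew_matrix_inner[of w, OF w] by blast
  have *: "sgn (bil M p q) = sgn (pref_vec r p \<bullet> q)" if p: "p \<in> inner_outcomes" for p q
  proof -
    obtain c where "c > 0" "w p = c *\<^sub>R pref_vec r p" using wv[OF p] by blast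
    then show ?thesis unfolding wM[OF p, symmetric] by (simp add: sgn_mult)
  qed
  have 1: "(p, q) \<in> r \<longleftrightarrow> bil M p q > 0" if "p \<in> inner_outcomes" "q \<in> outcomes" for p q
    unfolding pref_vec(1)[OF r that] using *[OF that(1), of q] sgn_1_pos by metis
  have 2: "(q, p) \<in> r \<longleftrightarrow> bil M p q < 0" if "p \<in> inner_outcomes" "q \<in> outcomes" for p q
    unfolding pref_vec(2)[OF r that] using *[OF that(1), of q] sgn_1_neg by metis
  show ?thesis unfolding rep_def
    using M boundary_representation[OF r M 1 2] by blast
qed

subsection \<open>Uniqueness of the representation\<close>

text \<open>Near the interior point \<open>p\<close> every direction of sum zero can be tested, so
  equal signs force \<open>h\<close> to vanish on each such direction annihilated by
  \<open>g\<close>; then \<open>h\<close> is a multiple of \<open>g\<close>.\<close>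

lemma functional_unique:
  fixes g h :: "real ^ 'a::finite"
  assumes p: "p \<in> inner_outcomes" and gp: "g \<bullet> p = 0" and hp: "h \<bullet> p = 0"
    and gh: "\<And>q. q \<in> outcomes \<Longrightarrow> g \<bullet> q > 0 \<longleftrightarrow> h \<bullet> q > 0" "\<And>q. q \<in> outcomes \<Longrightarrow> g \<bullet> q < 0 \<longleftrightarrow> h \<bullet> q < 0"
  shows "\<exists>c>0. \<forall>q\<in>outcomes. h \<bullet> q = c * (g \<bullet> q)"
proof (cases "\<forall>q\<in>outcomes. g \<bullet> q = 0")
  case True
  then have "h \<bullet> q = 0" if "q \<in> outcomes" for q
    using gh[OF that] that by (metis less_irrefl linorder_neqE_linordered_idom)
  then show ?thesis using True by (intro exI[of _ 1]) simp
next
  case False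
  then obtain q where q: "q \<in> outcomes" "g \<bullet> q \<noteq> 0" by blast
  define c where "c = (h \<bullet> q) / (g \<bullet> q)"
  have c: "c > 0" using gh[OF q(1)] q(2) by (simp add: c_def zero_less_divide_iff) linarith
  have "h \<bullet> x = c * (g \<bullet> x)" if x: "x \<in> outcomes" for x
  proof -
    define k where "k = (g \<bullet> x) / (g \<bullet> q)"
    define d where "d = (x - p) - k *\<^sub>R (q - p)"
    have "(\<Sum>a\<in>UNIV. d $ a) = (\<Sum>a\<in>UNIV. (x - p) $ a) - k * (\<Sum>a\<in>UNIV. (q - p) $ a)"
      unfolding d_def sum_distrib_left by (simp add: sum_subtractf)
    also have "\<dots> = 0"
      using sum_diff_outcomes[OF x inner_outcomes_subset[OF p]] sum_diff_outcomes[OF q(1) inner_outcomes_subset[OF p]]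
      by simp
    finally obtain e where e: "e > 0" "\<forall>t. \<bar>t\<bar> \<le> e \<longrightarrow> p + t *\<^sub>R d \<in> inner_outcomes"
      using inner_extend[OF p] by blast
    then have y: "p + e *\<^sub>R d \<in> outcomes" by (simp add: inner_outcomes_subset)
    have "g \<bullet> d = 0" using q(2) gp by (simp add: d_def k_def inner_diff_right)
    then have "g \<bullet> (p + e *\<^sub>R d) = 0" using gp by (simp add: inner_add_right)
    then have "h \<bullet> (p + e *\<^sub>R d) = 0" using gh[OF y] by linarith
    then have "h \<bullet> d = 0" using hp e(1) by (simp add: inner_add_right)
    then show ?thesis using hp by (simp add: d_def k_def c_def inner_diff_right)
  qed
  then show ?thesis using c by blast
qed

lemma bil_inner_vec: "bil M p y = (\<chi> b. \<Sum>a\<in>UNIV. p $ a * M a b) \<bullet> y"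
  unfolding bil_def by (subst sum.swap) (simp add: inner_vec_def sum_distrib_right sum_distrib_left mult_ac)

lemma bil_zero_inner:
  fixes N :: "'a::finite \<Rightarrow> 'a \<Rightarrow> real"
  assumes N: "\<And>p q. p \<in> inner_outcomes \<Longrightarrow> q \<in> inner_outcomes \<Longrightarrow> bil N p q = 0"
  shows "N a b = 0"
proof -
  obtain u :: "real ^ 'a" where u: "u \<in> inner_outcomes" using inner_outcomes_nonempty by blast
  define m where "m = (\<lambda>a. mix u (1/2) (pure a))"
  have m: "m a \<in> inner_outcomes" for a
    unfolding m_def using inner_mix_outcomes[OF u pure_outcomes] by simp
  have pure_m: "pure a = 2 *\<^sub>R m a - u" for a by (simp add: m_def mix_def scaleR_add_right)
  have "bil N (pure a) (pure b) = 0"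
    unfolding pure_m by (simp add: bil_linear N m u)
  then show ?thesis by (simp add: bil_pure)
qed

lemma bil_diff_matrix: "bil (\<lambda>a b. M' a b - c * M a b) p q = bil M' p q - c * bil M p q"
  by (simp add: bil_def right_diff_distrib sum_subtractf sum_distrib_left mult_ac)

text \<open>Each interior outcome gives a factor \<open>k p\<close> for its row. Skew-symmetry
  equates \<open>k p\<close> and \<open>k q\<close> whenever \<open>bil M p q\<close> is nonzero,
  and a generic third outcome links any two nonzero rows.\<close>

lemma bil_unique:
  fixes M M' :: "'a::finite \<Rightarrow> 'a \<Rightarrow> real"
  assumes M: "skew M" and M': "skew M'"
    and eq: "\<And>p q. p \<in> outcomes \<Longrightarrow> q \<in> outcomes \<Longrightarrow> bil M p q > 0 \<longleftrightarrow> bil M' p q > 0"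
  shows "\<exists>c>0. \<forall>a b. M' a b = c * M a b"
proof -
  have neg: "bil M p q < 0 \<longleftrightarrow> bil M' p q < 0" if "p \<in> outcomes" "q \<in> outcomes" for p q
    using eq[OF that(2,1)] bil_skew[OF M, of p q] bil_skew[OF M', of p q] by linarith
  define R where "R = (\<lambda>p. \<chi> b. \<Sum>a\<in>UNIV. p $ a * M a b)"
  have R: "bil M p q = R p \<bullet> q" for p q unfolding R_def by (rule bil_inner_vec)
  have ex: "\<exists>c>0. \<forall>q\<in>outcomes. bil M' p q = c * bil M p q" if p: "p \<in> inner_outcomes" for p
    unfolding bil_inner_vec
    using eq[OF inner_outcomes_subset[OF p]] neg[OF inner_outcomes_subset[OF p]] bil_self[OF M, of p] bil_self[OF M', of p]
    by (intro functional_unique[OF p]; simp only: bil_inner_vec)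
  then obtain k where k: "\<And>p. p \<in> inner_outcomes \<Longrightarrow> k p > 0"
    "\<And>p q. p \<in> inner_outcomes \<Longrightarrow> q \<in> outcomes \<Longrightarrow> bil M' p q = k p * bil M p q" by metis
  have kk: "k p = k q" if "p \<in> inner_outcomes" "q \<in> inner_outcomes" "bil M p q \<noteq> 0" for p q
  proof -
    have "k p * bil M p q = bil M' p q" using k(2)[OF that(1) inner_outcomes_subset[OF that(2)]] by (rule sym)
    also have "\<dots> = - (k q * bil M q p)"
      unfolding bil_skew[OF M', of p q] k(2)[OF that(2) inner_outcomes_subset[OF that(1)]] by (rule refl)
    also have "\<dots> = k q * bil M p q" unfolding bil_skew[OF M, of p q] by (rule mult_minus_right[symmetric])
    finally have "k p * bil M p q = k q * bil M p q" .
    then show ?thesis using that(3) by simp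
  qed
  have "\<exists>c>0. \<forall>p\<in>inner_outcomes. \<forall>q\<in>inner_outcomes. bil M' p q = c * bil M p q"
  proof (cases "\<exists>p\<in>inner_outcomes. R p \<noteq> 0")
    case True
    then obtain u where u: "u \<in> inner_outcomes" "R u \<noteq> 0" by blast
    have "bil M' p q = k u * bil M p q" if p: "p \<in> inner_outcomes" and q: "q \<in> inner_outcomes" for p q
    proof (cases "R p = 0")
      case True
      then show ?thesis using k(2)[OF p inner_outcomes_subset[OF q]] by (simp add: R)
    next
      case False
      obtain x where x: "x \<in> inner_outcomes" "R p \<bullet> x \<noteq> 0" "R u \<bullet> x \<noteq> 0"
        using generic_inner_outcome[of "{R p, R u}"] u(2) False by auto
      have "bil M x u \<noteq> 0" "bil M p x \<noteq> 0" using x bil_skew[OF M, of x u] by (simp_all add: R)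
      then have "k p = k u" using kk[OF p x(1)] kk[OF x(1) u(1)] by simp
      then show ?thesis using k(2)[OF p inner_outcomes_subset[OF q]] by simp
    qed
    then show ?thesis using k(1)[OF u(1)] by blast
  next
    case False
    then have "bil M' p q = 1 * bil M p q" if "p \<in> inner_outcomes" "q \<in> inner_outcomes" for p q
      using k(2)[OF that(1) inner_outcomes_subset[OF that(2)]] that by (simp add: R)
    then show ?thesis by (intro exI[of _ 1]) simp
  qed
  then obtain c where c: "c > 0" "\<And>p q. p \<in> inner_outcomes \<Longrightarrow> q \<in> inner_outcomes \<Longrightarrow> bil M' p q = c * bil M p q"
    by blast
  have "M' a b - c * M a b = 0" for a b
    by (rule bil_zero_inner) (simp only: bil_diff_matrix c(2) diff_self)
  then have "M' a b = c * M a b" for a b using eq_iff_diff_eq_0 by blast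
  then show ?thesis using c(1) by blast
qed

subsection \<open>Matrices and relations\<close>

text \<open>The signs on pure outcomes, kept as a real matrix because a pairwise-comparison relation
  is represented by exactly this matrix.\<close>

definition sg :: "'a::finite pref \<Rightarrow> 'a \<Rightarrow> 'a \<Rightarrow> real" where
  "sg r a b = (if (pure a, pure b) \<in> r then 1 else if (pure b, pure a) \<in> r then - 1 else 0)"

lemma sg_values: "sg r a b \<in> {-1, 0, 1}"
  by (simp add: sg_def)

lemma sg_rep:
  assumes "rep r M" shows "sg r a b = sgn (M a b)"
proof -
  have "(pure a, pure b) \<in> r \<longleftrightarrow> M a b > 0" "(pure b, pure a) \<in> r \<longleftrightarrow> M b a > 0"
    using rep_iff[OF assms pure_outcomes pure_outcomes] by (simp_all add: bil_pure)
  moreover have "M b a = - M a b" using rep_skew[OF assms] unfolding skew_def by blast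
  ultimately show ?thesis by (auto simp: sg_def)
qed

lemma skewD: "skew M \<Longrightarrow> M a b = - M b a"
  unfolding skew_def by blast

lemma skew_diag: "skew M \<Longrightarrow> M a a = 0"
  using skewD[of M a a] by linarith

lemma sg_skew: "r \<in> prefs \<Longrightarrow> sg r a b = - sg r b a"
  using pref_asym[of r "pure a" "pure b"] by (auto simp: sg_def)

lemma sg_diag: "r \<in> prefs \<Longrightarrow> sg r a a = 0"
  using sg_skew[of r a a] by linarith

lemma skew_sg: "r \<in> prefs \<Longrightarrow> skew (sg r)"
  unfolding skew_def using sg_skew by blast

lemma sg_converse: "r \<in> prefs \<Longrightarrow> sg (r\<inverse>) a b = - sg r a b"
  using pref_asym[of r "pure a" "pure b"] by (auto simp: sg_def)

lemma sg_empty: "sg {} a b = 0"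
  by (simp add: sg_def)

lemma bil_uminus: "bil (\<lambda>a b. - M a b) p q = - bil M p q"
  by (simp add: bil_def sum_negf)

lemma bil_cmult: "bil (\<lambda>a b. c * M a b) p q = c * bil M p q"
  by (simp add: bil_def sum_distrib_left mult_ac)

lemma rep_converse:
  assumes "rep r M" shows "rep (r\<inverse>) (\<lambda>a b. - M a b)"
proof -
  have "- M a b = - (- M b a)" for a b using skewD[OF rep_skew[OF assms], of a b] by simp
  then have "skew (\<lambda>a b. - M a b)" unfolding skew_def by blast
  moreover have "(p, q) \<in> r\<inverse> \<longleftrightarrow> bil (\<lambda>a b. - M a b) p q > 0" if "p \<in> outcomes" "q \<in> outcomes" for p q
    unfolding bil_uminus using rep_iff[OF assms that(2,1)] bil_skew[OF rep_skew[OF assms], of p q] by simp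
  ultimately show ?thesis by (simp add: rep_def)
qed

lemma rep_empty: "rep {} (\<lambda>a b. 0)"
  by (simp add: rep_def skew_def bil_def)

lemma rep_scale:
  assumes "rep r M" "c > 0" shows "rep r (\<lambda>a b. c * M a b)"
proof -
  have "c * M a b = - (c * M b a)" for a b
    using skewD[OF rep_skew[OF assms(1)], of a b] by simp
  then have "skew (\<lambda>a b. c * M a b)" unfolding skew_def by blast
  then show ?thesis using assms by (simp add: rep_def bil_cmult zero_less_mult_iff)
qed

lemma permute_outcome_outcomes:
  assumes "\<pi> permutes UNIV" "p \<in> outcomes" shows "permute_outcome \<pi> p \<in> outcomes"
proof -
  have "(\<Sum>b\<in>UNIV. p $ (inv \<pi> b)) = (\<Sum>a\<in>UNIV. p $ a)"
    using sum.permute[OF permutes_inv[OF assms(1)], of "\<lambda>a. p $ a"] by (simp add: o_def)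
  then show ?thesis using assms(2) by (simp add: outcomes_def permute_outcome_def)
qed

lemma permute_outcome_inv:
  assumes "\<pi> permutes UNIV"
  shows "permute_outcome (inv \<pi>) (permute_outcome \<pi> p) = p"
    and "permute_outcome \<pi> (permute_outcome (inv \<pi>) p) = p"
  using permutes_inv_inv[OF assms] permutes_inverses[OF assms]
  by (simp_all add: permute_outcome_def vec_eq_iff)

lemma rep_permute:
  assumes \<pi>: "\<pi> permutes UNIV" and r: "rep r M"
  shows "rep (permute_pref \<pi> r) (\<lambda>a b. M (inv \<pi> a) (inv \<pi> b))"
proof -
  have "skew (\<lambda>a b. M (inv \<pi> a) (inv \<pi> b))"
    unfolding skew_def using skewD[OF rep_skew[OF r]] by blast
  moreover have "(p, q) \<in> permute_pref \<pi> r \<longleftrightarrow> bil (\<lambda>a b. M (inv \<pi> a) (inv \<pi> b)) p q > 0"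
    if p: "p \<in> outcomes" and q: "q \<in> outcomes" for p q
  proof -
    define p' where "p' = permute_outcome (inv \<pi>) p"
    define q' where "q' = permute_outcome (inv \<pi>) q"
    have o: "p' \<in> outcomes" "q' \<in> outcomes"
      using permute_outcome_outcomes[OF permutes_inv[OF \<pi>]] p q by (simp_all add: p'_def q'_def)
    have pq: "p = permute_outcome \<pi> p'" "q = permute_outcome \<pi> q'"
      by (simp_all add: p'_def q'_def permute_outcome_inv[OF \<pi>])
    have "(p, q) \<in> permute_pref \<pi> r \<longleftrightarrow> (p', q') \<in> r"
    proof
      assume "(p, q) \<in> permute_pref \<pi> r"
      then obtain x y where "(x, y) \<in> r" "p = permute_outcome \<pi> x" "q = permute_outcome \<pi> y"
        by (auto simp: permute_pref_def)
      then show "(p', q') \<in> r" by (simp add: p'_def q'_def permute_outcome_inv[OF \<pi>])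
    next
      assume "(p', q') \<in> r"
      then show "(p, q) \<in> permute_pref \<pi> r"
        unfolding permute_pref_def pq by (metis map_prod_simp rev_image_eqI)
    qed
    also have "\<dots> \<longleftrightarrow> bil M p' q' > 0" by (rule rep_iff[OF r o])
    also have "bil M p' q' = bil (\<lambda>a b. M (inv \<pi> a) (inv \<pi> b)) p q"
    proof -
      have nth: "p' $ (inv \<pi> a) = p $ a" "q' $ (inv \<pi> a) = q $ a" for a
        using permutes_inv_inv[OF \<pi>] permutes_inverses(1)[OF \<pi>]
        by (simp_all add: p'_def q'_def permute_outcome_def)
      have "bil M p' q' = (\<Sum>a\<in>UNIV. \<Sum>b\<in>UNIV. p' $ (inv \<pi> a) * q' $ b * M (inv \<pi> a) b)"
        unfolding bil_def
        using sum.permute[OF permutes_inv[OF \<pi>], of "\<lambda>a. \<Sum>b\<in>UNIV. p' $ a * q' $ b * M a b"]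
        by (simp add: o_def)
      also have "\<dots> = (\<Sum>a\<in>UNIV. \<Sum>b\<in>UNIV. p' $ (inv \<pi> a) * q' $ (inv \<pi> b) * M (inv \<pi> a) (inv \<pi> b))"
      proof (rule sum.cong[OF refl])
        fix a
        show "(\<Sum>b\<in>UNIV. p' $ (inv \<pi> a) * q' $ b * M (inv \<pi> a) b)
          = (\<Sum>b\<in>UNIV. p' $ (inv \<pi> a) * q' $ (inv \<pi> b) * M (inv \<pi> a) (inv \<pi> b))"
          using sum.permute[OF permutes_inv[OF \<pi>], of "\<lambda>b. p' $ (inv \<pi> a) * q' $ b * M (inv \<pi> a) b"]
          by (simp add: o_def)
      qed
      finally show ?thesis by (simp add: bil_def nth)
    qed
    finally show ?thesis .
  qed
  ultimately show ?thesis by (simp add: rep_def)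
qed

section \<open>Unnormalized lotteries and restriction to a face of the simplex\<close>

definition nonneg :: "real ^ 'a::finite \<Rightarrow> bool" where
  "nonneg x \<longleftrightarrow> (\<forall>a. 0 \<le> x $ a)"

lemma nonneg_pure [simp]: "nonneg (pure a)"
  and nonneg_add: "nonneg x \<Longrightarrow> nonneg y \<Longrightarrow> nonneg (x + y)"
  and nonneg_scale: "nonneg x \<Longrightarrow> 0 \<le> c \<Longrightarrow> nonneg (c *\<^sub>R x)"
  by (simp_all add: nonneg_def pure_nth)

lemma nonneg_normalize:
  assumes "nonneg x" "x \<noteq> 0"
  shows "\<exists>c>0. c *\<^sub>R x \<in> outcomes"
proof -
  define s where "s = (\<Sum>a\<in>UNIV. x $ a)"
  obtain a where "x $ a \<noteq> 0" using assms(2) by (auto simp: vec_eq_iff)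
  then have "s > 0" unfolding s_def using assms(1)
    by (intro sum_pos2[of _ a]) (auto simp: nonneg_def less_le)
  then have "(1 / s) *\<^sub>R x \<in> outcomes" using assms(1)
    by (simp add: outcomes_def nonneg_def s_def flip: sum_divide_distrib)
  then show ?thesis using \<open>s > 0\<close> by (intro exI[of _ "1 / s"]) simp
qed

lemma rep_weakly_prefers:
  assumes r: "rep r M" and p: "p \<in> outcomes" and q: "q \<in> outcomes"
  shows "weakly_prefers r p q \<longleftrightarrow> bil M p q \<ge> 0"
  using rep_iff[OF r p q] rep_iff[OF r q p] bil_skew[OF rep_skew[OF r], of p q]
  unfolding weakly_prefers_def indiff_def by linarith

text \<open>Zero outside \<open>X\<close> instead of a matrix on a smaller type, so that
  \<open>bil_unique\<close> applies to a face unchanged.\<close>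

definition mask :: "'a set \<Rightarrow> ('a \<Rightarrow> 'a \<Rightarrow> real) \<Rightarrow> 'a \<Rightarrow> 'a \<Rightarrow> real" where
  "mask X M a b = (if a \<in> X \<and> b \<in> X then M a b else 0)"

lemma bil_mask:
  "bil (mask X M) x y = bil M (\<chi> a. if a \<in> X then x $ a else 0) (\<chi> a. if a \<in> X then y $ a else 0)"
  unfolding bil_def mask_def by (intro sum.cong refl) simp

lemma outcomes_on_zero:
  assumes "p \<in> outcomes_on X" "a \<notin> X" shows "p $ a = 0"
proof -
  have p: "p \<in> outcomes" "(\<Sum>a\<in>X. p $ a) = 1" using assms(1) by (auto simp: outcomes_on_def)
  have "(\<Sum>a\<in>X. p $ a) + (\<Sum>a\<in>-X. p $ a) = (\<Sum>a\<in>UNIV. p $ a)"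
    using sum.subset_diff[of X UNIV "\<lambda>a. p $ a"] by (simp add: Compl_eq_Diff_UNIV)
  then have "(\<Sum>a\<in>-X. p $ a) = 0" using p outcomesD(2)[OF p(1)] by simp
  then have "\<forall>a\<in>-X. p $ a = 0" using outcomesD(1)[OF p(1)] by (subst (asm) sum_nonneg_eq_0_iff) auto
  then show ?thesis using assms(2) by simp
qed

lemma bil_outcomes_on:
  assumes "p \<in> outcomes_on X" "q \<in> outcomes_on X" shows "bil (mask X M) p q = bil M p q"
proof -
  have "(\<chi> a. if a \<in> X then p $ a else 0) = p" "(\<chi> a. if a \<in> X then q $ a else 0) = q"
    using outcomes_on_zero assms by (auto simp: vec_eq_iff)
  then show ?thesis by (simp add: bil_mask)
qed

lemma outcomes_on_cut:
  assumes "p \<in> outcomes" "(\<chi> a. if a \<in> X then p $ a else 0) \<noteq> 0"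
  shows "\<exists>c>0. c *\<^sub>R (\<chi> a. if a \<in> X then p $ a else 0) \<in> outcomes_on X"
proof -
  define x where "x = (\<chi> a. if a \<in> X then p $ a else 0)"
  have "nonneg x" using assms(1) by (simp add: x_def nonneg_def outcomes_def)
  then obtain c where c: "c > 0" "c *\<^sub>R x \<in> outcomes" using nonneg_normalize assms(2) x_def by blast
  have "(\<Sum>a\<in>X. (c *\<^sub>R x) $ a) = (\<Sum>a\<in>UNIV. (c *\<^sub>R x) $ a)"
    by (rule sum.mono_neutral_left) (auto simp: x_def)
  then have "c *\<^sub>R x \<in> outcomes_on X" using c(2) outcomesD(2)[OF c(2)] by (simp add: outcomes_on_def)
  then show ?thesis using c(1) x_def by blast
qed

lemma skew_mask:
  assumes "skew M" shows "skew (mask X M)"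
  unfolding skew_def
proof (intro allI)
  fix a b
  show "mask X M a b = - mask X M b a" using skewD[OF assms, of a b] by (simp add: mask_def)
qed

text \<open>Uniqueness of the representation applied to masked matrices: a masked value at arbitrary
  outcomes is the value at their parts on \<open>X\<close>, and a nonzero part rescales to an
  element of \<open>outcomes_on X\<close>. This translates independence into proportionality of
  matrices.\<close>

lemma restrict_rel_iff:
  assumes r: "rep r M" and r': "rep r' M'"
  shows "restrict_rel r (outcomes_on X) = restrict_rel r' (outcomes_on X)
    \<longleftrightarrow> (\<exists>c>0. \<forall>a\<in>X. \<forall>b\<in>X. M' a b = c * M a b)"
proof
  assume "\<exists>c>0. \<forall>a\<in>X. \<forall>b\<in>X. M' a b = c * M a b"
  then obtain c where c: "c > 0" "\<And>a b. a \<in> X \<Longrightarrow> b \<in> X \<Longrightarrow> M' a b = c * M a b" by blast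
  have "mask X M' = (\<lambda>a b. c * mask X M a b)" by (auto simp: fun_eq_iff mask_def c(2))
  then have *: "bil (mask X M') p q = c * bil (mask X M) p q" for p q by (simp add: bil_cmult)
  have "(p, q) \<in> r \<longleftrightarrow> (p, q) \<in> r'" if "p \<in> outcomes_on X" "q \<in> outcomes_on X" for p q
    using *[of p q] that c(1) rep_iff[OF r, of p q] rep_iff[OF r', of p q]
    by (simp add: bil_outcomes_on outcomes_on_def zero_less_mult_iff)
  then show "restrict_rel r (outcomes_on X) = restrict_rel r' (outcomes_on X)"
    by (auto simp: restrict_rel_def)
next
  assume eq: "restrict_rel r (outcomes_on X) = restrict_rel r' (outcomes_on X)"
  have on: "bil M p q > 0 \<longleftrightarrow> bil M' p q > 0" if "p \<in> outcomes_on X" "q \<in> outcomes_on X" for p q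
  proof -
    have "(p, q) \<in> r \<longleftrightarrow> (p, q) \<in> r'" using eq that unfolding restrict_rel_def by blast
    then show ?thesis using rep_iff[OF r, of p q] rep_iff[OF r', of p q] that by (simp add: outcomes_on_def)
  qed
  have "bil (mask X M) p q > 0 \<longleftrightarrow> bil (mask X M') p q > 0" if p: "p \<in> outcomes" and q: "q \<in> outcomes" for p q
  proof -
    define x where "x = (\<chi> a. if a \<in> X then p $ a else 0)"
    define y where "y = (\<chi> a. if a \<in> X then q $ a else 0)"
    have m: "bil (mask X N) p q = bil N x y" for N unfolding x_def y_def by (rule bil_mask)
    show ?thesis
    proof (cases "x = 0 \<or> y = 0")
      case True
      then have "bil N x y = 0" for N by (auto simp: bil_def)
      then show ?thesis by (simp add: m)
    next
      case False
      then obtain c d where "c > 0" "c *\<^sub>R x \<in> outcomes_on X" "d > 0" "d *\<^sub>R y \<in> outcomes_on X"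
        using outcomes_on_cut[OF p, of X] outcomes_on_cut[OF q, of X] unfolding x_def y_def by blast
      then show ?thesis using on[of "c *\<^sub>R x" "d *\<^sub>R y"]
        by (simp add: m bil_scale_left bil_scale_right zero_less_mult_iff)
    qed
  qed
  then obtain c where c: "c > 0" "\<And>a b. mask X M' a b = c * mask X M a b"
    using bil_unique[OF skew_mask[OF rep_skew[OF r]] skew_mask[OF rep_skew[OF r']]] by blast
  have "M' a b = c * M a b" if "a \<in> X" "b \<in> X" for a b
    using c(2)[of a b] that by (simp add: mask_def)
  then show "\<exists>c>0. \<forall>a\<in>X. \<forall>b\<in>X. M' a b = c * M a b" using c(1) by blast
qed

subsection \<open>SSB functions and matrices\<close>

text \<open>Induction on the size of the support: a vertex with positive weight is split off and the
  rest is renormalized.\<close>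

lemma affine_on_outcomes:
  fixes g :: "real ^ 'a::finite \<Rightarrow> real"
  assumes g: "\<And>p q l. p \<in> outcomes \<Longrightarrow> q \<in> outcomes \<Longrightarrow> 0 \<le> l \<Longrightarrow> l \<le> 1 \<Longrightarrow>
    g (mix p l q) = l * g p + (1 - l) * g q"
    and p: "p \<in> outcomes"
  shows "g p = (\<Sum>a\<in>UNIV. p $ a * g (pure a))"
  using p
proof (induction "card {a. p $ a \<noteq> 0}" arbitrary: p rule: less_induct)
  case less
  have "\<exists>a. p $ a \<noteq> 0"
  proof (rule ccontr)
    assume "\<nexists>a. p $ a \<noteq> 0"
    then show False using outcomesD(2)[OF less.prems] by simp
  qed
  then obtain a where a: "p $ a \<noteq> 0" by blast
  then have a0: "p $ a > 0" using outcomesD(1)[OF less.prems, of a] by simp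
  have rest: "(\<Sum>b\<in>UNIV - {a}. p $ b) = 1 - p $ a"
    using outcomesD(2)[OF less.prems] by (simp add: sum_diff1)
  have a1: "p $ a \<le> 1"
    using rest sum_nonneg[of "UNIV - {a}" "\<lambda>b. p $ b"] outcomesD(1)[OF less.prems] by simp
  show ?case
  proof (cases "p $ a = 1")
    case True
    then have "(\<Sum>b\<in>UNIV - {a}. p $ b) = 0" using rest by simp
    then have "\<forall>b\<in>UNIV - {a}. p $ b = 0"
      using outcomesD(1)[OF less.prems] by (subst (asm) sum_nonneg_eq_0_iff) auto
    then have "p = pure a" using True by (auto simp: vec_eq_iff pure_nth)
    moreover have "(\<Sum>b\<in>UNIV. pure a $ b * g (pure b)) = (\<Sum>b\<in>UNIV. if a = b then g (pure b) else 0)"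
      by (intro sum.cong refl) (simp add: pure_nth)
    ultimately show ?thesis by simp
  next
    case False
    define k where "k = 1 - p $ a"
    have k: "k > 0" using a1 False by (simp add: k_def)
    define q where "q = (1 / k) *\<^sub>R (p - (p $ a) *\<^sub>R pure a)"
    have qn: "q $ b = (if b = a then 0 else p $ b / k)" for b by (simp add: q_def pure_nth)
    have "(\<Sum>b\<in>UNIV. q $ b) = (\<Sum>b\<in>UNIV - {a}. p $ b / k)"
      unfolding qn by (subst sum.remove[of _ a]) (auto intro!: sum.cong)
    also have "\<dots> = 1" using rest k by (simp add: k_def flip: sum_divide_distrib)
    finally have q: "q \<in> outcomes" using outcomesD(1)[OF less.prems] k by (auto simp: outcomes_def qn)
    have "{b. q $ b \<noteq> 0} \<subset> {b. p $ b \<noteq> 0}" using a k by (auto simp: qn)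
    then have "card {b. q $ b \<noteq> 0} < card {b. p $ b \<noteq> 0}" by (intro psubset_card_mono) auto
    then have IH: "g q = (\<Sum>b\<in>UNIV. q $ b * g (pure b))" by (rule less.hyps[OF _ q])
    have pm: "p = mix (pure a) (p $ a) q"
    proof -
      have "p $ b = (mix (pure a) (p $ a) q) $ b" for b
        using k by (simp add: mix_def pure_nth qn) (simp add: k_def)
      then show ?thesis unfolding vec_eq_iff by blast
    qed
    have "g p = g (mix (pure a) (p $ a) q)" by (rule arg_cong[OF pm])
    also have "\<dots> = p $ a * g (pure a) + k * g q"
      using g[OF pure_outcomes q, of "p $ a" a] a0 a1 by (simp add: k_def)
    also have "k * g q = (\<Sum>b\<in>UNIV. if b = a then 0 else p $ b * g (pure b))"
      unfolding IH sum_distrib_left using k by (intro sum.cong) (simp_all add: qn)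
    also have "\<dots> = (\<Sum>b\<in>UNIV - {a}. p $ b * g (pure b))"
      by (subst sum.remove[of _ a]) (auto intro!: sum.cong)
    finally show ?thesis using sum.remove[of UNIV a "\<lambda>b. p $ b * g (pure b)"] by simp
  qed
qed

lemma ssb_bil:
  assumes "ssb \<phi>" "p \<in> outcomes" "q \<in> outcomes"
  shows "\<phi> p q = bil (\<lambda>a b. \<phi> (pure a) (pure b)) p q"
proof -
  have mixes: "\<phi> (mix x l y) z = l * \<phi> x z + (1 - l) * \<phi> y z" "\<phi> z (mix x l y) = l * \<phi> z x + (1 - l) * \<phi> z y"
    if "x \<in> outcomes" "y \<in> outcomes" "z \<in> outcomes" "0 \<le> l" "l \<le> 1" for x y z l
  proof -
    have "l \<in> {0..1}" using that by simp
    then show "\<phi> (mix x l y) z = l * \<phi> x z + (1 - l) * \<phi> y z" "\<phi> z (mix x l y) = l * \<phi> z x + (1 - l) * \<phi> z y"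
      using assms(1) that(1-3) unfolding ssb_def by blast+
  qed
  have "\<phi> p q = (\<Sum>a\<in>UNIV. p $ a * \<phi> (pure a) q)"
    by (rule affine_on_outcomes[of "\<lambda>p. \<phi> p q", OF mixes(1) assms(2)]) (use assms in auto)
  also have "\<dots> = (\<Sum>a\<in>UNIV. p $ a * (\<Sum>b\<in>UNIV. q $ b * \<phi> (pure a) (pure b)))"
  proof (rule sum.cong[OF refl])
    fix a
    have "\<phi> (pure a) q = (\<Sum>b\<in>UNIV. q $ b * \<phi> (pure a) (pure b))"
      by (rule affine_on_outcomes[of "\<phi> (pure a)", OF mixes(2) assms(3)]) (use pure_outcomes in auto)
    then show "p $ a * \<phi> (pure a) q = p $ a * (\<Sum>b\<in>UNIV. q $ b * \<phi> (pure a) (pure b))" by simp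
  qed
  finally show ?thesis by (simp add: bil_def sum_distrib_left mult.assoc)
qed

lemma ssb_rep:
  assumes "ssb \<phi>" "represents r \<phi>" shows "rep r (\<lambda>a b. \<phi> (pure a) (pure b))"
proof -
  have "\<phi> (pure a) (pure b) = - \<phi> (pure b) (pure a)" for a b
    using assms(1) pure_outcomes unfolding ssb_def by blast
  then have "skew (\<lambda>a b. \<phi> (pure a) (pure b))" unfolding skew_def by blast
  moreover have "(p, q) \<in> r \<longleftrightarrow> bil (\<lambda>a b. \<phi> (pure a) (pure b)) p q > 0"
    if "p \<in> outcomes" "q \<in> outcomes" for p q
    using assms(2) that ssb_bil[OF assms(1) that] unfolding represents_def by simp
  ultimately show ?thesis by (simp add: rep_def)
qed

lemma ssb_of_bil: "skew M \<Longrightarrow> ssb (bil M)"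
  unfolding ssb_def bil_mix_left bil_mix_right using bil_skew by blast

lemma bil_le_1:
  assumes M: "\<And>a b. M a b \<le> 1" and p: "p \<in> outcomes" and q: "q \<in> outcomes"
  shows "bil M p q \<le> 1"
proof -
  have "bil M p q \<le> (\<Sum>a\<in>UNIV. \<Sum>b\<in>UNIV. p $ a * q $ b)"
    unfolding bil_def
  proof (intro sum_mono)
    fix a b
    have "0 \<le> p $ a * q $ b" using outcomesD(1) p q by (metis mult_nonneg_nonneg)
    then show "p $ a * q $ b * M a b \<le> p $ a * q $ b" using M[of a b] by (simp add: mult_left_le)
  qed
  also have "\<dots> = (\<Sum>a\<in>UNIV. p $ a * (\<Sum>b\<in>UNIV. q $ b))" by (simp add: sum_distrib_left)
  also have "\<dots> = 1" by (simp add: outcomesD(2)[OF p] outcomesD(2)[OF q])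
  finally show ?thesis .
qed

lemma sg_normalized:
  assumes "r \<in> prefs" shows "bil (sg r) \<in> normalized_ssb"
proof -
  have sk: "skew (sg r)" using assms by (rule skew_sg)
  have le: "sg r a b \<le> 1" for a b by (simp add: sg_def)
  show ?thesis
  proof (cases "\<exists>a b. sg r a b = 1")
    case True
    then obtain a b where "bil (sg r) (pure a) (pure b) = 1" by (auto simp: bil_pure)
    then have "\<exists>p\<in>outcomes. \<exists>q\<in>outcomes. bil (sg r) p q = 1" using pure_outcomes by blast
    then show ?thesis using ssb_of_bil[OF sk] bil_le_1[of "sg r", OF le] by (simp add: normalized_ssb_def)
  next
    case False
    have "sg r a b = 0" for a b
    proof -
      have "sg r a b \<noteq> 1" "sg r b a \<noteq> 1" using False by auto
      then show ?thesis using sg_values[of r a b] sg_skew[OF assms, of a b] by auto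
    qed
    then have "bil (sg r) p q = 0" for p q by (simp add: bil_def)
    then show ?thesis using ssb_of_bil[OF sk] by (simp add: normalized_ssb_def)
  qed
qed

lemma sgn_unit: "(x::real) \<in> {-1, 0, 1} \<Longrightarrow> sgn x = x"
  by auto

text \<open>The numbers -1, 0 and 1 are their own signs, so a pairwise-comparison function is
  determined by the relation on pure outcomes.\<close>

lemma pc_prefs_iff: "r \<in> pc_prefs \<longleftrightarrow> r \<in> prefs \<and> rep r (sg r)"
proof
  assume "r \<in> pc_prefs"
  then obtain \<phi> where r: "r \<in> prefs" and \<phi>: "\<phi> \<in> pc_ssb" "represents r \<phi>" by (auto simp: pc_prefs_def)
  then have "ssb \<phi>" by (auto simp: pc_ssb_def normalized_ssb_def)
  then have rp: "rep r (\<lambda>a b. \<phi> (pure a) (pure b))" using \<phi>(2) by (rule ssb_rep)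
  have "\<phi> (pure a) (pure b) = sg r a b" for a b
    using \<phi>(1) sg_rep[OF rp, of a b] sgn_unit[of "\<phi> (pure a) (pure b)"] by (simp only: pc_ssb_def) simp
  then show "r \<in> prefs \<and> rep r (sg r)" using r rp by simp
next
  assume *: "r \<in> prefs \<and> rep r (sg r)"
  then have "bil (sg r) \<in> pc_ssb" using sg_normalized[of r] sg_values by (auto simp: pc_ssb_def bil_pure)
  moreover have "represents r (bil (sg r))" using * by (simp add: rep_def represents_def)
  ultimately show "r \<in> pc_prefs" using * by (auto simp: pc_prefs_def)
qed

text \<open>Two representations differ by a positive factor \<open>c\<close>. Unless both vanish,
  each has largest value 1, attained by the sign matrix at a pair of pure outcomes, and this forces
  \<open>c = 1\<close>.\<close>

lemma normalized_pc_unique: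
  assumes r: "rep r (sg r)" and \<phi>: "\<phi> \<in> normalized_ssb" "represents r \<phi>"
    and pq: "p \<in> outcomes" "q \<in> outcomes"
  shows "\<phi> p q = bil (sg r) p q"
proof -
  have ssb: "ssb \<phi>" using \<phi>(1) by (auto simp: normalized_ssb_def)
  define M where "M = (\<lambda>a b. \<phi> (pure a) (pure b))"
  have M: "rep r M" unfolding M_def using ssb \<phi>(2) by (rule ssb_rep)
  have \<phi>M: "\<phi> x y = bil M x y" if "x \<in> outcomes" "y \<in> outcomes" for x y
    unfolding M_def using ssb_bil[OF ssb that] .
  have "\<exists>c>0. \<forall>a b. M a b = c * sg r a b"
    by (rule bil_unique[OF rep_skew[OF r] rep_skew[OF M]]) (use rep_iff[OF r] rep_iff[OF M] in blast)
  then obtain c where c: "c > 0" "M = (\<lambda>a b. c * sg r a b)" by (auto simp: fun_eq_iff)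
  have bM: "bil M x y = c * bil (sg r) x y" for x y unfolding c(2) by (rule bil_cmult)
  have le: "sg r a b \<le> 1" for a b by (simp add: sg_def)
  consider x y where "x \<in> outcomes" "y \<in> outcomes" "\<phi> x y = 1" "\<And>p q. p \<in> outcomes \<Longrightarrow> q \<in> outcomes \<Longrightarrow> \<phi> p q \<le> 1"
    | "\<And>p q. p \<in> outcomes \<Longrightarrow> q \<in> outcomes \<Longrightarrow> \<phi> p q = 0"
    using \<phi>(1) unfolding normalized_ssb_def by blast
  then show ?thesis
  proof cases
    case 1
    have cb: "c * bil (sg r) x y = 1" using 1 \<phi>M bM by simp
    have "bil (sg r) x y \<le> 1" using bil_le_1[of "sg r", OF le] 1 by simp
    then have "c \<ge> 1" using cb c(1) mult_left_le[of "bil (sg r) x y" c] by simp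
    have "\<exists>a b. sg r a b = 1"
    proof (rule ccontr)
      assume no: "\<nexists>a b. sg r a b = 1"
      have np: "sg r a b \<le> 0" for a b using no sg_values[of r a b] by auto
      have "sg r a b = 0" for a b
        using np[of a b] np[of b a] skewD[OF rep_skew[OF r], of a b] by linarith
      then have "bil (sg r) x y = 0" by (simp add: bil_def)
      then show False using cb by simp
    qed
    then obtain a b where "sg r a b = 1" by blast
    moreover have "\<phi> (pure a) (pure b) = c * sg r a b"
      unfolding \<phi>M[OF pure_outcomes pure_outcomes] bil_pure by (subst c(2)) (rule refl)
    ultimately have "\<phi> (pure a) (pure b) = c" by simp
    then have "c \<le> 1" using 1(4)[OF pure_outcomes pure_outcomes] by metis
    then show ?thesis using \<open>c \<ge> 1\<close> \<phi>M[OF pq] bM by simp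
  next
    case 2
    then show ?thesis using \<phi>M[OF pq] bM[of p q] c(1) pq by simp
  qed
qed

subsection \<open>Rich domains\<close>

lemma rich_prefs: "rich D \<Longrightarrow> r \<in> D \<Longrightarrow> r \<in> prefs"
  and rich_empty: "rich D \<Longrightarrow> {} \<in> D"
  and rich_converse: "rich D \<Longrightarrow> r \<in> D \<Longrightarrow> r\<inverse> \<in> D"
  and rich_permute: "rich D \<Longrightarrow> r \<in> D \<Longrightarrow> \<pi> permutes UNIV \<Longrightarrow> permute_pref \<pi> r \<in> D"
  unfolding rich_def by blast+

lemma rich_rep: "rich D \<Longrightarrow> r \<in> D \<Longrightarrow> \<exists>M. rep r M"
  using prefs_rep rich_prefs by blast

lemma sg_eq_1_iff: "sg r a b = 1 \<longleftrightarrow> (pure a, pure b) \<in> r"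
  by (simp add: sg_def)

lemma transpose_permutes_UNIV: "Transposition.transpose a b permutes UNIV"
  by (rule permutes_swap_id) auto

text \<open>Richness puts some alternative \<open>a\<close> at the bottom; transposing
  \<open>a\<close> and \<open>c\<close> moves it to the prescribed place and fixes \<open>X\<close>,
  which contains neither.\<close>

lemma add_bottom:
  assumes D: "rich D" and r': "r' \<in> D" and X: "card X \<le> 4" "c \<notin> X"
  shows "\<exists>r\<in>D. (\<forall>x\<in>X. \<forall>y\<in>X. sg r x y = sg r' x y) \<and> (\<forall>x\<in>X. sg r x c = 1)"
proof -
  have "\<forall>r'\<in>D. \<forall>X. card X \<le> 4 \<longrightarrow> (\<exists>r\<in>D. \<exists>a. restrict_rel r (pure ` X) = restrict_rel r' (pure ` X) \<and>
    (\<forall>x\<in>X. (pure x, pure a) \<in> r))"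
    using D unfolding rich_def by (elim conjE)
  from this[rule_format, OF r' X(1)] obtain r a where r: "r \<in> D" "restrict_rel r (pure ` X) = restrict_rel r' (pure ` X)"
    and a: "\<And>x. x \<in> X \<Longrightarrow> (pure x, pure a) \<in> r"
    by blast
  have aX: "a \<notin> X" using a pref_irrefl[OF rich_prefs[OF D r(1)]] by blast
  have same: "sg r x y = sg r' x y" if "x \<in> X" "y \<in> X" for x y
  proof -
    have "(pure x, pure y) \<in> r \<longleftrightarrow> (pure x, pure y) \<in> r'" "(pure y, pure x) \<in> r \<longleftrightarrow> (pure y, pure x) \<in> r'"
      using r(2) that unfolding restrict_rel_def by blast+
    then show ?thesis by (simp add: sg_def)
  qed
  obtain M where M: "rep r M" using rich_rep[OF D r(1)] by blast
  define \<pi> where "\<pi> = Transposition.transpose a c"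
  define r2 where "r2 = permute_pref \<pi> r"
  have "rep r2 (\<lambda>x y. M (inv \<pi> x) (inv \<pi> y))"
    unfolding r2_def \<pi>_def by (rule rep_permute[OF transpose_permutes_UNIV M])
  then have sg2: "sg r2 x y = sg r (\<pi> x) (\<pi> y)" for x y
    using sg_rep[of r2] sg_rep[OF M] by (simp add: \<pi>_def)
  have px: "\<pi> x = x" if "x \<in> X" for x
    using that aX X(2) by (auto simp: \<pi>_def intro!: transpose_apply_other)
  have pc: "\<pi> c = a" by (simp add: \<pi>_def)
  have "r2 \<in> D" unfolding r2_def \<pi>_def by (rule rich_permute[OF D r(1) transpose_permutes_UNIV])
  moreover have "\<forall>x\<in>X. \<forall>y\<in>X. sg r2 x y = sg r' x y" by (simp add: sg2 px same)
  moreover have "\<forall>x\<in>X. sg r2 x c = 1" using a by (simp add: sg2 px pc sg_eq_1_iff)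
  ultimately show ?thesis by blast
qed

lemma sgn_proportional:
  fixes M M' :: "'a \<Rightarrow> 'a \<Rightarrow> real"
  assumes "skew M" "skew M'" "sgn (M a b) = sgn (M' a b)"
  shows "\<exists>c>0. \<forall>x\<in>{a, b}. \<forall>y\<in>{a, b}. M' x y = c * M x y"
proof -
  define c where "c = (if M a b = 0 then 1 else M' a b / M a b)"
  have c: "c > 0" "M' a b = c * M a b"
    using assms(3) by (auto simp: c_def sgn_if zero_less_divide_iff split: if_splits)
  then have "M' b a = c * M b a" using skewD[OF assms(1), of b a] skewD[OF assms(2), of b a] by simp
  then show ?thesis using c skew_diag[OF assms(1)] skew_diag[OF assms(2)] by (intro exI[of _ c]) auto
qed

subsection \<open>Pareto optimality and independence for matrices\<close>

definition signed :: "real \<Rightarrow> 'a::finite pref \<Rightarrow> 'a pref" where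
  "signed s r = (if s = 1 then r else if s = - 1 then r\<inverse> else {})"

lemma signed_rep: "s \<in> {-1, 0, 1} \<Longrightarrow> rep r M \<Longrightarrow> rep (signed s r) (\<lambda>a b. s * M a b)"
  using rep_empty rep_converse by (auto simp: signed_def)

locale arrovian_swf =
  fixes D :: "'a::finite pref set" and f :: "(nat \<Rightarrow> 'a pref) \<Rightarrow> 'a pref" and n :: nat
  assumes n2: "n \<ge> 2" and D: "rich D" and f: "swf n D f"
    and pareto: "pareto_optimal n D f" and iia: "iia n D f" and anon: "anonymous n D f"
    and card: "CARD('a) \<ge> 5"
begin

lemma profile_prefs: "R \<in> profiles n D \<Longrightarrow> i \<in> {1..n} \<Longrightarrow> R i \<in> D"
  unfolding profiles_def by (rule PiE_mem)

lemma profile_restrict: "(\<And>i. i \<in> {1..n} \<Longrightarrow> g i \<in> D) \<Longrightarrow> restrict g {1..n} \<in> profiles n D"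
  unfolding profiles_def by simp

lemma f_prefs: "R \<in> profiles n D \<Longrightarrow> f R \<in> prefs"
  using f unfolding swf_def by blast

lemma f_rep: "R \<in> profiles n D \<Longrightarrow> \<exists>M. rep (f R) M"
  using prefs_rep f_prefs by blast

text \<open>Both arguments of \<open>bil\<close> may be rescaled, so Pareto optimality can be tested
  with arbitrary nonnegative weights.\<close>

lemma pareto_bil:
  assumes R: "R \<in> profiles n D" and M: "rep (f R) M" and A: "\<And>i. i \<in> {1..n} \<Longrightarrow> rep (R i) (A i)"
    and xy: "nonneg x" "nonneg y" and le: "\<And>i. i \<in> {1..n} \<Longrightarrow> 0 \<le> bil (A i) x y"
  shows "0 \<le> bil M x y" and "i \<in> {1..n} \<Longrightarrow> 0 < bil (A i) x y \<Longrightarrow> 0 < bil M x y"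
proof -
  have "0 \<le> bil M x y \<and> (i \<in> {1..n} \<longrightarrow> 0 < bil (A i) x y \<longrightarrow> 0 < bil M x y)"
  proof (cases "x = 0 \<or> y = 0")
    case True
    then have "bil N x y = 0" for N by (auto simp: bil_def)
    then show ?thesis by simp
  next
    case False
    then obtain c d where c: "c > 0" "c *\<^sub>R x \<in> outcomes" and d: "d > 0" "d *\<^sub>R y \<in> outcomes"
      using nonneg_normalize xy by blast
    have s: "bil N (c *\<^sub>R x) (d *\<^sub>R y) = c * d * bil N x y" for N
      by (simp add: bil_scale_left bil_scale_right)
    have cd: "c * d > 0" using c d by simp
    have "weakly_prefers (R i) (c *\<^sub>R x) (d *\<^sub>R y)" if "i \<in> {1..n}" for i
      unfolding rep_weakly_prefers[OF A[OF that] c(2) d(2)] s using le[OF that] cd by simp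
    then have "weakly_prefers (f R) (c *\<^sub>R x) (d *\<^sub>R y) \<and>
      ((\<exists>i\<in>{1..n}. (c *\<^sub>R x, d *\<^sub>R y) \<in> R i) \<longrightarrow> (c *\<^sub>R x, d *\<^sub>R y) \<in> f R)"
      using pareto R c(2) d(2) unfolding pareto_optimal_def by blast
    then have *: "0 \<le> c * d * bil M x y"
      "(\<exists>i\<in>{1..n}. (c *\<^sub>R x, d *\<^sub>R y) \<in> R i) \<longrightarrow> 0 < c * d * bil M x y"
      unfolding rep_weakly_prefers[OF M c(2) d(2)] rep_iff[OF M c(2) d(2)] s by blast+
    have "(c *\<^sub>R x, d *\<^sub>R y) \<in> R i" if "i \<in> {1..n}" "0 < bil (A i) x y"
      unfolding rep_iff[OF A[OF that(1)] c(2) d(2)] s using that(2) cd by simp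
    then show ?thesis using * cd by (auto simp: zero_le_mult_iff zero_less_mult_iff)
  qed
  then show "0 \<le> bil M x y" and "i \<in> {1..n} \<Longrightarrow> 0 < bil (A i) x y \<Longrightarrow> 0 < bil M x y" by auto
qed

lemma pareto_zero:
  assumes R: "R \<in> profiles n D" and M: "rep (f R) M" and A: "\<And>i. i \<in> {1..n} \<Longrightarrow> rep (R i) (A i)"
    and xy: "nonneg x" "nonneg y" and z: "\<And>i. i \<in> {1..n} \<Longrightarrow> bil (A i) x y = 0"
  shows "bil M x y = 0"
proof -
  have "0 \<le> bil M x y" by (rule pareto_bil(1)[OF R M A xy]) (simp_all add: z)
  moreover have "bil (A i) y x = 0" if "i \<in> {1..n}" for i
    using bil_skew[OF rep_skew[OF A[OF that]], of y x] z[OF that] by simp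
  then have "0 \<le> bil M y x" by (intro pareto_bil(1)[OF R M A xy(2,1)]) simp_all
  ultimately show ?thesis using bil_skew[OF rep_skew[OF M], of x y] by linarith
qed

lemma iia_rep:
  assumes R: "R \<in> profiles n D" and R': "R' \<in> profiles n D" and M: "rep (f R) M" and M': "rep (f R') M'"
    and A: "\<And>i. i \<in> {1..n} \<Longrightarrow> rep (R i) (A i)" and A': "\<And>i. i \<in> {1..n} \<Longrightarrow> rep (R' i) (A' i)"
    and pr: "\<And>i. i \<in> {1..n} \<Longrightarrow> \<exists>c>0. \<forall>x\<in>X. \<forall>y\<in>X. A' i x y = c * A i x y"
  shows "\<exists>c>0. \<forall>x\<in>X. \<forall>y\<in>X. M' x y = c * M x y"
proof -
  have "restrict_rel (R i) (outcomes_on X) = restrict_rel (R' i) (outcomes_on X)" if "i \<in> {1..n}" for i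
    unfolding restrict_rel_iff[OF A[OF that] A'[OF that]] using pr[OF that] .
  then have "restrict_rel (f R) (outcomes_on X) = restrict_rel (f R') (outcomes_on X)"
    using iia R R' unfolding iia_def by blast
  then show ?thesis unfolding restrict_rel_iff[OF M M'] .
qed

lemma profile_rep:
  assumes "R \<in> profiles n D"
  obtains A where "\<And>i. i \<in> {1..n} \<Longrightarrow> rep (R i) (A i)"
proof -
  have "\<forall>i\<in>{1..n}. \<exists>A. rep (R i) A" using rich_rep[OF D] profile_prefs[OF assms] by blast
  then obtain A where "\<forall>i\<in>{1..n}. rep (R i) (A i)" by (rule bchoice[THEN exE])
  then show thesis using that by blast
qed

subsection \<open>Neutrality on pairs\<close>

text \<open>On two alternatives a relation carries no intensity: its sign determines its
  restriction, so independence needs nothing else.\<close>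

lemma pair_independence:
  assumes R: "R \<in> profiles n D" and R': "R' \<in> profiles n D"
    and eq: "\<And>i. i \<in> {1..n} \<Longrightarrow> sg (R i) a b = sg (R' i) a b"
  shows "sg (f R) a b = sg (f R') a b"
proof -
  obtain M M' where M: "rep (f R) M" "rep (f R') M'" using f_rep R R' by blast
  obtain A where A: "\<And>i. i \<in> {1..n} \<Longrightarrow> rep (R i) (A i)" using profile_rep[OF R] by blast
  obtain A' where A': "\<And>i. i \<in> {1..n} \<Longrightarrow> rep (R' i) (A' i)" using profile_rep[OF R'] by blast
  have "\<exists>c>0. \<forall>x\<in>{a, b}. \<forall>y\<in>{a, b}. A' i x y = c * A i x y" if i: "i \<in> {1..n}" for i
    using sgn_proportional[OF rep_skew[OF A[OF i]] rep_skew[OF A'[OF i]]] eq[OF i]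
    by (simp only: sg_rep[OF A[OF i]] sg_rep[OF A'[OF i]])
  from iia_rep[OF R R' M A A' this] obtain c where "c > 0" "M' a b = c * M a b" by auto
  then show ?thesis by (simp add: sg_rep[OF M(1)] sg_rep[OF M(2)] sgn_mult)
qed

lemma star_exists:
  assumes "a \<noteq> c" "b \<noteq> c"
  shows "\<exists>r\<in>D. sg r a b = 0 \<and> sg r a c = 1 \<and> sg r b c = 1"
  using add_bottom[OF D rich_empty[OF D], of "{a, b}" c] assms card_insert_le_m1[of 2 "{b}" a]
  by (auto simp: sg_empty)

lemma signed_D: "r \<in> D \<Longrightarrow> signed s r \<in> D"
  using rich_empty[OF D] rich_converse[OF D] by (simp add: signed_def)

lemma sign_profile:
  assumes ab: "a \<noteq> b" and s: "\<And>i. s i \<in> {-1, 0, 1}"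
  shows "\<exists>T\<in>profiles n D. \<forall>i\<in>{1..n}. sg (T i) a b = s i"
proof -
  obtain r where r: "r \<in> D" "sg r a b = 1" using star_exists[of a b a] ab by blast
  obtain M where M: "rep r M" using rich_rep[OF D r(1)] by blast
  have "sgn (M a b) = 1" using sg_rep[OF M] r(2) by metis
  define T where "T = restrict (\<lambda>i. signed (s i) r) {1..n}"
  have "T \<in> profiles n D" unfolding T_def using signed_D[OF r(1)] by (intro profile_restrict)
  moreover have "sg (T i) a b = s i" if "i \<in> {1..n}" for i
    using sg_rep[OF signed_rep[OF s[of i] M], of a b] that \<open>sgn (M a b) = 1\<close> s[of i]
    by (simp add: T_def sgn_mult sgn_unit)
  ultimately show ?thesis by blast
qed

text \<open>In the profile \<open>T\<close> every agent holds a relation \<open>r\<close> with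
  \<open>a\<close> and \<open>b\<close> indifferent and both above \<open>c\<close>, its inverse, or
  complete indifference. Whatever is indifferent for \<open>r\<close> is then indifferent for all
  agents, and Pareto optimality transfers the proportion of \<open>a\<close> against
  \<open>c\<close> and \<open>b\<close> against \<open>c\<close> to the collective matrix.\<close>

lemma pair_neutral_step:
  assumes dist: "distinct [a, b, c]" and R: "R \<in> profiles n D" and R': "R' \<in> profiles n D"
    and eq: "\<And>i. i \<in> {1..n} \<Longrightarrow> sg (R i) a c = sg (R' i) b c"
  shows "sg (f R) a c = sg (f R') b c"
proof -
  obtain r where r: "r \<in> D" "sg r a b = 0" "sg r a c = 1" "sg r b c = 1"
    using star_exists[of a c b] dist by auto
  obtain S where S: "rep r S" using rich_rep[OF D r(1)] by blast
  have S0: "sgn (S a b) = 0" "sgn (S a c) = 1" "sgn (S b c) = 1" using r(2-4) unfolding sg_rep[OF S] .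
  then have Sv: "S a b = 0" "S a c > 0" "S b c > 0" by (simp_all add: sgn_if split: if_splits)
  define s where "s = (\<lambda>i. sg (R i) a c)"
  define T where "T = restrict (\<lambda>i. signed (s i) r) {1..n}"
  have T: "T \<in> profiles n D" unfolding T_def using signed_D[OF r(1)] by (intro profile_restrict)
  have sv: "s i \<in> {-1, 0, 1}" for i unfolding s_def by (rule sg_values)
  have A: "rep (T i) (\<lambda>x y. s i * S x y)" if "i \<in> {1..n}" for i
    using signed_rep[OF sv S] that by (simp add: T_def)
  have sT: "sg (T i) a c = s i" "sg (T i) b c = s i" if "i \<in> {1..n}" for i
    unfolding sg_rep[OF A[OF that]] by (simp_all add: sgn_mult S0 sgn_unit[OF sv])
  obtain M where M: "rep (f T) M" using f_rep[OF T] by blast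
  have skS: "S x y = - S y x" for x y by (rule skewD[OF rep_skew[OF S]])
  have skM: "M x y = - M y x" for x y by (rule skewD[OF rep_skew[OF M]])
  have "bil M (pure a) (pure b) = 0"
    by (rule pareto_zero[OF T M A]) (simp_all add: bil_pure Sv)
  then have Mab: "M a b = 0" by (simp add: bil_pure)
  define x where "x = S a c *\<^sub>R pure b + S b c *\<^sub>R pure c"
  define y where "y = pure a + pure c"
  have b: "bil N x y = S a c * N b a + S a c * N b c + S b c * N c a + S b c * N c c" for N
    by (simp add: x_def y_def bil_linear bil_pure algebra_simps)
  have "bil M x y = 0"
  proof (rule pareto_zero[OF T M A])
    show "nonneg x" "nonneg y" using Sv by (simp_all add: x_def y_def nonneg_add nonneg_scale)
    have "S c c = 0" "S b a = 0" "S c a = - S a c"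
      using skS[of c c] skS[of b a] skS[of c a] Sv by simp_all
    then show "bil (\<lambda>x y. s i * S x y) x y = 0" for i unfolding b by (simp add: algebra_simps)
  qed
  then have "S a c * M b c = S b c * M a c"
    unfolding b using Mab skM[of c c] skM[of b a] skM[of c a] by simp
  then have "sgn (S a c) * sgn (M b c) = sgn (S b c) * sgn (M a c)" by (metis sgn_mult)
  then have "sg (f T) a c = sg (f T) b c" by (simp add: sg_rep[OF M] S0)
  moreover have "sg (f R) a c = sg (f T) a c"
    by (rule pair_independence[OF R T]) (simp add: sT s_def)
  moreover have "sg (f T) b c = sg (f R') b c"
    by (rule pair_independence[OF T R']) (simp add: sT s_def eq)
  ultimately show ?thesis by simp
qed

lemma third_exists: "\<exists>c::'a. c \<notin> set xs" if "length xs \<le> 4"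
proof -
  have "card (set xs) \<le> 4" using card_length[of xs] that by linarith
  then have "set xs \<noteq> UNIV" using card by auto
  then show ?thesis by blast
qed

text \<open>\<open>pair_neutral_step\<close> replaces one alternative at a time, so reversing a pair
  takes a third one: from \<open>(a, b)\<close> to \<open>(c, b)\<close>, \<open>(c, a)\<close> and
  finally \<open>(b, a)\<close>.\<close>

lemma pair_neutral_swap:
  assumes ab: "a \<noteq> b" and R: "R \<in> profiles n D" and R': "R' \<in> profiles n D"
    and eq: "\<And>i. i \<in> {1..n} \<Longrightarrow> sg (R i) a b = sg (R' i) b a"
  shows "sg (f R) a b = sg (f R') b a"
proof -
  obtain c where c: "c \<notin> set [a, b]" using third_exists[of "[a, b]"] by auto
  then have cab: "c \<noteq> a" "c \<noteq> b" by auto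
  obtain T where T: "T \<in> profiles n D" "\<And>i. i \<in> {1..n} \<Longrightarrow> sg (T i) c b = sg (R i) a b"
    using sign_profile[of c b "\<lambda>i. sg (R i) a b", OF _ sg_values] cab by blast
  obtain U where U: "U \<in> profiles n D" "\<And>i. i \<in> {1..n} \<Longrightarrow> sg (U i) c a = sg (R i) a b"
    using sign_profile[of c a "\<lambda>i. sg (R i) a b", OF _ sg_values] cab by blast
  have sk: "sg (Q i) x y = - sg (Q i) y x" if "Q \<in> profiles n D" "i \<in> {1..n}" for Q i x y
    by (rule sg_skew[OF rich_prefs[OF D profile_prefs[OF that]]])
  have skf: "sg (f Q) x y = - sg (f Q) y x" if "Q \<in> profiles n D" for Q x y
    by (rule sg_skew[OF f_prefs[OF that]])
  have "sg (f R) a b = sg (f T) c b"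
    by (rule pair_neutral_step[OF _ R T(1)]) (use ab c T(2) in auto)
  also have "\<dots> = - sg (f T) b c" by (rule skf[OF T(1)])
  also have "sg (f T) b c = sg (f U) a c"
  proof (rule pair_neutral_step[OF _ T(1) U(1)])
    show "sg (T i) b c = sg (U i) a c" if i: "i \<in> {1..n}" for i
      using sk[OF T(1) i, of b c] sk[OF U(1) i, of a c] T(2)[OF i] U(2)[OF i] by linarith
  qed (use ab c in auto)
  also have "- sg (f U) a c = sg (f U) c a" using skf[OF U(1), of c a] by linarith
  also have "\<dots> = sg (f R') b a"
    by (rule pair_neutral_step[OF _ U(1) R']) (use ab c U(2) eq in auto)
  finally show ?thesis .
qed

text \<open>
  Swapping the two agents turns the profile into one that looks the same on the reversed pair, so
  anonymity and neutrality force indifference.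
\<close>

lemma opposite_signs_cancel:
  assumes r1: "r1 \<in> D" and r2: "r2 \<in> D"
  shows "\<exists>R\<in>profiles n D. R 1 = r1 \<and> R 2 = r2 \<and> (\<forall>i\<in>{1..n} - {1, 2}. R i = {}) \<and>
    (\<forall>a b. sg r2 a b = - sg r1 a b \<longrightarrow> sg (f R) a b = 0)"
proof -
  define g where "g = (\<lambda>u v (i::nat). if i = 1 then u else if i = 2 then v else ({} :: 'a pref))"
  define R where "R = restrict (g r1 r2) {1..n}"
  define R' where "R' = restrict (g r2 r1) {1..n}"
  have R: "R \<in> profiles n D" and R': "R' \<in> profiles n D"
    unfolding R_def R'_def by (rule profile_restrict; use r1 r2 rich_empty[OF D] in \<open>simp add: g_def\<close>)+
  define \<pi> where "\<pi> = Transposition.transpose (1::nat) 2"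
  have "\<pi> permutes {1..n}" unfolding \<pi>_def using n2 by (intro permutes_swap_id) auto
  moreover have "R \<circ> \<pi> = R'"
    using n2 by (auto simp: fun_eq_iff R_def R'_def g_def \<pi>_def Transposition.transpose_def)
  ultimately have fR: "f R' = f R" using anon R unfolding anonymous_def by metis
  have "sg (f R) a b = 0" if opp: "sg r2 a b = - sg r1 a b" for a b
  proof (cases "a = b")
    case True
    then show ?thesis using sg_diag[OF f_prefs[OF R]] by simp
  next
    case False
    have "sg r1 b a = - sg r1 a b" "sg r2 b a = - sg r2 a b"
      using sg_skew rich_prefs[OF D] r1 r2 by blast+
    then have "sg (R i) a b = sg (R' i) b a" if "i \<in> {1..n}" for i
      using that opp by (simp add: R_def R'_def g_def sg_empty)
    from pair_neutral_swap[OF False R R' this] have "sg (f R) a b = sg (f R') b a" by simp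
    then show ?thesis unfolding fR using sg_skew[OF f_prefs[OF R], of a b] by linarith
  qed
  moreover have "R 1 = r1" "R 2 = r2" "\<forall>i\<in>{1..n} - {1, 2}. R i = {}"
    using n2 by (auto simp: R_def g_def)
  ultimately show ?thesis using R by blast
qed

text \<open>With agents 1 and 2 holding \<open>r1\<close> and \<open>r2\<close> and all others
  indifferent, the collective relation is indifferent throughout the face of \<open>X\<close>.
  Lotteries that neither agent dislikes and agent 1 strictly likes would violate Pareto
  optimality.\<close>

lemma opposite_signs_test:
  assumes r1: "r1 \<in> D" "rep r1 M1" and r2: "r2 \<in> D" "rep r2 M2"
    and opp: "\<And>a b. a \<in> X \<Longrightarrow> b \<in> X \<Longrightarrow> sgn (M2 a b) = - sgn (M1 a b)"
    and xy: "nonneg x" "nonneg y" "\<And>a. a \<notin> X \<Longrightarrow> x $ a = 0" "\<And>a. a \<notin> X \<Longrightarrow> y $ a = 0"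
    and le: "0 \<le> bil M1 x y" "0 \<le> bil M2 x y"
  shows "bil M1 x y = 0"
proof -
  obtain R where R: "R \<in> profiles n D" "R 1 = r1" "R 2 = r2" "\<forall>i\<in>{1..n} - {1, 2}. R i = {}"
    and c: "\<And>a b. sg r2 a b = - sg r1 a b \<Longrightarrow> sg (f R) a b = 0"
    using opposite_signs_cancel[OF r1(1) r2(1)] by blast
  obtain M where M: "rep (f R) M" using f_rep[OF R(1)] by blast
  have "M a b = 0" if "a \<in> X" "b \<in> X" for a b
    using c[of a b] opp[OF that] by (simp add: sg_rep[OF M] sg_rep[OF r1(2)] sg_rep[OF r2(2)] sgn_eq_0_iff)
  then have "x $ a * y $ b * M a b = 0" for a b using xy(3)[of a] xy(4)[of b] by (cases "a \<in> X"; cases "b \<in> X") auto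
  then have z: "bil M x y = 0" unfolding bil_def by (intro sum.neutral ballI)
  define A where "A = (\<lambda>i::nat. if i = 1 then M1 else if i = 2 then M2 else (\<lambda>a b. 0))"
  have A: "rep (R i) (A i)" if "i \<in> {1..n}" for i
    using that R r1(2) r2(2) rep_empty by (auto simp: A_def)
  have "0 \<le> bil (A i) x y" for i using le by (simp add: A_def bil_def)
  then have "\<not> 0 < bil (A 1) x y"
    using pareto_bil(2)[OF R(1) M A xy(1,2), of 1] n2 z by auto
  then show ?thesis using le by (simp add: A_def)
qed

end

subsection \<open>All nonzero preference intensities are equal\<close>

context arrovian_swf
begin

text \<open>Transposing the ends of the path \<open>a > b > c\<close> reverses all signs on the
  three alternatives, whatever the sign on \<open>a, c\<close>, and exchanges the two magnitudes.
  For \<open>a + c\<close> against \<open>b\<close> both agents then have the same value, the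
  difference of the magnitudes.\<close>

lemma path_equal:
  assumes r: "r \<in> D" "rep r M" and dist: "distinct [a, b, c]" and ab: "M a b > 0" and bc: "M b c > 0"
  shows "M a b = M b c"
proof -
  define \<tau> where "\<tau> = Transposition.transpose a c"
  define M2 where "M2 = (\<lambda>x y. M (\<tau> x) (\<tau> y))"
  have r2: "permute_pref \<tau> r \<in> D" "rep (permute_pref \<tau> r) M2"
    using rich_permute[OF D r(1) transpose_permutes_UNIV] rep_permute[OF transpose_permutes_UNIV r(2), of a c]
    by (simp_all add: \<tau>_def M2_def)
  have sk: "M b a = - M a b" "M c b = - M b c" "M c a = - M a c" and dg: "M x x = 0" for x
    using skewD[OF rep_skew[OF r(2)]] skew_diag[OF rep_skew[OF r(2)]] by blast+
  have t: "\<tau> a = c" "\<tau> b = b" "\<tau> c = a"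
    using dist by (auto simp: \<tau>_def Transposition.transpose_def)
  have opp: "sgn (M2 x y) = - sgn (M x y)" if "x \<in> {a, b, c}" "y \<in> {a, b, c}" for x y
    using that ab bc by (auto simp: M2_def t sk dg)
  define x where "x = pure a + pure c"
  define y where "y = pure b"
  have xy: "nonneg x" "nonneg y" and s: "z \<notin> {a, b, c} \<Longrightarrow> x $ z = 0" "z \<notin> {a, b, c} \<Longrightarrow> y $ z = 0" for z
    by (auto simp: x_def y_def nonneg_add pure_nth)
  have e: "bil N x y = N a b + N c b" "bil N y x = N b a + N b c" for N
    by (simp_all add: x_def y_def bil_linear bil_pure)
  have v: "bil M x y = M a b - M b c" "bil M2 x y = M a b - M b c"
    "bil M y x = M b c - M a b" "bil M2 y x = M b c - M a b"
    unfolding e by (simp_all add: M2_def t sk)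
  show ?thesis
  proof (cases "M a b \<ge> M b c")
    case True
    then have "bil M x y = 0" using opposite_signs_test[OF r r2, of "{a, b, c}", OF opp xy s] v by simp
    then show ?thesis using v by simp
  next
    case False
    then have "bil M y x = 0" using opposite_signs_test[OF r r2, of "{a, b, c}", OF opp xy(2,1) s(2,1)] v by simp
    then show ?thesis using v by simp
  qed
qed

text \<open>Here transposing \<open>b\<close> and \<open>c\<close> preserves all signs, so the
  inverse of the transposed relation plays the opposing agent. The lotteries \<open>a + c\<close>
  and \<open>a + b\<close> again give both agents the difference of the magnitudes.\<close>

lemma fork_equal:
  assumes r: "r \<in> D" "rep r M" and dist: "distinct [a, b, c]"
    and ab: "M a b > 0" and ac: "M a c > 0" and bc: "M b c = 0"
  shows "M a b = M a c"
proof -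
  define \<tau> where "\<tau> = Transposition.transpose b c"
  define M2 where "M2 = (\<lambda>x y. - M (\<tau> x) (\<tau> y))"
  have p: "permute_pref \<tau> r \<in> D" "rep (permute_pref \<tau> r) (\<lambda>x y. M (\<tau> x) (\<tau> y))"
    using rich_permute[OF D r(1) transpose_permutes_UNIV] rep_permute[OF transpose_permutes_UNIV r(2), of b c]
    by (simp_all add: \<tau>_def)
  have r2: "(permute_pref \<tau> r)\<inverse> \<in> D" "rep ((permute_pref \<tau> r)\<inverse>) M2"
    using rich_converse[OF D p(1)] rep_converse[OF p(2)] by (simp_all add: M2_def)
  have sk: "M b a = - M a b" "M c b = - M b c" "M c a = - M a c" and dg: "M x x = 0" for x
    using skewD[OF rep_skew[OF r(2)]] skew_diag[OF rep_skew[OF r(2)]] by blast+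
  have t: "\<tau> a = a" "\<tau> b = c" "\<tau> c = b"
    using dist by (auto simp: \<tau>_def Transposition.transpose_def)
  have opp: "sgn (M2 x y) = - sgn (M x y)" if "x \<in> {a, b, c}" "y \<in> {a, b, c}" for x y
    using that ab bc ac by (auto simp: M2_def t sk dg)
  define x where "x = pure a + pure c"
  define y where "y = pure a + pure b"
  have xy: "nonneg x" "nonneg y" and s: "z \<notin> {a, b, c} \<Longrightarrow> x $ z = 0" "z \<notin> {a, b, c} \<Longrightarrow> y $ z = 0" for z
    by (auto simp: x_def y_def nonneg_add pure_nth)
  have e: "bil N x y = N a a + N a b + N c a + N c b" "bil N y x = N a a + N b a + N a c + N b c" for N
    by (simp_all add: x_def y_def bil_linear bil_pure)
  have v: "bil M x y = M a b - M a c" "bil M2 x y = M a b - M a c"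
    "bil M y x = M a c - M a b" "bil M2 y x = M a c - M a b"
    unfolding e by (simp_all add: M2_def t sk dg bc)
  show ?thesis
  proof (cases "M a b \<ge> M a c")
    case True
    then have "bil M x y = 0" using opposite_signs_test[OF r r2, of "{a, b, c}", OF opp xy s] v by simp
    then show ?thesis using v by simp
  next
    case False
    then have "bil M y x = 0" using opposite_signs_test[OF r r2, of "{a, b, c}", OF opp xy(2,1) s(2,1)] v by simp
    then show ?thesis using v by simp
  qed
qed

text \<open>
  The magnitudes on a chain \<open>a, b, c\<close> are compared with those of a preference that has the same
  signs on the chain and an additional alternative below it.
\<close>

lemma chain_equal:
  assumes r: "r \<in> D" "rep r M" and dist: "distinct [a, b, c]"
    and ab: "M a b > 0" and bc: "M b c > 0" and ac: "M a c > 0"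
  shows "M a c = M a b"
proof -
  have ab_bc: "M a b = M b c" using path_equal[OF r dist ab bc] .
  obtain d where d: "d \<notin> set [a, b, c]" using third_exists[of "[a, b, c]"] by auto
  have "card {a, b, c} \<le> 4" using dist by simp
  then obtain q where q: "q \<in> D" "\<forall>x\<in>{a, b, c}. \<forall>y\<in>{a, b, c}. sg q x y = sg r x y" "\<forall>x\<in>{a, b, c}. sg q x d = 1"
    using add_bottom[OF D r(1), of "{a, b, c}" d] d by auto
  obtain S where S: "rep q S" using rich_rep[OF D q(1)] by blast
  have pos: "S x y > 0" if "sg q x y = 1" for x y
    using that unfolding sg_rep[OF S] by (simp add: sgn_1_pos)
  have "sg r a b = 1" "sg r b c = 1" "sg r a c = 1" using ab bc ac by (simp_all add: sg_rep[OF r(2)])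
  then have P: "S a b > 0" "S b c > 0" "S a c > 0" "S b d > 0" "S c d > 0" using q by (auto intro!: pos)
  have "S a b = S b c" "S a c = S c d" "S b c = S c d"
    using path_equal[OF q(1) S, of a b c] path_equal[OF q(1) S, of a c d] path_equal[OF q(1) S, of b c d] P dist d
    by auto
  then have Seq: "S b c = S a b" "S a c = S a b" by simp_all
  define M2 where "M2 = (\<lambda>x y. - S x y)"
  have r2: "q\<inverse> \<in> D" "rep (q\<inverse>) M2"
    unfolding M2_def by (rule rich_converse[OF D q(1)], rule rep_converse[OF S])
  have opp: "sgn (M2 x y) = - sgn (M x y)" if "x \<in> {a, b, c}" "y \<in> {a, b, c}" for x y
  proof -
    have "sg q x y = sg r x y" using q(2) that by blast
    then show ?thesis unfolding sg_rep[OF S] sg_rep[OF r(2)] by (simp add: M2_def sgn_minus)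
  qed
  have sk: "M b a = - M a b" "M c b = - M b c" "M c a = - M a c" and dg: "M x x = 0" for x
    using skewD[OF rep_skew[OF r(2)]] skew_diag[OF rep_skew[OF r(2)]] by blast+
  have sk': "S b a = - S a b" "S c b = - S b c" "S c a = - S a c" and dg': "S x x = 0" for x
    using skewD[OF rep_skew[OF S]] skew_diag[OF rep_skew[OF S]] by blast+
  \<comment> \<open>These lotteries are indifferent once all three magnitudes agree, as they do for
    \<open>S\<close>. For \<open>M\<close>, where only \<open>M a b = M b c\<close> is known, their
    value is \<open>M a c - M a b\<close>.\<close>
  define x where "x = pure a + 2 *\<^sub>R pure c"
  define y where "y = pure b + pure c"
  have xy: "nonneg x" "nonneg y" and s: "z \<notin> {a, b, c} \<Longrightarrow> x $ z = 0" "z \<notin> {a, b, c} \<Longrightarrow> y $ z = 0" for z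
    by (auto simp: x_def y_def nonneg_add nonneg_scale pure_nth)
  have e: "bil N x y = N a b + N a c + 2 * N c b + 2 * N c c" "bil N y x = N b a + N c a + 2 * N b c + 2 * N c c" for N
    by (simp_all add: x_def y_def bil_linear bil_pure)
  have v: "bil M x y = M a c - M a b" "bil M2 x y = 0" "bil M y x = M a b - M a c" "bil M2 y x = 0"
    unfolding e by (simp_all add: M2_def sk dg sk' dg' Seq ab_bc)
  show ?thesis
  proof (cases "M a b \<le> M a c")
    case True
    then have "bil M x y = 0" using opposite_signs_test[OF r r2, of "{a, b, c}", OF opp xy s] v by simp
    then show ?thesis using v by simp
  next
    case False
    then have "bil M y x = 0" using opposite_signs_test[OF r r2, of "{a, b, c}", OF opp xy(2,1) s(2,1)] v by simp
    then show ?thesis using v by simp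
  qed
qed

lemma adjacent_equal_pos:
  assumes r: "r \<in> D" "rep r M" and dist: "distinct [a, b, c]" and ab: "M a b > 0" and ac: "M a c > 0"
  shows "M a b = M a c"
proof -
  have cb: "M c b = - M b c" by (rule skewD[OF rep_skew[OF r(2)]])
  consider "M b c = 0" | "M b c > 0" | "M c b > 0" using cb by linarith
  then show ?thesis
  proof cases
    case 1
    then show ?thesis by (rule fork_equal[OF r dist ab ac])
  next
    case 2
    then show ?thesis using chain_equal[OF r dist ab _ ac] by simp
  next
    case 3
    have "distinct [a, c, b]" using dist by auto
    then show ?thesis using chain_equal[OF r _ ac 3 ab] by simp
  qed
qed

lemma adjacent_equal:
  assumes r: "r \<in> D" "rep r M" and dist: "distinct [a, b, c]" and ab: "M a b \<noteq> 0" and ac: "M a c \<noteq> 0"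
  shows "\<bar>M a b\<bar> = \<bar>M a c\<bar>"
proof -
  have sk: "M b a = - M a b" "M c a = - M a c" using skewD[OF rep_skew[OF r(2)]] by blast+
  have dist': "distinct [b, a, c]" "distinct [c, a, b]" using dist by auto
  consider "M a b > 0" "M a c > 0" | "M a b > 0" "M a c < 0" | "M a b < 0" "M a c > 0" | "M a b < 0" "M a c < 0"
    using ab ac by linarith
  then show ?thesis
  proof cases
    case 1
    then show ?thesis using adjacent_equal_pos[OF r dist] by simp
  next
    case 2
    then show ?thesis using path_equal[OF r dist'(2)] sk by simp
  next
    case 3
    then show ?thesis using path_equal[OF r dist'(1)] sk by simp
  next
    case 4
    then show ?thesis
      using adjacent_equal_pos[OF rich_converse[OF D r(1)] rep_converse[OF r(2)] dist] by simp
  qed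
qed

text \<open>Exchanging the two pairs and inverting reverses every sign, because all entries between
  the pairs vanish.\<close>

lemma disjoint_equal_pos:
  assumes r: "r \<in> D" "rep r M" and dist: "distinct [a, b, c, d]" and ab: "M a b > 0" and cd: "M c d > 0"
    and zero: "M a c = 0" "M a d = 0" "M b c = 0" "M b d = 0"
  shows "M a b = M c d"
proof -
  define \<tau> where "\<tau> = Transposition.transpose a c"
  define \<sigma> where "\<sigma> = Transposition.transpose b d"
  define M2 where "M2 = (\<lambda>x y. - M (\<sigma> (\<tau> x)) (\<sigma> (\<tau> y)))"
  have "permute_pref \<sigma> r \<in> D" "rep (permute_pref \<sigma> r) (\<lambda>x y. M (\<sigma> x) (\<sigma> y))"
    using rich_permute[OF D r(1) transpose_permutes_UNIV] rep_permute[OF transpose_permutes_UNIV r(2), of b d]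
    by (simp_all add: \<sigma>_def)
  then have p: "permute_pref \<tau> (permute_pref \<sigma> r) \<in> D"
    "rep (permute_pref \<tau> (permute_pref \<sigma> r)) (\<lambda>x y. M (\<sigma> (\<tau> x)) (\<sigma> (\<tau> y)))"
    using rich_permute[OF D _ transpose_permutes_UNIV] rep_permute[OF transpose_permutes_UNIV, of "permute_pref \<sigma> r" _ a c]
    by (simp_all add: \<tau>_def)
  have r2: "(permute_pref \<tau> (permute_pref \<sigma> r))\<inverse> \<in> D" "rep ((permute_pref \<tau> (permute_pref \<sigma> r))\<inverse>) M2"
    using rich_converse[OF D p(1)] rep_converse[OF p(2)] by (simp_all add: M2_def)
  have sk: "M b a = - M a b" "M c a = - M a c" "M d a = - M a d" "M c b = - M b c" "M d b = - M b d" "M d c = - M c d"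
    and dg: "M x x = 0" for x
    using skewD[OF rep_skew[OF r(2)]] skew_diag[OF rep_skew[OF r(2)]] by blast+
  have t: "\<sigma> (\<tau> a) = c" "\<sigma> (\<tau> b) = d" "\<sigma> (\<tau> c) = a" "\<sigma> (\<tau> d) = b"
    using dist by (auto simp: \<tau>_def \<sigma>_def Transposition.transpose_def)
  have opp: "sgn (M2 x y) = - sgn (M x y)" if "x \<in> {a, b, c, d}" "y \<in> {a, b, c, d}" for x y
    using that ab cd by (auto simp: M2_def t sk dg zero)
  define x where "x = pure a + pure d"
  define y where "y = pure b + pure c"
  have xy: "nonneg x" "nonneg y" and s: "z \<notin> {a, b, c, d} \<Longrightarrow> x $ z = 0" "z \<notin> {a, b, c, d} \<Longrightarrow> y $ z = 0" for z
    by (auto simp: x_def y_def nonneg_add pure_nth)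
  have e: "bil N x y = N a b + N a c + N d b + N d c" "bil N y x = N b a + N c a + N b d + N c d" for N
    by (simp_all add: x_def y_def bil_linear bil_pure)
  have v: "bil M x y = M a b - M c d" "bil M2 x y = M a b - M c d"
    "bil M y x = M c d - M a b" "bil M2 y x = M c d - M a b"
    unfolding e by (simp_all add: M2_def t sk zero)
  show ?thesis
  proof (cases "M a b \<ge> M c d")
    case True
    then have "bil M x y = 0" using opposite_signs_test[OF r r2, of "{a, b, c, d}", OF opp xy s] v by simp
    then show ?thesis using v by simp
  next
    case False
    then have "bil M y x = 0" using opposite_signs_test[OF r r2, of "{a, b, c, d}", OF opp xy(2,1) s(2,1)] v by simp
    then show ?thesis using v by simp
  qed
qed

text \<open>Nonzero entries are the edges of a graph. Edges with a common vertex have equal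
  magnitude; two disjoint edges are either joined by a third or have no entry between them, as
  \<open>disjoint_equal_pos\<close> requires.\<close>

lemma pos_equal:
  assumes r: "r \<in> D" "rep r M" and ab: "M a b > 0" and cd: "M c d > 0"
  shows "M a b = M c d"
proof -
  have sk: "\<bar>M x y\<bar> = \<bar>M y x\<bar>" for x y
    using skewD[OF rep_skew[OF r(2)], of x y] by simp
  have nz: "M x y \<noteq> 0 \<longleftrightarrow> M y x \<noteq> 0" for x y
    using skewD[OF rep_skew[OF r(2)], of x y] by simp
  have ne: "a \<noteq> b" "c \<noteq> d" using ab cd skew_diag[OF rep_skew[OF r(2)]] by auto
  have adj: "\<bar>M x y\<bar> = \<bar>M x z\<bar>" if "M x y \<noteq> 0" "M x z \<noteq> 0" for x y z
  proof (cases "y = z")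
    case False
    have "x \<noteq> y" "x \<noteq> z" using that skew_diag[OF rep_skew[OF r(2)]] by auto
    then show ?thesis using adjacent_equal[OF r _ that] False by simp
  qed simp
  have link: "\<bar>M x y\<bar> = \<bar>M z w\<bar>" if "M x y \<noteq> 0" "M z w \<noteq> 0" "M x z \<noteq> 0" for x y z w
  proof -
    have "M z x \<noteq> 0" using nz that(3) by blast
    then show ?thesis using adj[OF that(1,3)] adj[OF that(2), of x] sk[of x z] by linarith
  qed
  have ab0: "M a b \<noteq> 0" "M b a \<noteq> 0" and cd0: "M c d \<noteq> 0" "M d c \<noteq> 0"
    using ab cd nz[of a b] nz[of c d] by auto
  have "\<bar>M a b\<bar> = \<bar>M c d\<bar>"
  proof (cases "a = c \<or> a = d \<or> b = c \<or> b = d")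
    case True
    have "\<bar>M x y\<bar> = \<bar>M z w\<bar>" if "x = z" "M x y \<noteq> 0" "M z w \<noteq> 0" for x y z w
      using adj[of x y w] that by blast
    then have "a = c \<Longrightarrow> \<bar>M a b\<bar> = \<bar>M c d\<bar>" "a = d \<Longrightarrow> \<bar>M a b\<bar> = \<bar>M d c\<bar>"
      "b = c \<Longrightarrow> \<bar>M b a\<bar> = \<bar>M c d\<bar>" "b = d \<Longrightarrow> \<bar>M b a\<bar> = \<bar>M d c\<bar>"
      using ab0 cd0 by blast+
    then show ?thesis using True sk[of a b] sk[of c d] by linarith
  next
    case False
    show ?thesis
    proof (cases "M a c = 0 \<and> M a d = 0 \<and> M b c = 0 \<and> M b d = 0")
      case True
      have "distinct [a, b, c, d]" using False ne by auto
      then show ?thesis using disjoint_equal_pos[OF r _ ab cd] True by simp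
    next
      case False
      then consider "M a c \<noteq> 0" | "M a d \<noteq> 0" | "M b c \<noteq> 0" | "M b d \<noteq> 0" by blast
      then show ?thesis
      proof cases
        case 1
        then show ?thesis by (rule link[OF ab0(1) cd0(1)])
      next
        case 2
        then show ?thesis using link[OF ab0(1) cd0(2)] sk[of c d] by simp
      next
        case 3
        then show ?thesis using link[OF ab0(2) cd0(1)] sk[of a b] by simp
      next
        case 4
        then show ?thesis using link[OF ab0(2) cd0(2)] sk[of a b] sk[of c d] by simp
      qed
    qed
  qed
  then show ?thesis using ab cd by simp
qed

theorem rep_sg:
  assumes r: "r \<in> D" shows "rep r (sg r)"
proof -
  obtain M where M: "rep r M" using rich_rep[OF D r] by blast
  have sk: "M x y = - M y x" for x y by (rule skewD[OF rep_skew[OF M]])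
  show ?thesis
  proof (cases "\<exists>a b. M a b > 0")
    case True
    then obtain a b where ab: "M a b > 0" by blast
    have "sg r x y = 1 / M a b * M x y" for x y
    proof -
      consider "M x y > 0" | "M y x > 0" | "M x y = 0" using sk[of x y] by linarith
      then show ?thesis
      proof cases
        case 1
        then show ?thesis using pos_equal[OF r M ab 1] by (simp add: sg_rep[OF M])
      next
        case 2
        then have "M x y = - M a b" using pos_equal[OF r M ab 2] sk[of x y] by simp
        then show ?thesis using ab by (simp add: sg_rep[OF M])
      qed (simp add: sg_rep[OF M])
    qed
    then have "sg r = (\<lambda>x y. 1 / M a b * M x y)" by (intro ext)
    then show ?thesis using rep_scale[OF M, of "1 / M a b"] ab by simp
  next
    case False
    have "M x y = 0" for x y
    proof -
      have "\<not> M x y > 0" "\<not> M y x > 0" using False by blast+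
      then show ?thesis using sk[of x y] by linarith
    qed
    then have "M = sg r" by (intro ext) (simp add: sg_rep[OF M])
    then show ?thesis using M by simp
  qed
qed

end

subsection \<open>Intensities against a common worst alternative\<close>

lemma bil_sum_matrix: "bil (\<lambda>a b. \<Sum>i\<in>I. A i a b) p q = (\<Sum>i\<in>I. bil (A i) p q)"
proof -
  have "bil (\<lambda>a b. \<Sum>i\<in>I. A i a b) p q = (\<Sum>a\<in>UNIV. \<Sum>b\<in>UNIV. \<Sum>i\<in>I. p $ a * q $ b * A i a b)"
    by (simp add: bil_def sum_distrib_left)
  also have "\<dots> = (\<Sum>a\<in>UNIV. \<Sum>i\<in>I. \<Sum>b\<in>UNIV. p $ a * q $ b * A i a b)"
    by (intro sum.cong[OF refl] sum.swap)
  also have "\<dots> = (\<Sum>i\<in>I. bil (A i) p q)" unfolding bil_def by (rule sum.swap)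
  finally show ?thesis .
qed

lemma skew_sum:
  assumes "\<And>i. i \<in> I \<Longrightarrow> skew (A i)" shows "skew (\<lambda>a b. \<Sum>i\<in>I. A i a b)"
proof -
  have "(\<Sum>i\<in>I. A i a b) = - (\<Sum>i\<in>I. A i b a)" for a b
    unfolding sum_negf[symmetric] by (intro sum.cong refl skewD assms)
  then show ?thesis unfolding skew_def by blast
qed

context arrovian_swf
begin

lemma profile_rep_sg: "R \<in> profiles n D \<Longrightarrow> i \<in> {1..n} \<Longrightarrow> rep (R i) (sg (R i))"
  using rep_sg profile_prefs by blast

lemma profile_skew: "R \<in> profiles n D \<Longrightarrow> i \<in> {1..n} \<Longrightarrow> sg (R i) a b = - sg (R i) b a"
  using skewD[OF rep_skew[OF profile_rep_sg]] .

lemma profile_diag: "R \<in> profiles n D \<Longrightarrow> i \<in> {1..n} \<Longrightarrow> sg (R i) a a = 0"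
  using skew_diag[OF rep_skew[OF profile_rep_sg]] .

lemma iia_sg:
  assumes R: "R \<in> profiles n D" and R': "R' \<in> profiles n D" and M: "rep (f R) M" and M': "rep (f R') M'"
    and eq: "\<And>i x y. i \<in> {1..n} \<Longrightarrow> x \<in> X \<Longrightarrow> y \<in> X \<Longrightarrow> sg (R i) x y = sg (R' i) x y"
  shows "\<exists>c>0. \<forall>x\<in>X. \<forall>y\<in>X. M' x y = c * M x y"
proof (rule iia_rep[OF R R' M M' profile_rep_sg[OF R] profile_rep_sg[OF R']])
  show "\<exists>c>0. \<forall>x\<in>X. \<forall>y\<in>X. sg (R' i) x y = c * sg (R i) x y" if "i \<in> {1..n}" for i
    using eq[OF that] by (intro exI[of _ 1]) simp
qed

definition below :: "(nat \<Rightarrow> 'a pref) \<Rightarrow> 'a \<Rightarrow> 'a set \<Rightarrow> bool" where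
  "below R e X \<longleftrightarrow> (\<forall>i\<in>{1..n}. \<forall>x\<in>X. sg (R i) x e = 1)"

lemma below_profile:
  assumes B: "\<And>i. i \<in> {1..n} \<Longrightarrow> B i \<in> D" and X: "card X \<le> 4" "e \<notin> X"
  shows "\<exists>T\<in>profiles n D. below T e X \<and> (\<forall>i\<in>{1..n}. \<forall>x\<in>X. \<forall>y\<in>X. sg (T i) x y = sg (B i) x y)"
proof -
  have "\<forall>i\<in>{1..n}. \<exists>r. r \<in> D \<and> (\<forall>x\<in>X. \<forall>y\<in>X. sg r x y = sg (B i) x y) \<and> (\<forall>x\<in>X. sg r x e = 1)"
    using add_bottom[OF D B X] by blast
  from bchoice[OF this] obtain g where
    g: "\<And>i. i \<in> {1..n} \<Longrightarrow> g i \<in> D \<and> (\<forall>x\<in>X. \<forall>y\<in>X. sg (g i) x y = sg (B i) x y) \<and> (\<forall>x\<in>X. sg (g i) x e = 1)"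
    by blast
  have "restrict g {1..n} \<in> profiles n D" using g by (intro profile_restrict) blast
  moreover have "below (restrict g {1..n}) e X" using g by (simp add: below_def)
  ultimately show ?thesis using g by (intro bexI[of _ "restrict g {1..n}"]) auto
qed

text \<open>If \<open>e\<close> had different collective distances from \<open>a\<close> and
  \<open>b\<close>, putting enough weight on \<open>e\<close> on both sides would let this
  difference outweigh the comparison of \<open>a\<close> and \<open>b\<close>. Each agent's value is
  \<open>sg (R i) b a + 1\<close>, which is nonnegative for every \<open>k\<close>.\<close>

lemma below_le:
  assumes R: "R \<in> profiles n D" and M: "rep (f R) M" and be: "below R e {a, b}"
  shows "M a e \<le> M b e"
proof (rule ccontr)
  assume "\<not> M a e \<le> M b e"
  then have pos: "M a e - M b e > 0" by simp
  then obtain k :: nat where k: "M a e - M a b < k * (M a e - M b e)"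
    using reals_Archimedean3 by blast
  define x where "x = pure b + real k *\<^sub>R pure e"
  define y where "y = pure a + (real k + 1) *\<^sub>R pure e"
  have e: "bil N x y = N b a + (real k + 1) * N b e + real k * N e a + real k * (real k + 1) * N e e" for N
    by (simp add: x_def y_def bil_linear bil_pure algebra_simps)
  have "0 \<le> bil M x y"
  proof (rule pareto_bil(1)[OF R M profile_rep_sg[OF R]])
    fix i assume i: "i \<in> {1..n}"
    have "sg (R i) a e = 1" "sg (R i) b e = 1" using be i by (simp_all add: below_def)
    moreover have "sg (R i) e a = - sg (R i) a e" "sg (R i) e e = 0"
      using profile_skew[OF R i] profile_diag[OF R i] by blast+
    moreover have "sg (R i) b a \<ge> - 1" by (simp add: sg_def)
    ultimately show "0 \<le> bil (sg (R i)) x y" by (simp add: e)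
  qed (simp_all add: x_def y_def nonneg_add nonneg_scale)
  moreover have "M e a = - M a e" "M b a = - M a b" "M e e = 0"
    using skewD[OF rep_skew[OF M]] skew_diag[OF rep_skew[OF M]] by blast+
  ultimately have "real k * (M a e - M b e) \<le> M b e - M a b" by (simp add: e algebra_simps)
  then show False using k pos by linarith
qed

lemma below_equal:
  assumes R: "R \<in> profiles n D" and M: "rep (f R) M" and be: "below R e {a, b}"
  shows "M a e = M b e" and "M a e > 0"
proof -
  have "below R e {b, a}" using be by (simp add: insert_commute)
  then show "M a e = M b e" using below_le[OF R M be] below_le[OF R M] by (meson antisym)
  have "bil M (pure a) (pure e) > 0"
  proof (rule pareto_bil(2)[OF R M profile_rep_sg[OF R], of "pure a" "pure e" 1])
    show "0 \<le> bil (sg (R i)) (pure a) (pure e)" if "i \<in> {1..n}" for i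
      using be that by (simp add: below_def bil_pure)
    show "0 < bil (sg (R 1)) (pure a) (pure e)" using be n2 by (simp add: below_def bil_pure)
  qed (use n2 in simp_all)
  then show "M a e > 0" by (simp add: bil_pure)
qed

text \<open>
  \<open>ratio a b e s v\<close>: \<open>v\<close> is the collective intensity between \<open>a\<close> and \<open>b\<close>, in units of the common
  intensity against a worst alternative \<open>e\<close>, when the agents' signs on \<open>a, b\<close> are \<open>s\<close>.
\<close>

definition ratio :: "'a \<Rightarrow> 'a \<Rightarrow> 'a \<Rightarrow> (nat \<Rightarrow> real) \<Rightarrow> real \<Rightarrow> bool" where
  "ratio a b e s v \<longleftrightarrow> distinct [a, b, e] \<and> (\<exists>R\<in>profiles n D. \<exists>M. rep (f R) M \<and> below R e {a, b} \<and>
    (\<forall>i\<in>{1..n}. sg (R i) a b = s i) \<and> M a b = v * M a e)"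

lemma ratioI:
  assumes "distinct [a, b, e]" "R \<in> profiles n D" "rep (f R) M" "below R e {a, b}"
    "\<And>i. i \<in> {1..n} \<Longrightarrow> sg (R i) a b = s i"
  shows "ratio a b e s (M a b / M a e)"
proof -
  have "M a b = M a b / M a e * M a e" using below_equal(2)[OF assms(2-4)] by simp
  then show ?thesis unfolding ratio_def using assms by blast
qed

lemma ratio_exists:
  assumes "distinct [a, b, e]" and s: "\<And>i. s i \<in> {-1, 0, 1}"
  shows "\<exists>v. ratio a b e s v"
proof -
  have "a \<noteq> b" using assms(1) by simp
  from sign_profile[where s = s, OF this s] obtain S where S: "S \<in> profiles n D" "\<And>i. i \<in> {1..n} \<Longrightarrow> sg (S i) a b = s i"
    by blast
  have "card {a, b} \<le> 4" using assms(1) by simp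
  with below_profile[of S "{a, b}" e, OF profile_prefs[OF S(1)]] assms(1) obtain T where T: "T \<in> profiles n D"
    "below T e {a, b}" "\<forall>i\<in>{1..n}. \<forall>x\<in>{a, b}. \<forall>y\<in>{a, b}. sg (T i) x y = sg (S i) x y"
    by auto
  obtain M where M: "rep (f T) M" using f_rep[OF T(1)] by blast
  have "sg (T i) a b = s i" if "i \<in> {1..n}" for i using T(3) S(2) that by simp
  then show ?thesis using ratioI[OF assms(1) T(1) M T(2)] by blast
qed

lemma ratio_neg:
  assumes "ratio a b e s v" shows "ratio b a e (\<lambda>i. - s i) (- v)"
proof -
  obtain R M where d: "distinct [a, b, e]" and R: "R \<in> profiles n D" and M: "rep (f R) M"
    and be: "below R e {a, b}" and s: "\<And>i. i \<in> {1..n} \<Longrightarrow> sg (R i) a b = s i" and v: "M a b = v * M a e"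
    using assms unfolding ratio_def by blast
  have "M b a = - v * M b e" using skewD[OF rep_skew[OF M], of b a] v below_equal(1)[OF R M be] by simp
  moreover have "\<forall>i\<in>{1..n}. sg (R i) b a = - s i" using profile_skew[OF R, of _ b a] s by simp
  moreover have "below R e {b, a}" using be by (simp add: insert_commute)
  moreover have "distinct [b, a, e]" using d by auto
  ultimately show ?thesis unfolding ratio_def using R M by blast
qed

text \<open>All signs on \<open>{a, b, e}\<close> are prescribed, so the two collective matrices are
  proportional there, and the factor cancels in the ratio.\<close>

lemma ratio_same_pair:
  assumes "ratio a b e s v" "ratio a b e s w" shows "v = w"
proof -
  obtain R M where d: "distinct [a, b, e]" and R: "R \<in> profiles n D" and M: "rep (f R) M"
    and be: "below R e {a, b}" and s: "\<And>i. i \<in> {1..n} \<Longrightarrow> sg (R i) a b = s i" and v: "M a b = v * M a e"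
    using assms(1) unfolding ratio_def by blast
  obtain R' M' where R': "R' \<in> profiles n D" and M': "rep (f R') M'"
    and be': "below R' e {a, b}" and s': "\<And>i. i \<in> {1..n} \<Longrightarrow> sg (R' i) a b = s i" and w: "M' a b = w * M' a e"
    using assms(2) unfolding ratio_def by blast
  have "sg (R i) x y = sg (R' i) x y" if i: "i \<in> {1..n}" and xy: "x \<in> {a, b, e}" "y \<in> {a, b, e}" for i x y
  proof -
    have "sg (R i) a e = 1" "sg (R i) b e = 1" "sg (R' i) a e = 1" "sg (R' i) b e = 1"
      using be be' i by (simp_all add: below_def)
    moreover have "sg (Q i) e a = - sg (Q i) a e" "sg (Q i) e b = - sg (Q i) b e" "sg (Q i) b a = - sg (Q i) a b"
      "sg (Q i) x x = 0" if "Q \<in> profiles n D" for Q x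
      using profile_skew[OF that i] profile_diag[OF that i] by blast+
    ultimately show ?thesis using xy s[OF i] s'[OF i] R R' by auto
  qed
  from iia_sg[where X = "{a, b, e}", OF R R' M M' this] obtain c where c: "c > 0" "M' a b = c * M a b" "M' a e = c * M a e" by auto
  have "M a e > 0" by (rule below_equal(2)[OF R M be])
  then show ?thesis using c v w by simp
qed

text \<open>In one profile where every agent is indifferent between \<open>b\<close> and
  \<open>c\<close>, and has sign \<open>s i\<close> on \<open>a\<close> against either, the
  lotteries \<open>a + c\<close> and \<open>a + b\<close> are indifferent for everybody; hence
  \<open>M a b = M a c\<close>.\<close>

lemma ratio_change_right:
  assumes v: "ratio a b e s v" and w: "ratio a c e s w" and s: "\<And>i. s i \<in> {-1, 0, 1}"
  shows "v = w"
proof (cases "b = c")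
  case True
  then show ?thesis using ratio_same_pair v w by blast
next
  case False
  have d: "distinct [a, b, c, e]" using v w False by (auto simp: ratio_def)
  obtain q where q: "q \<in> D" "sg q b c = 0" "sg q b a = 1" "sg q c a = 1" using star_exists[of b a c] d by auto
  define B where "B = (\<lambda>i. signed (s i) (q\<inverse>))"
  have B: "B i \<in> D" for i unfolding B_def by (rule signed_D[OF rich_converse[OF D q(1)]])
  have rq: "rep q (sg q)" by (rule rep_sg[OF q(1)])
  have repB: "rep (B i) (\<lambda>x y. s i * - sg q x y)" for i
    unfolding B_def by (rule signed_rep[OF s rep_converse[OF rq]])
  have skq: "sg q a b = - 1" "sg q a c = - 1"
    using skewD[OF rep_skew[OF rq], of a b] skewD[OF rep_skew[OF rq], of a c] q by simp_all
  have sB: "sg (B i) a b = s i" "sg (B i) a c = s i" "sg (B i) b c = 0" for i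
    using sg_rep[OF repB] sgn_unit[OF s] by (simp_all add: skq q)
  have "card {a, b, c} \<le> 4" using d by simp
  with below_profile[of B, OF B, of "{a, b, c}" e] d obtain T where T: "T \<in> profiles n D"
    "below T e {a, b, c}" "\<forall>i\<in>{1..n}. \<forall>x\<in>{a, b, c}. \<forall>y\<in>{a, b, c}. sg (T i) x y = sg (B i) x y"
    by auto
  obtain M where M: "rep (f T) M" using f_rep[OF T(1)] by blast
  have sT: "sg (T i) a b = s i" "sg (T i) a c = s i" "sg (T i) b c = 0" if "i \<in> {1..n}" for i
    using T(3) that sB by simp_all
  have "bil M (pure b) (pure c) = 0"
    by (rule pareto_zero[OF T(1) M profile_rep_sg[OF T(1)]]) (simp_all add: bil_pure sT)
  then have Mbc: "M b c = 0" by (simp add: bil_pure)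
  define x where "x = pure a + pure c"
  define y where "y = pure a + pure b"
  have xy: "bil N x y = N a a + N a b + N c a + N c b" for N
    by (simp add: x_def y_def bil_linear bil_pure)
  have "bil M x y = 0"
  proof (rule pareto_zero[OF T(1) M profile_rep_sg[OF T(1)]])
    show "bil (sg (T i)) x y = 0" if i: "i \<in> {1..n}" for i
      using profile_skew[OF T(1) i, of c a] profile_skew[OF T(1) i, of c b] profile_diag[OF T(1) i, of a] sT[OF i]
      by (simp add: xy)
  qed (simp_all add: x_def y_def nonneg_add)
  then have "M a b = M a c"
    using skewD[OF rep_skew[OF M], of c a] skewD[OF rep_skew[OF M], of c b] skew_diag[OF rep_skew[OF M], of a] Mbc
    by (simp add: xy)
  moreover have "ratio a b e s (M a b / M a e)"
    by (rule ratioI[OF _ T(1) M]) (use d T(2) sT in \<open>auto simp: below_def\<close>)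
  moreover have "ratio a c e s (M a c / M a e)"
    by (rule ratioI[OF _ T(1) M]) (use d T(2) sT in \<open>auto simp: below_def\<close>)
  ultimately show ?thesis using ratio_same_pair v w by metis
qed

lemma ratio_change_left:
  assumes v: "ratio a b e s v" and w: "ratio c b e s w" and s: "\<And>i. s i \<in> {-1, 0, 1}"
  shows "v = w"
proof -
  have "- s i \<in> {-1, 0, 1}" for i using s[of i] by auto
  then have "- v = - w" by (rule ratio_change_right[OF ratio_neg[OF v] ratio_neg[OF w]])
  then show ?thesis by simp
qed

lemma ratio_unique:
  assumes v: "ratio a b e s v" and w: "ratio a' b' e s w" and s: "\<And>i. s i \<in> {-1, 0, 1}"
  shows "v = w"
proof -
  have d: "distinct [a, b, e]" "distinct [a', b', e]" using v w by (auto simp: ratio_def)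
  \<comment> \<open>\<open>c\<close> has to avoid both pairs formed below but may equal
    \<open>a'\<close>, since the change lemmas admit equal alternatives; so five alternatives
    suffice.\<close>
  obtain c where c: "c \<notin> set [a, b, b', e]" using third_exists[of "[a, b, b', e]"] by auto
  have dc: "distinct [c, b, e]" "distinct [c, b', e]" using c d by auto
  obtain x where x: "ratio c b e s x" using ratio_exists[where s = s, OF dc(1) s] by blast
  obtain y where y: "ratio c b' e s y" using ratio_exists[where s = s, OF dc(2) s] by blast
  have "v = x" by (rule ratio_change_left[OF v x s])
  also have "x = y" by (rule ratio_change_right[OF x y s])
  also have "y = w" by (rule ratio_change_left[OF y w s])
  finally show ?thesis .
qed

section \<open>The value of a sign profile as an additive function of its supporters\<close>

text \<open>By \<open>ratio_unique\<close> the choice does not depend on the pair. The unit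
  \<open>e\<close> remains a parameter because values are compared only within one unit.\<close>

definition value_of :: "'a \<Rightarrow> (nat \<Rightarrow> real) \<Rightarrow> real" where
  "value_of e s = (SOME v. \<exists>a b. ratio a b e s v)"

lemma value_of_ratio:
  assumes v: "ratio a b e s v" and s: "\<And>i. s i \<in> {-1, 0, 1}"
  shows "value_of e s = v"
proof -
  have "\<exists>a b. ratio a b e s (value_of e s)" unfolding value_of_def by (rule someI[of _ v]) (use v in blast)
  then show ?thesis using ratio_unique[OF _ v s] by blast
qed

lemma value_of_eq:
  assumes "distinct [a, b, e]" and R: "R \<in> profiles n D" and M: "rep (f R) M" and be: "below R e {a, b}"
    and "\<And>i. i \<in> {1..n} \<Longrightarrow> sg (R i) a b = s i" and s: "\<And>i. s i \<in> {-1, 0, 1}"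
  shows "M a b = value_of e s * M a e"
  using value_of_ratio[OF ratioI[OF assms(1-5)] s] below_equal(2)[OF R M be] by simp

lemma value_of_neg:
  assumes s: "\<And>i. s i \<in> {-1, 0, 1}"
  shows "value_of e (\<lambda>i. - s i) = - value_of e s"
proof -
  obtain a where a: "a \<notin> set [e]" using third_exists[of "[e]"] by auto
  obtain b where b: "b \<notin> set [a, e]" using third_exists[of "[a, e]"] by auto
  have "distinct [a, b, e]" using a b by auto
  from ratio_exists[where s = s, OF this s] obtain v where v: "ratio a b e s v" by blast
  have "- s i \<in> {-1, 0, 1}" for i using s[of i] by auto
  then have "value_of e (\<lambda>i. - s i) = - v" by (rule value_of_ratio[OF ratio_neg[OF v]])
  then show ?thesis using value_of_ratio[OF v s] by simp
qed

text \<open>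
  The key profile: the agents in \<open>P\<close> rank \<open>a > b, c > d\<close>, those in \<open>Q\<close> rank \<open>b > a, c, d\<close>, and
  the others are indifferent on \<open>a, b, c, d\<close>. Every agent is indifferent between the lotteries
  proportional to \<open>a + 2 b + d\<close> and \<open>b + c\<close>.
\<close>

lemma value_of_two_groups:
  assumes PQ: "P \<inter> Q = {}"
  shows "value_of e (\<lambda>i. indicator P i - indicator Q i)
    = value_of e (indicator (P \<union> Q)) - 2 * value_of e (indicator Q)"
proof -
  obtain a where a: "a \<notin> set [e]" using third_exists[of "[e]"] by auto
  obtain b where b: "b \<notin> set [a, e]" using third_exists[of "[a, e]"] by auto
  obtain c where c: "c \<notin> set [a, b, e]" using third_exists[of "[a, b, e]"] by auto
  obtain d where d: "d \<notin> set [a, b, c, e]" using third_exists[of "[a, b, c, e]"] by auto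
  have dist: "distinct [a, b, c, d, e]" using a b c d by auto
  have skD: "sg r x y = - sg r y x" if "r \<in> D" for r x y
    by (rule sg_skew[OF rich_prefs[OF D that]])
  obtain q where q: "q \<in> D" "sg q b c = 0" "sg q b a = 1" "sg q c a = 1" using star_exists[of b a c] dist by auto
  have q': "sg (q\<inverse>) x y = - sg q x y" for x y by (rule sg_converse[OF rich_prefs[OF D q(1)]])
  have "card {a, b, c} \<le> 4" using dist by simp
  with add_bottom[OF D rich_converse[OF D q(1)], of "{a, b, c}" d] dist obtain rP where rP: "rP \<in> D"
    "\<forall>x\<in>{a, b, c}. \<forall>y\<in>{a, b, c}. sg rP x y = sg (q\<inverse>) x y" "\<forall>x\<in>{a, b, c}. sg rP x d = 1" by auto
  have P: "sg rP a b = 1" "sg rP a c = 1" "sg rP b c = 0" "sg rP b d = 1" "sg rP c d = 1"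
    using rP(2,3) q skD[OF q(1), of a b] skD[OF q(1), of a c] by (simp_all add: q')
  have "card {a, c, d} \<le> 4" using dist by simp
  with add_bottom[OF D rich_empty[OF D], of "{a, c, d}" b] dist obtain p where p: "p \<in> D"
    "\<forall>x\<in>{a, c, d}. \<forall>y\<in>{a, c, d}. sg p x y = 0" "\<forall>x\<in>{a, c, d}. sg p x b = 1" by (auto simp: sg_empty)
  \<comment> \<open>\<open>b\<close> is first added below the indifferent alternatives
    \<open>a, c, d\<close>; inverting puts it on top.\<close>
  define rQ where "rQ = p\<inverse>"
  have rQ: "rQ \<in> D" unfolding rQ_def by (rule rich_converse[OF D p(1)])
  have "sg rQ x y = - sg p x y" for x y unfolding rQ_def by (rule sg_converse[OF rich_prefs[OF D p(1)]])
  then have Q: "sg rQ a b = - 1" "sg rQ a c = 0" "sg rQ b c = 1" "sg rQ b d = 1" "sg rQ c d = 0"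
    using p(2,3) skD[OF p(1), of b c] skD[OF p(1), of b d] by simp_all
  define B where "B = (\<lambda>i. if i \<in> P then rP else if i \<in> Q then rQ else {})"
  have B: "B i \<in> D" for i using rP(1) rQ rich_empty[OF D] by (simp add: B_def)
  have "card {a, b, c, d} \<le> 4" using dist by simp
  with below_profile[of B, OF B, of "{a, b, c, d}" e] dist obtain T where T: "T \<in> profiles n D"
    "below T e {a, b, c, d}" "\<forall>i\<in>{1..n}. \<forall>x\<in>{a, b, c, d}. \<forall>y\<in>{a, b, c, d}. sg (T i) x y = sg (B i) x y"
    by auto
  obtain M where M: "rep (f T) M" using f_rep[OF T(1)] by blast
  have sT: "sg (T i) a b = indicator P i - indicator Q i" "sg (T i) a c = indicator P i" "sg (T i) b c = indicator Q i"
    "sg (T i) b d = indicator (P \<union> Q) i" "sg (T i) c d = indicator P i" if "i \<in> {1..n}" for i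
  proof -
    have "sg (T i) x y = sg (B i) x y" if "x \<in> {a, b, c, d}" "y \<in> {a, b, c, d}" for x y
      using T(3) \<open>i \<in> {1..n}\<close> that by blast
    then show "sg (T i) a b = indicator P i - indicator Q i" "sg (T i) a c = indicator P i" "sg (T i) b c = indicator Q i"
      "sg (T i) b d = indicator (P \<union> Q) i" "sg (T i) c d = indicator P i"
      using PQ P Q by (auto simp: B_def sg_empty indicator_def)
  qed
  have bw: "below T e {x, y}" if "x \<in> {a, b, c, d}" "y \<in> {a, b, c, d}" for x y
    using T(2) that unfolding below_def by blast
  \<comment> \<open>The sum to be tested is \<open>a b + a c + 2 * b c - b d - c d\<close>: it is
    \<open>1 + 1 + 0 - 1 - 1\<close> for an agent in \<open>P\<close> and
    \<open>- 1 + 0 + 2 - 1 - 0\<close> for one in \<open>Q\<close>. The pairs \<open>a, c\<close>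
    and \<open>c, d\<close> are both supported by \<open>P\<close> alone, so collectively they
    cancel.\<close>
  define x where "x = pure a + 2 *\<^sub>R pure b + pure d"
  define y where "y = pure b + pure c"
  have xy: "bil N x y = N a b + N a c + 2 * N b b + 2 * N b c + N d b + N d c" for N
    by (simp add: x_def y_def bil_linear bil_pure)
  have "bil M x y = 0"
  proof (rule pareto_zero[OF T(1) M profile_rep_sg[OF T(1)]])
    show "bil (sg (T i)) x y = 0" if i: "i \<in> {1..n}" for i
      using profile_skew[OF T(1) i, of d b] profile_skew[OF T(1) i, of d c] profile_diag[OF T(1) i, of b] sT[OF i] PQ
      by (auto simp: xy indicator_def)
  qed (simp_all add: x_def y_def nonneg_add nonneg_scale)
  then have eq: "M a b + M a c + 2 * M b c - M b d - M c d = 0"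
    using skewD[OF rep_skew[OF M], of d b] skewD[OF rep_skew[OF M], of d c] skew_diag[OF rep_skew[OF M], of b]
    by (simp add: xy)
  have iv: "indicator A i \<in> {- 1, 0, 1::real}" for A :: "nat set" and i by (simp add: indicator_def)
  have iv2: "indicator P i - indicator Q i \<in> {- 1, 0, 1::real}" for i by (simp add: indicator_def)
  define t where "t = M a e"
  have t: "M b e = t" "M c e = t" "t > 0"
    using below_equal[OF T(1) M bw[of a b]] below_equal[OF T(1) M bw[of a c]] by (simp_all add: t_def)
  have "M a b = value_of e (\<lambda>i. indicator P i - indicator Q i) * t" "M a c = value_of e (indicator P) * t"
    "M b c = value_of e (indicator Q) * t" "M b d = value_of e (indicator (P \<union> Q)) * t" "M c d = value_of e (indicator P) * t"
    using dist t value_of_eq[OF _ T(1) M bw[of a b] sT(1) iv2] value_of_eq[OF _ T(1) M bw[of a c] sT(2) iv]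
      value_of_eq[OF _ T(1) M bw[of b c] sT(3) iv] value_of_eq[OF _ T(1) M bw[of b d] sT(4) iv]
      value_of_eq[OF _ T(1) M bw[of c d] sT(5) iv]
    by (auto simp: t_def)
  then have "t * (value_of e (\<lambda>i. indicator P i - indicator Q i) + 2 * value_of e (indicator Q)
      - value_of e (indicator (P \<union> Q))) = 0"
    using eq by (simp add: algebra_simps)
  then show ?thesis using t(3) by simp
qed

lemma value_of_additive:
  assumes "P \<inter> Q = {}"
  shows "value_of e (indicator (P \<union> Q)) = value_of e (indicator P) + value_of e (indicator Q)"
proof -
  have "indicator P i - indicator Q i \<in> {- 1, 0, 1::real}" for i :: nat by (simp add: indicator_def)
  from value_of_neg[of "\<lambda>i. indicator P i - indicator Q i" e, OF this]
  have "value_of e (\<lambda>i. indicator Q i - indicator P i) = - value_of e (\<lambda>i. indicator P i - indicator Q i)" by simp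
  moreover have "Q \<inter> P = {}" using assms by blast
  ultimately show ?thesis
    using value_of_two_groups[OF assms, of e] value_of_two_groups[of Q P e] by (simp add: Un_commute)
qed

text \<open>When everybody ranks \<open>a > b > e\<close>, the lotteries \<open>a + e\<close> and
  \<open>b\<close> are indifferent for all agents, so \<open>a\<close> against \<open>b\<close> has
  the same collective intensity as \<open>b\<close> against \<open>e\<close>, the unit.\<close>

lemma value_of_unanimous: "value_of e (indicator {1..n}) = 1"
proof -
  obtain a where a: "a \<notin> set [e]" using third_exists[of "[e]"] by auto
  obtain b where b: "b \<notin> set [a, e]" using third_exists[of "[a, e]"] by auto
  have d: "distinct [a, b, e]" using a b by auto
  have s: "indicator {1..n} i \<in> {- 1, 0, 1::real}" for i by (simp add: indicator_def)
  from ratio_exists[where s = "indicator {1..n}", OF d s] obtain v where v: "ratio a b e (indicator {1..n}) v" by blast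
  then obtain R M where R: "R \<in> profiles n D" and M: "rep (f R) M" and be: "below R e {a, b}"
    and sR: "\<And>i. i \<in> {1..n} \<Longrightarrow> sg (R i) a b = indicator {1..n} i" and vM: "M a b = v * M a e"
    unfolding ratio_def by blast
  define x where "x = pure a + pure e"
  have x: "bil N x (pure b) = N a b + N e b" for N by (simp add: x_def bil_linear bil_pure)
  have "bil M x (pure b) = 0"
  proof (rule pareto_zero[OF R M profile_rep_sg[OF R]])
    show "bil (sg (R i)) x (pure b) = 0" if i: "i \<in> {1..n}" for i
      using sR[OF i] i be profile_skew[OF R i, of e b] by (simp add: x below_def)
  qed (simp_all add: x_def nonneg_add)
  then have "M a b = M b e" using skewD[OF rep_skew[OF M], of e b] by (simp add: x)
  then have "v = 1" using vM below_equal[OF R M be] by simp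
  then show ?thesis using value_of_ratio[OF v s] by simp
qed

lemma value_of_anonymous:
  assumes i: "i \<in> {1..n}" and j: "j \<in> {1..n}"
  shows "value_of e (indicator {i}) = value_of e (indicator {j})"
proof -
  obtain a where a: "a \<notin> set [e]" using third_exists[of "[e]"] by auto
  obtain b where b: "b \<notin> set [a, e]" using third_exists[of "[a, e]"] by auto
  have d: "distinct [a, b, e]" using a b by auto
  have s: "indicator {k} l \<in> {- 1, 0, 1::real}" for k l :: nat by (simp add: indicator_def)
  from ratio_exists[where s = "indicator {i}", OF d s] obtain v where v: "ratio a b e (indicator {i}) v" by blast
  then obtain R M where R: "R \<in> profiles n D" and M: "rep (f R) M" and be: "below R e {a, b}"
    and sR: "\<And>k. k \<in> {1..n} \<Longrightarrow> sg (R k) a b = indicator {i} k" and vM: "M a b = v * M a e"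
    unfolding ratio_def by blast
  define \<pi> where "\<pi> = Transposition.transpose i j"
  have \<pi>: "\<pi> permutes {1..n}" unfolding \<pi>_def by (rule permutes_swap_id[OF i j])
  have \<pi>N: "\<pi> k \<in> {1..n}" if "k \<in> {1..n}" for k using permutes_in_image[OF \<pi>] that by blast
  have "R \<circ> \<pi> \<in> profiles n D"
    unfolding profiles_def
  proof (rule PiE_I)
    show "(R \<circ> \<pi>) k \<in> D" if "k \<in> {1..n}" for k using profile_prefs[OF R \<pi>N[OF that]] by simp
    show "(R \<circ> \<pi>) k = undefined" if k: "k \<notin> {1..n}" for k
    proof -
      have "R k = undefined" using R k unfolding profiles_def by (rule PiE_arb)
      then show ?thesis by (simp only: o_apply permutes_not_in[OF \<pi> k])
    qed
  qed
  moreover have "f R = f (R \<circ> \<pi>)" using anon R \<pi> unfolding anonymous_def by blast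
  then have "rep (f (R \<circ> \<pi>)) M" using M by (simp only:)
  moreover have "below (R \<circ> \<pi>) e {a, b}" using be \<pi>N by (simp add: below_def)
  moreover have "sg ((R \<circ> \<pi>) k) a b = indicator {j} k" if "k \<in> {1..n}" for k
  proof -
    have "sg ((R \<circ> \<pi>) k) a b = indicator {i} (\<pi> k)" using sR[OF \<pi>N[OF that]] by simp
    also have "\<dots> = indicator {j} k" by (auto simp: \<pi>_def Transposition.transpose_def indicator_def)
    finally show ?thesis .
  qed
  ultimately have "ratio a b e (indicator {j}) v"
    unfolding ratio_def using d vM by (intro conjI bexI[of _ "R \<circ> \<pi>"] exI[of _ M] ballI)
  from value_of_ratio[OF v s] value_of_ratio[OF this s] show ?thesis by (rule trans[OF _ sym])
qed

lemma value_of_card: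
  assumes "P \<subseteq> {1..n}" shows "value_of e (indicator P) = card P / n"
proof -
  define w where "w = value_of e (indicator {1})"
  have empty: "value_of e (indicator {}) = 0" using value_of_additive[of "{}" "{}" e] by simp
  have c: "value_of e (indicator P) = card P * w" if "P \<subseteq> {1..n}" for P
  proof -
    have "finite P" using that finite_subset by blast
    then show ?thesis using that
    proof (induction rule: finite_induct)
      case (insert k P)
      have "value_of e (indicator {k}) = w" unfolding w_def using insert.prems n2 by (intro value_of_anonymous) auto
      moreover have "value_of e (indicator ({k} \<union> P)) = value_of e (indicator {k}) + value_of e (indicator P)"
        using insert.hyps(2) by (intro value_of_additive) auto
      moreover have "value_of e (indicator P) = card P * w" using insert.IH insert.prems by blast
      ultimately show ?case using insert.hyps by (simp add: distrib_right)
    qed (simp add: empty)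
  qed
  have "n * w = 1" using c[of "{1..n}"] value_of_unanimous by simp
  then have "w = 1 / n" using n2 by (simp add: field_simps)
  then show ?thesis using c[OF assms] by simp
qed

lemma value_of_sum:
  assumes s: "\<And>i. s i \<in> {-1, 0, 1}" and out: "\<And>i. i \<notin> {1..n} \<Longrightarrow> s i = 0"
  shows "value_of e s = (\<Sum>i\<in>{1..n}. s i) / n"
proof -
  define P where "P = {i\<in>{1..n}. s i = 1}"
  define Q where "Q = {i\<in>{1..n}. s i = - 1}"
  have sPQ: "s = (\<lambda>i. indicator P i - indicator Q i)"
  proof
    fix i
    show "s i = indicator P i - indicator Q i"
      using s[of i] out[of i] by (auto simp: P_def Q_def indicator_def)
  qed
  have PQ: "P \<inter> Q = {}" "P \<subseteq> {1..n}" "Q \<subseteq> {1..n}" by (auto simp: P_def Q_def)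
  then have fin: "finite P" "finite Q" using finite_subset by blast+
  have "(\<Sum>i\<in>{1..n}. s i) = (\<Sum>i\<in>{1..n}. indicator P i) - (\<Sum>i\<in>{1..n}. indicator Q i)"
    unfolding sPQ by (rule sum_subtractf)
  also have "\<dots> = real (card P) - real (card Q)"
  proof -
    have "(\<Sum>i\<in>{1..n}. indicator A i) = (\<Sum>i\<in>A. 1 :: real)" if "A \<subseteq> {1..n}" for A
      using that by (intro sum.mono_neutral_cong_right) (auto simp: indicator_def)
    then show ?thesis using PQ(2,3) by simp
  qed
  finally have "(\<Sum>i\<in>{1..n}. s i) = real (card P) - real (card Q)" .
  moreover have "value_of e s = real (card (P \<union> Q)) / n - 2 * (real (card Q) / n)"
    unfolding sPQ value_of_two_groups[OF PQ(1)] using PQ by (simp add: value_of_card)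
  ultimately show ?thesis using card_Un_disjoint[OF fin PQ(1)] by (simp add: diff_divide_distrib add_divide_distrib)
qed

text \<open>\<open>R\<close> itself need not have a common worst alternative. Intensities are
  computed in a profile \<open>T\<close> with the same signs on \<open>X\<close> and
  \<open>e\<close> at the bottom, and independence carries them back up to a factor.\<close>

lemma sum_locally_proportional:
  assumes R: "R \<in> profiles n D" and M: "rep (f R) M" and X: "card X \<le> 4"
  shows "\<exists>k>0. \<forall>x\<in>X. \<forall>y\<in>X. M x y = k * (\<Sum>i\<in>{1..n}. sg (R i) x y)"
proof (cases "X = {}")
  case False
  then obtain z where z: "z \<in> X" by blast
  have "X \<noteq> UNIV" using X card by auto
  then obtain e where e: "e \<notin> X" by blast
  from below_profile[of R X e, OF profile_prefs[OF R] X e] obtain T where T: "T \<in> profiles n D" "below T e X"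
    "\<forall>i\<in>{1..n}. \<forall>x\<in>X. \<forall>y\<in>X. sg (T i) x y = sg (R i) x y" by blast
  obtain N where N: "rep (f T) N" using f_rep[OF T(1)] by blast
  have bw: "below T e {x, y}" if "x \<in> X" "y \<in> X" for x y using T(2) that unfolding below_def by blast
  define t where "t = N z e"
  have t: "N x e = t" "t > 0" if "x \<in> X" for x
    using below_equal[OF T(1) N bw[OF z that]] by (simp_all add: t_def)
  have Nm: "N x y = t / n * (\<Sum>i\<in>{1..n}. sg (R i) x y)" if x: "x \<in> X" and y: "y \<in> X" for x y
  proof (cases "x = y")
    case True
    then show ?thesis using skew_diag[OF rep_skew[OF N]] profile_diag[OF R] by simp
  next
    case False
    define s where "s = (\<lambda>i. if i \<in> {1..n} then sg (R i) x y else 0)"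
    have s: "s i \<in> {-1, 0, 1}" for i using sg_values[of "R i" x y] by (simp add: s_def)
    have "N x y = value_of e s * N x e"
    proof (rule value_of_eq[OF _ T(1) N bw[OF x y] _ s])
      show "distinct [x, y, e]" using False x y e by auto
      show "sg (T i) x y = s i" if "i \<in> {1..n}" for i using T(3) that x y by (simp add: s_def)
    qed
    also have "value_of e s = (\<Sum>i\<in>{1..n}. s i) / n"
    proof (rule value_of_sum[where s = s, OF s])
      show "s i = 0" if "i \<notin> {1..n}" for i using that unfolding s_def by (rule if_not_P)
    qed
    also have "(\<Sum>i\<in>{1..n}. s i) = (\<Sum>i\<in>{1..n}. sg (R i) x y)" by (intro sum.cong refl) (simp add: s_def)
    finally show ?thesis using t(1)[OF x] by simp
  qed
  have "\<exists>c>0. \<forall>x\<in>X. \<forall>y\<in>X. M x y = c * N x y"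
    by (rule iia_sg[OF T(1) R N M]) (use T(3) in blast)
  then obtain c where c: "c > 0" "\<And>x y. x \<in> X \<Longrightarrow> y \<in> X \<Longrightarrow> M x y = c * N x y" by blast
  have "c * (t / n) > 0" using c(1) t(2)[OF z] n2 by simp
  moreover have "M x y = c * (t / n) * (\<Sum>i\<in>{1..n}. sg (R i) x y)" if "x \<in> X" "y \<in> X" for x y
    by (simp only: c(2)[OF that] Nm[OF that] mult.assoc)
  ultimately show ?thesis by blast
qed (use zero_less_one in blast)

text \<open>The local factor may depend on the set, but any two entries lie in a common set of at
  most four alternatives; so the factor of one nonzero entry serves all.\<close>

theorem rep_sum:
  assumes R: "R \<in> profiles n D"
  shows "rep (f R) (\<lambda>a b. \<Sum>i\<in>{1..n}. sg (R i) a b)"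
proof -
  obtain M where M: "rep (f R) M" using f_rep[OF R] by blast
  define m where "m = (\<lambda>a b. \<Sum>i\<in>{1..n}. sg (R i) a b)"
  have loc: "\<exists>k>0. M a b = k * m a b \<and> M c d = k * m c d" for a b c d
  proof -
    have "card {a, b, c, d} \<le> 4" by (simp add: card_insert_if)
    from sum_locally_proportional[OF R M this] show ?thesis unfolding m_def by auto
  qed
  show ?thesis
  proof (cases "\<exists>a b. m a b \<noteq> 0")
    case True
    then obtain a b where ab: "m a b \<noteq> 0" by blast
    define k where "k = M a b / m a b"
    have k: "k > 0" using loc[of a b a b] ab by (auto simp: k_def)
    have "m c d = 1 / k * M c d" for c d
    proof -
      obtain l where "l > 0" "M a b = l * m a b" "M c d = l * m c d" using loc by blast
      then show ?thesis using ab by (simp add: k_def)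
    qed
    then have "m = (\<lambda>c d. 1 / k * M c d)" by (intro ext)
    then show ?thesis using rep_scale[OF M, of "1 / k"] k by (simp add: m_def)
  next
    case False
    have "M c d = m c d" for c d using loc[of c d c d] False by auto
    then have "M = m" by (intro ext)
    then show ?thesis using M by (simp add: m_def)
  qed
qed

end

section \<open>Equivalence of the Arrovian and the utilitarian description\<close>

theorem corollary1:
  fixes D :: "'a::finite pref set"
    and f :: "(nat \<Rightarrow> 'a pref) \<Rightarrow> 'a pref"
    and n :: nat
  assumes "CARD('a) \<ge> 5"
    and "n \<ge> 2"
    and "rich D"
    and "swf n D f"
    and "anonymous n D f"
  shows "arrovian n D f \<longleftrightarrow> utilitarian n D f \<and> D \<subseteq> pc_prefs"
proof
  assume "arrovian n D f"
  then interpret arrovian_swf D f n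
    using assms by unfold_locales (auto simp: arrovian_def)
  have "D \<subseteq> pc_prefs" using rep_sg rich_prefs[OF assms(3)] by (auto simp: pc_prefs_iff)
  moreover have "utilitarian n D f"
    unfolding utilitarian_def
  proof (intro ballI exI conjI)
    fix R i assume R: "R \<in> profiles n D" and i: "i \<in> {1..n}"
    show "bil (sg (R i)) \<in> normalized_ssb" by (rule sg_normalized[OF rich_prefs[OF D profile_prefs[OF R i]]])
    show "represents (R i) (bil (sg (R i)))" using profile_rep_sg[OF R i] by (simp add: rep_def represents_def)
  next
    fix R assume R: "R \<in> profiles n D"
    show "represents (f R) (\<lambda>p q. \<Sum>i\<in>{1..n}. bil (sg (R i)) p q)"
      using rep_sum[OF R] unfolding rep_def represents_def bil_sum_matrix by blast
  qed
  ultimately show "utilitarian n D f \<and> D \<subseteq> pc_prefs" by blast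
next
  assume "utilitarian n D f \<and> D \<subseteq> pc_prefs"
  then have ut: "utilitarian n D f" and pc: "D \<subseteq> pc_prefs" by blast+
  define m where "m = (\<lambda>R a b. \<Sum>i\<in>{1..n}. sg (R i :: 'a pref) a b)"
  have RD: "rep (R i) (sg (R i))" if "R \<in> profiles n D" "i \<in> {1..n}" for R i
  proof -
    have "R i \<in> D" using that unfolding profiles_def by (rule PiE_mem)
    then show ?thesis using pc pc_prefs_iff by blast
  qed
  have fR: "rep (f R) (m R)" if R: "R \<in> profiles n D" for R
  proof -
    obtain \<phi> where \<phi>: "\<And>i. i \<in> {1..n} \<Longrightarrow> \<phi> i \<in> normalized_ssb \<and> represents (R i) (\<phi> i)"
      and fr: "represents (f R) (\<lambda>p q. \<Sum>i\<in>{1..n}. \<phi> i p q)"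
      using ut R unfolding utilitarian_def by blast
    \<comment> \<open>On pairwise-comparison relations the functions named by
      \<open>utilitarian\<close> are forced to be the sign matrices.\<close>
    have "(\<Sum>i\<in>{1..n}. \<phi> i p q) = bil (m R) p q" if "p \<in> outcomes" "q \<in> outcomes" for p q
      unfolding m_def bil_sum_matrix using \<phi> normalized_pc_unique[OF RD[OF R] _ _ that] by (intro sum.cong refl) blast
    moreover have "skew (m R)" unfolding m_def by (intro skew_sum rep_skew[OF RD[OF R]])
    ultimately show ?thesis using fr unfolding rep_def represents_def by simp
  qed
  have "pareto_optimal n D f"
    unfolding pareto_optimal_def
  proof (intro ballI impI)
    fix R p q assume R: "R \<in> profiles n D" and p: "p \<in> outcomes" and q: "q \<in> outcomes"
      and w: "\<forall>i\<in>{1..n}. weakly_prefers (R i) p q"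
    have le: "0 \<le> bil (sg (R i)) p q" if "i \<in> {1..n}" for i
      using w that rep_weakly_prefers[OF RD[OF R that] p q] by blast
    have sum: "bil (m R) p q = (\<Sum>i\<in>{1..n}. bil (sg (R i)) p q)" unfolding m_def by (rule bil_sum_matrix)
    have "(p, q) \<in> f R" if ex: "\<exists>i\<in>{1..n}. (p, q) \<in> R i"
    proof -
      obtain i where i: "i \<in> {1..n}" "(p, q) \<in> R i" using ex by blast
      have "0 < bil (sg (R i)) p q" using rep_iff[OF RD[OF R i(1)] p q] i(2) by blast
      then have "0 < bil (m R) p q" unfolding sum using le i(1) by (intro sum_pos2[of _ i]) auto
      then show ?thesis using rep_iff[OF fR[OF R] p q] by blast
    qed
    moreover have "weakly_prefers (f R) p q"
      unfolding rep_weakly_prefers[OF fR[OF R] p q] sum using le by (rule sum_nonneg)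
    ultimately show "weakly_prefers (f R) p q \<and> ((\<exists>i\<in>{1..n}. (p, q) \<in> R i) \<longrightarrow> (p, q) \<in> f R)" by blast
  qed
  moreover have "iia n D f"
    unfolding iia_def
  proof (intro ballI allI impI)
    fix R R' X assume R: "R \<in> profiles n D" and R': "R' \<in> profiles n D"
      and eq: "\<forall>i\<in>{1..n}. restrict_rel (R i) (outcomes_on X) = restrict_rel (R' i) (outcomes_on X)"
    \<comment> \<open>A positive factor between entries in -1, 0, 1 can only relate equal entries.
      So the normalized intensities on \<open>X\<close> are determined by the relation on
      \<open>X\<close>, which makes their sum independent of the other alternatives.\<close>
    have "sg (R' i) a b = sg (R i) a b" if i: "i \<in> {1..n}" and ab: "a \<in> X" "b \<in> X" for i a b
    proof -
      obtain c where "c > 0" "\<forall>a\<in>X. \<forall>b\<in>X. sg (R' i) a b = c * sg (R i) a b"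
        using eq i restrict_rel_iff[OF RD[OF R i] RD[OF R' i], of X] by blast
      then have "sgn (sg (R' i) a b) = sgn (sg (R i) a b)" using ab by (simp add: sgn_mult)
      then show ?thesis by (simp only: sgn_unit[OF sg_values])
    qed
    then have "\<forall>a\<in>X. \<forall>b\<in>X. m R' a b = 1 * m R a b" by (simp add: m_def)
    then have "\<exists>c>0. \<forall>a\<in>X. \<forall>b\<in>X. m R' a b = c * m R a b" using zero_less_one by blast
    then show "restrict_rel (f R) (outcomes_on X) = restrict_rel (f R') (outcomes_on X)"
      unfolding restrict_rel_iff[OF fR[OF R] fR[OF R']] .
  qed
  ultimately show "arrovian n D f" by (simp add: arrovian_def)
qed

end
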